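(* Let $2\le n<d$ be integers and let $\Gamma=\langle M_{d;\alpha_0,\dots,\alpha_n}\rangle\subset\mathrm{GL}(n+1,\mathbb{K})$ be a cyclic group of order $d$ as in the context. Let $\mathrm{reg}(R^{\overline{\Gamma}})$ denote the Castelnuovo–Mumford regularity of the ring $R^{\overline{\Gamma}}$. Then $$n\le\mathrm{reg}(R^{\overline{\Gamma}})\le n+1,$$ and the equality $\mathrm{reg}(R^{\overline{\Gamma}})=n+1$ holds if and only if $\mathcal{C}_{d,1}\neq\emptyset$.
   Context: $\mathbb{K}$ is an algebraically closed field of characteristic zero and $R=\mathbb{K}[x_0,\dots,x_n]$. Fix $e\in\mathbb{K}$ a primitive $d$-th root of $1$, and integers $0\le\alpha_0\le\cdots\le\alpha_n<d$ with $\mathrm{GCD}(d,\alpha_0,\dots,\alpha_n)=1$ and $\alpha_i<\alpha_j$ for some $i\ne j$. $M_{d;\alpha_0,\dots,\alpha_n}$ is the diagonal matrix $\mathrm{diag}(e^{\alpha_0},\dots,e^{\alpha_n})$, acting on $R$ by $x_i\mapsto e^{\alpha_i}x_i$. $\overline{\Gamma}\subset\mathrm{GL}(n+1,\mathbb{K})$ is the finite abelian group of order $d^2$ generated by $M_{d;\alpha_0,\dots,\alpha_n}$ and $\mathrm{diag}(e,\dots,e)$. Its ring of invariants $R^{\overline{\Gamma}}$ is spanned over $\mathbb{K}$ by the monomials $x_0^{a_0}\cdots x_n^{a_n}$ with $a_0+\cdots+a_n\equiv 0\pmod d$ and $\alpha_0a_0+\cdots+\alpha_na_n\equiv 0\pmod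 d$, and it is graded by $R^{\overline{\Gamma}}_t=R^{\overline{\Gamma}}\cap R_{td}$. Let $m_1,\dots,m_{\mu_d}$ be all the monomials of degree $d$ invariant under $\Gamma$; they generate $R^{\overline{\Gamma}}$ as a $\mathbb{K}$-algebra. Let $X_d\subset\mathbb{P}^{\mu_d-1}$ be the image of $\mathbb{P}^n$ under the morphism $(m_1,\dots,m_{\mu_d})$, let $S=\mathbb{K}[w_1,\dots,w_{\mu_d}]$, and let $\mathrm{I}(X_d)\subset S$ be the homogeneous ideal of $X_d$, i.e. the kernel of $S\to R$, $w_i\mapsto m_i$. Then $R^{\overline{\Gamma}}\cong S/\mathrm{I}(X_d)$ is the homogeneous coordinate ring of $X_d$. $\mathcal{C}_{d,1}$ is the set of all monomials $x_0^{a_0}\cdots x_n^{a_n}\in R^{\overline{\Gamma}}$ of degree $d$ (in the variables $x_0,\dots,x_n$) with $a_0\cdots a_n\neq0$.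
   Formalization: The regularity is taken to be that of X_d, i.e. of the ideal I(X_d), which is one more than the regularity of the ring S/I(X_d); for the latter the bounds fail: n=2, d=3, α=(0,1,2) gives K[w1,..,w4]/(w4^3-w1w2w3), of regularity 2, though C_{3,1} is nonempty. *)

theory Defs
  imports
    "HOL-Library.Poly_Mapping"
    "HOL-Library.Extended_Real"
    "HOL-Computational_Algebra.Polynomial"
    "HOL-Algebra.Generated_Groups"
    "Jordan_Normal_Form.Matrix"
begin

section \<open>Polynomials in several variables\<close>

text \<open>
  A monomial with variables in \<^typ>\<open>'v\<close> is its exponent vector \<^typ>\<open>'v \<Rightarrow>\<^sub>0 nat\<close>; the ring
  structure on \<^typ>\<open>('v \<Rightarrow>\<^sub>0 nat) \<Rightarrow>\<^sub>0 'a\<close> is the convolution product of the library.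
  The polynomial ring in a set \<open>V\<close> of variables is a subset of this type.
\<close>

type_synonym ('v, 'a) mpoly = "('v \<Rightarrow>\<^sub>0 nat) \<Rightarrow>\<^sub>0 'a"

abbreviation Mon :: "('v \<Rightarrow>\<^sub>0 nat) \<Rightarrow> ('v, 'a::comm_ring_1) mpoly" where
  "Mon m \<equiv> Poly_Mapping.single m 1"

abbreviation Const :: "'a::comm_ring_1 \<Rightarrow> ('v, 'a) mpoly" where
  "Const c \<equiv> Poly_Mapping.single 0 c"

abbreviation Var :: "'v \<Rightarrow> ('v, 'a::comm_ring_1) mpoly" where
  "Var v \<equiv> Mon (Poly_Mapping.single v 1)"

definition mdeg :: "('v \<Rightarrow>\<^sub>0 nat) \<Rightarrow> nat" where
  "mdeg m = (\<Sum>v\<in>Poly_Mapping.keys m. Poly_Mapping.lookup m v)"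

definition polys :: "'v set \<Rightarrow> ('v, 'a::comm_ring_1) mpoly set" where
  "polys V = {p. \<forall>m\<in>Poly_Mapping.keys p. Poly_Mapping.keys m \<subseteq> V}"

text \<open>The \<open>\<bbbK>\<close>-algebra homomorphism sending each variable \<open>v\<close> to \<open>\<sigma> v\<close>.\<close>

definition subst :: "('v \<Rightarrow> ('w, 'a::comm_ring_1) mpoly) \<Rightarrow> ('v, 'a) mpoly \<Rightarrow> ('w, 'a) mpoly" where
  "subst \<sigma> p = (\<Sum>m\<in>Poly_Mapping.keys p. Const (Poly_Mapping.lookup p m) *
      (\<Prod>v\<in>Poly_Mapping.keys m. \<sigma> v ^ Poly_Mapping.lookup m v))"


section \<open>Castelnuovo--Mumford regularity\<close>

definition free_mod :: "'v set \<Rightarrow> nat \<Rightarrow> ('v, 'a::comm_ring_1) mpoly vec set" where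
  "free_mod V r = {v \<in> carrier_vec r. \<forall>j<r. v $ j \<in> polys V}"

text \<open>
  A minimal graded free resolution \<open>\<dots> \<rightarrow> F\<^sub>1 \<rightarrow> F\<^sub>0 \<rightarrow> I \<rightarrow> 0\<close> of a homogeneous ideal \<open>I\<close> of
  \<open>S = \<bbbK>[V]\<close>, where \<open>F\<^sub>i\<close> is the direct sum of the \<open>S(- a i j)\<close> for \<open>j < b i\<close>.
  The map \<open>F\<^sub>0 \<rightarrow> I\<close> is given by the row \<open>g\<close> of generators and
  \<open>F\<^bsub>i+1\<^esub> \<rightarrow> F\<^sub>i\<close> by the matrix \<open>D i\<close>. Both are of degree 0: \<open>g $ j\<close> is a form of degree
  \<open>a 0 j\<close> and \<open>D i $$ (j, k)\<close> is a form of degree \<open>a (i+1) k - a i j\<close>, hence zero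
  if that number is negative. Minimality: the entries of every \<open>D i\<close> lie in the irrelevant ideal.
  The indices \<open>i\<close> run over all natural numbers; a finite resolution has \<open>b i = 0\<close> for large \<open>i\<close>.
\<close>

definition minimal_graded_free_resolution ::
  "'v set \<Rightarrow> ('v, 'a::comm_ring_1) mpoly set \<Rightarrow> (nat \<Rightarrow> nat) \<Rightarrow> (nat \<Rightarrow> nat \<Rightarrow> nat) \<Rightarrow>
    ('v, 'a) mpoly vec \<Rightarrow> (nat \<Rightarrow> ('v, 'a) mpoly mat) \<Rightarrow> bool" where
  "minimal_graded_free_resolution V I b a g D \<longleftrightarrow>
     g \<in> free_mod V (b 0) \<and>
     (\<forall>j<b 0. \<forall>m\<in>Poly_Mapping.keys (g $ j). mdeg m = a 0 j) \<and>
     (\<forall>i. D i \<in> carrier_mat (b i) (b (Suc i)) \<and>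
       (\<forall>j<b i. \<forall>k<b (Suc i).
          D i $$ (j, k) \<in> polys V \<and>
          (\<forall>m\<in>Poly_Mapping.keys (D i $$ (j, k)). mdeg m + a i j = a (Suc i) k) \<and>
          Poly_Mapping.lookup (D i $$ (j, k)) 0 = 0)) \<and>
     (\<lambda>v. g \<bullet> v) ` free_mod V (b 0) = I \<and>
     {v \<in> free_mod V (b 0). g \<bullet> v = 0} = (\<lambda>w. D 0 *\<^sub>v w) ` free_mod V (b 1) \<and>
     (\<forall>i. {v \<in> free_mod V (b (Suc i)). D i *\<^sub>v v = 0\<^sub>v (b i)} =
          (\<lambda>w. D (Suc i) *\<^sub>v w) ` free_mod V (b (Suc (Suc i))))"

text \<open>
  The maximum of all \<open>a i j - i\<close>. A minimal graded free resolution is unique up to isomorphism, so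
  it does not matter that the supremum ranges over all of them. It is taken in \<^typ>\<open>ereal\<close>,
  so that it is \<open>-\<infinity>\<close> if there is no resolution and \<open>\<infinity>\<close> if the numbers are unbounded.
\<close>

definition ideal_regularity :: "'v set \<Rightarrow> ('v, 'a::comm_ring_1) mpoly set \<Rightarrow> ereal" where
  "ideal_regularity V I = Sup {ereal (real (a i j) - real i) | a i j.
     \<exists>b g D. minimal_graded_free_resolution V I b a g D \<and> j < b i}"

definition presentation_kernel ::
  "'v set \<Rightarrow> ('v \<Rightarrow> ('w, 'a::comm_ring_1) mpoly) \<Rightarrow> ('v, 'a) mpoly set" where
  "presentation_kernel V \<sigma> = {p \<in> polys V. subst \<sigma> p = 0}"

text \<open>
  The regularity of the homogeneous coordinate ring \<open>A = S/I(X)\<close> of \<open>X \<subseteq> \<bbbP>(S)\<close>,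
  presented by \<open>S = \<bbbK>[V] \<rightarrow> A\<close>, \<open>v \<mapsto> \<sigma> v\<close>.
  Convention: this is the regularity of \<open>X\<close> in the sense of Mumford, that is, the regularity of
  the ideal \<open>I(X)\<close>. For \<open>I(X) \<noteq> 0\<close> it exceeds the regularity of \<open>S/I(X)\<close> as an \<open>S\<close>-module by 1:
  in the former the module of first syzygies of \<open>A\<close> has homological degree 0.
  For instance, the cubic surface \<open>w\<^sub>4^3 = w\<^sub>1 w\<^sub>2 w\<^sub>3\<close> has regularity 3.
  A value is specified only if the image of \<open>S\<close> is all of \<open>A\<close>.
\<close>

definition coordinate_ring_regularity ::
  "'v set \<Rightarrow> ('v \<Rightarrow> ('w, 'a::comm_ring_1) mpoly) \<Rightarrow> ('w, 'a) mpoly set \<Rightarrow> ereal" where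
  "coordinate_ring_regularity V \<sigma> A =
     (if subst \<sigma> ` polys V = A then ideal_regularity V (presentation_kernel V \<sigma>) else undefined)"


section \<open>The groups and their invariants\<close>

text \<open>A matrix \<open>A\<close> acts on \<open>\<bbbK>[x\<^sub>0, \<dots>, x\<^sub>n]\<close> by \<open>x\<^sub>i \<mapsto> \<Sum>\<^sub>j A\<^sub>i\<^sub>j x\<^sub>j\<close>.\<close>

definition mat_act :: "'a::comm_ring_1 mat \<Rightarrow> (nat, 'a) mpoly \<Rightarrow> (nat, 'a) mpoly" where
  "mat_act A = subst (\<lambda>i. \<Sum>j<dim_col A. Const (A $$ (i, j)) * Var j)"

definition invariant_ring :: "nat \<Rightarrow> 'a::comm_ring_1 mat set \<Rightarrow> (nat, 'a) mpoly set" where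
  "invariant_ring n G = {f \<in> polys {..n}. \<forall>A\<in>G. mat_act A f = f}"

abbreviation GL :: "nat \<Rightarrow> 'a::comm_ring_1 mat monoid" where
  "GL N \<equiv> units_of (ring_mat TYPE('a) N ())"

definition Gamma :: "nat \<Rightarrow> 'a::comm_ring_1 \<Rightarrow> (nat \<Rightarrow> nat) \<Rightarrow> 'a mat set" where
  "Gamma n e \<alpha> = generate (GL (Suc n)) {mat_diag (Suc n) (\<lambda>i. e ^ \<alpha> i)}"

definition Gamma_bar :: "nat \<Rightarrow> 'a::comm_ring_1 \<Rightarrow> (nat \<Rightarrow> nat) \<Rightarrow> 'a mat set" where
  "Gamma_bar n e \<alpha> =
     generate (GL (Suc n)) {mat_diag (Suc n) (\<lambda>i. e ^ \<alpha> i), mat_diag (Suc n) (\<lambda>_. e)}"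

definition invariant_monomials :: "nat \<Rightarrow> nat \<Rightarrow> 'a::comm_ring_1 mat set \<Rightarrow> (nat \<Rightarrow>\<^sub>0 nat) set" where
  "invariant_monomials n d G = {m. (Mon m :: (nat, 'a) mpoly) \<in> invariant_ring n G \<and> mdeg m = d}"

text \<open>
  The ring \<open>S\<close> has one variable \<open>w\<^sub>m\<close> for each monomial \<open>m\<close> of degree \<open>d\<close> invariant under \<open>\<Gamma>\<close>;
  the variable is \<open>m\<close> itself, so the presentation \<open>w\<^sub>m \<mapsto> m\<close> is \<^term>\<open>Mon\<close>.
\<close>

definition reg_invariant_ring :: "nat \<Rightarrow> nat \<Rightarrow> 'a::comm_ring_1 \<Rightarrow> (nat \<Rightarrow> nat) \<Rightarrow> ereal" where
  "reg_invariant_ring n d e \<alpha> =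
     coordinate_ring_regularity (invariant_monomials n d (Gamma n e \<alpha>)) Mon
       (invariant_ring n (Gamma_bar n e \<alpha>))"

definition C_d1 :: "nat \<Rightarrow> nat \<Rightarrow> 'a::comm_ring_1 \<Rightarrow> (nat \<Rightarrow> nat) \<Rightarrow> (nat \<Rightarrow>\<^sub>0 nat) set" where
  "C_d1 n d e \<alpha> = {m \<in> invariant_monomials n d (Gamma_bar n e \<alpha>).
     (\<Prod>i\<le>n. Poly_Mapping.lookup m i) \<noteq> 0}"

definition primitive_root :: "nat \<Rightarrow> 'a::comm_ring_1 \<Rightarrow> bool" where
  "primitive_root d e \<longleftrightarrow> e ^ d = 1 \<and> (\<forall>k. 0 < k \<and> k < d \<longrightarrow> e ^ k \<noteq> 1)"

end

theory Submission
  imports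
    Defs
    "HOL-Library.Disjoint_Sets"
    "HOL-Library.Function_Algebras"
    "HOL-Number_Theory.Cong"
begin

text \<open>
  The ring \<open>A\<close> of invariants is a free module over \<open>\<bbbK>[x\<^sub>0^d, \<dots>, x\<^sub>n^d]\<close>, and a basis is given by the
  invariant monomials with all exponents below \<open>d\<close>. So the \<open>n + 1\<close> variables \<open>\<theta>\<^sub>i\<close> of \<open>S\<close> that map to the
  \<open>x\<^sub>i^d\<close> form a regular sequence on \<open>A\<close>, and \<open>A/\<theta>A\<close> has a top degree \<open>t\<close>. Given a minimal resolution
  \<open>C\<close> of \<open>A\<close> over \<open>S\<close>, set the variables of \<open>S\<close> to zero one at a time, the \<open>\<theta>\<^sub>i\<close> first. The long exact
  sequence for one variable shows that the homology of \<open>C\<close> modulo \<open>\<theta>\<close> and any further variables vanishes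
  at position \<open>i\<close> in degrees above \<open>i + t\<close>, and that after \<open>k\<close> further variables it does not vanish at position \<open>k\<close>
  in degree \<open>k + t\<close>. When all variables are zero, minimality identifies the homology with the generators of \<open>C\<close>.
  Hence the regularity of the ideal is \<open>t + 1\<close>. The same argument bounds the degrees of the syzygies of a
  partial resolution, which gives their finite generation.

  The complement \<open>a\<^sub>i \<mapsto> d - a\<^sub>i\<close> shows that \<open>t = n\<close> if there is an invariant monomial of degree \<open>d\<close> in
  which all variables occur, and that \<open>t < n\<close> otherwise. The Erdos--Ginzburg--Ziv theorem provides both the
  generation of \<open>A\<close> in degree \<open>d\<close> and a reduced invariant monomial of degree \<open>(n - 1)d\<close>, so that \<open>t \<ge> n - 1\<close>.
\<close>

section \<open>The Erdos--Ginzburg--Ziv theorem\<close>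

text \<open>The value \<open>t + 1\<close> contains an index shift: the complexes below resolve
  \<open>S/I(X)\<close> and start with \<open>F 0 = S\<close>, whereas
  \<open>ideal_regularity\<close> counts from the generators of the ideal. The generator attaining
  it sits at position \<open>card (V - Th)\<close>, because each variable outside \<open>Th\<close>
  raises position and degree of a surviving class by one. The class survives since multiplication by
  the next variable sends it into a degree where homology already vanishes. The obstacle is the
  lower bound. The supremum ranges over resolutions with all modules of finite rank, so one has to
  be constructed before its ranks are known to be finite. This is why the exactness hypotheses carry
  a degree bound \<open>D\<close>: in a complex that is exact up to \<open>D\<close>, the generators
  of degree at most \<open>D\<close> at position i have degree at most i + t, a bound that does not
  mention \<open>D\<close>.\<close>

lemma closed_translation_full:
  fixes p \<delta> :: nat
  assumes p: "prime p" "\<not> p dvd \<delta>" and S: "S \<subseteq> {..<p}" "S \<noteq> {}"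
    and closed: "\<And>s. s \<in> S \<Longrightarrow> (s + \<delta>) mod p \<in> S"
  shows "S = {..<p}"
proof
  obtain s where s: "s \<in> S" using S by blast
  have iter: "(s + j * \<delta>) mod p \<in> S" for j
  proof (induction j)
    case 0
    then show ?case using s S by (auto simp: subset_iff)
  next
    case (Suc j)
    have "((s + j * \<delta>) mod p + \<delta>) mod p = (s + Suc j * \<delta>) mod p"
      unfolding mod_add_left_eq by (simp add: ac_simps)
    then show ?case using closed[OF Suc] by metis
  qed
  have "coprime \<delta> p" using prime_imp_coprime[OF p] by (simp add: coprime_commute)
  then obtain y where y: "[\<delta> * y = 1] (mod p)" using cong_solve_coprime_nat by auto
  show "{..<p} \<subseteq> S"
  proof
    fix r assume r: "r \<in> {..<p}"
    \<comment> \<open>The solution of s + j \<delta> = r modulo \<open>p\<close>: \<open>y\<close>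
      inverts \<delta>, and \<open>(p - 1) * s\<close> stands for -s.\<close>
    let ?j = "y * (r + (p - 1) * s)"
    have "[s + ?j * \<delta> = s + (\<delta> * y) * (r + (p - 1) * s)] (mod p)" by (simp add: ac_simps)
    also have "[s + (\<delta> * y) * (r + (p - 1) * s) = s + 1 * (r + (p - 1) * s)] (mod p)"
      using y by (intro cong_add cong_mult) auto
    also have "s + 1 * (r + (p - 1) * s) = r + p * s"
    proof -
      have "p = Suc (p - 1)" using p(1) prime_gt_0_nat by simp
      then have "p * s = s + (p - 1) * s" by (metis mult_Suc)
      then show ?thesis by simp
    qed
    also have "[r + p * s = r] (mod p)" by (simp add: cong_def)
    finally have "(s + ?j * \<delta>) mod p = r" using r by (simp add: cong_def)
    then show "r \<in> S" using iter by metis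
  qed
qed (use S in auto)

text \<open>Cauchy-Davenport for two-element sets. The sums with one more pair contain two
  translates of the old set. If the second leaves the first, a residue is gained; otherwise the old
  set is closed under translation by \<open>B k - A k\<close>, which is nonzero modulo
  \<open>p\<close>, and is already everything.\<close>

lemma two_choice_sums_cover:
  fixes p :: nat
  assumes p: "prime p" and AB: "\<And>i. i < k \<Longrightarrow> A i mod p \<noteq> B i mod p"
  shows "min p (k + 1) \<le> card {(\<Sum>i<k. if c i then A i else B i) mod p | c :: nat \<Rightarrow> bool. True}"
  using AB
proof (induction k)
  case 0
  have "p > 0" using p prime_gt_0_nat by blast
  then show ?case by simp
next
  case (Suc k)
  define R where "R k = {(\<Sum>i<k. if c i then A i else B i) mod p | c :: nat \<Rightarrow> bool. True}" for k
  have p0: "p > 0" using p prime_gt_0_nat by blast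
  have RS: "R k \<subseteq> {..<p}" for k using p0 by (auto simp: R_def)
  have fin: "finite (R k)" for k using RS finite_subset by blast
  have ne: "R k \<noteq> {}" by (auto simp: R_def)
  have IH: "min p (k + 1) \<le> card (R k)" using Suc unfolding R_def by simp
  define sh where "sh a = (\<lambda>s. (s + a) mod p) ` R k" for a
  have inj: "inj_on (\<lambda>s. (s + a) mod p) (R k)" for a
  proof (rule inj_onI)
    fix s t assume "s \<in> R k" "t \<in> R k" "(s + a) mod p = (t + a) mod p"
    then have "[s = t] (mod p)" "s < p" "t < p"
      using RS cong_add_rcancel_nat unfolding cong_def by (blast+)
    then show "s = t" by (simp add: cong_def)
  qed
  have cs: "card (sh a) = card (R k)" for a unfolding sh_def using inj by (rule card_image)
  have fs: "finite (sh a)" for a unfolding sh_def using fin by simp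
  have subA: "sh (A k) \<subseteq> R (Suc k)" and subB: "sh (B k) \<subseteq> R (Suc k)"
  proof -
    have ext: "((\<Sum>i<k. if c i then A i else B i) mod p + (if b then A k else B k)) mod p \<in> R (Suc k)"
      for c :: "nat \<Rightarrow> bool" and b
    proof -
      have "((\<Sum>i<k. if c i then A i else B i) mod p + (if b then A k else B k)) mod p =
        (\<Sum>i<Suc k. if (c(k := b)) i then A i else B i) mod p"
        unfolding mod_add_left_eq by simp
      then show ?thesis unfolding R_def by blast
    qed
    show "sh (A k) \<subseteq> R (Suc k)" "sh (B k) \<subseteq> R (Suc k)"
      using ext[where b = True] ext[where b = False] by (auto simp: sh_def R_def[of k])
  qed
  show ?case
  proof (cases "sh (B k) \<subseteq> sh (A k)")
    case True
    \<comment> \<open>This represents \<open>B k - A k\<close> modulo \<open>p\<close> without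
      subtracting below zero.\<close>
    define \<delta> where "\<delta> = B k + (p - A k mod p)"
    have "R k = {..<p}"
    proof (rule closed_translation_full[OF p _ RS ne])
      show "\<not> p dvd \<delta>"
      proof
        assume "p dvd \<delta>"
        then have "[B k + (p - A k mod p) + A k mod p = 0 + A k mod p] (mod p)"
          unfolding \<delta>_def by (intro cong_add) (auto simp: cong_0_iff)
        moreover have "B k + (p - A k mod p) + A k mod p = B k + p"
          using mod_less_divisor[OF p0, of "A k"] by linarith
        ultimately show False using Suc.prems[of k] by (simp add: cong_def)
      qed
      fix s assume s: "s \<in> R k"
      then obtain s' where s': "s' \<in> R k" "(s + B k) mod p = (s' + A k) mod p"
        using True by (auto simp: sh_def)
      have "[s + \<delta> = s + B k + (p - A k mod p)] (mod p)"
        by (simp only: \<delta>_def add.assoc cong_refl)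
      also have "[s + B k + (p - A k mod p) = s' + A k + (p - A k mod p)] (mod p)"
        using s'(2) by (intro cong_add[OF _ cong_refl]) (simp add: cong_def)
      also have "[s' + A k + (p - A k mod p) = s' + A k mod p + (p - A k mod p)] (mod p)"
        by (intro cong_add) (auto simp: cong_def)
      also have "s' + A k mod p + (p - A k mod p) = s' + p" using p0 by (simp add: order_less_imp_le)
      finally have "(s + \<delta>) mod p = s' mod p" by (simp add: cong_def)
      also have "\<dots> = s'" using s'(1) RS by fastforce
      finally show "(s + \<delta>) mod p \<in> R k" using s'(1) by simp
    qed
    then have "card (sh (A k)) = p" using cs by simp
    then have "p \<le> card (R (Suc k))" using card_mono[OF fin subA] by simp
    then show ?thesis unfolding R_def by simp
  next
    case False
    then obtain y where y: "y \<in> sh (B k)" "y \<notin> sh (A k)" by blast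
    have "card (insert y (sh (A k))) \<le> card (R (Suc k))"
      using y subA subB by (intro card_mono[OF fin]) auto
    then have "Suc (card (R k)) \<le> card (R (Suc k))" using y fs cs by simp
    then show ?thesis using IH unfolding R_def by simp
  qed
qed

text \<open>Index sets are fixed to be sets of naturals so that the property depends on
  \<open>m\<close> alone; the last theorem transfers it to any index type.\<close>

definition EGZ :: "nat \<Rightarrow> bool" where
  "EGZ m \<longleftrightarrow> (\<forall>(J :: nat set) f :: nat \<Rightarrow> nat. finite J \<longrightarrow> 2 * m - 1 \<le> card J \<longrightarrow>
     (\<exists>K\<subseteq>J. card K = m \<and> m dvd sum f K))"

text \<open>Sort by residue and pair entry \<open>i\<close> with entry \<open>i + p - 1\<close>. If
  a pair has equal residues, so do the \<open>p\<close> entries between them, and their sum is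
  divisible by \<open>p\<close>. Otherwise the choices from the \<open>p - 1\<close> pairs reach
  every residue, in particular the negative of the one entry left over.\<close>

lemma EGZ_prime:
  assumes p: "prime p"
  shows "EGZ p"
  unfolding EGZ_def
proof (intro allI impI)
  fix J :: "nat set" and f :: "nat \<Rightarrow> nat"
  assume J: "finite J" "2 * p - 1 \<le> card J"
  have p1: "p > 1" using p prime_gt_1_nat by blast
  define xs where "xs = sort_key (\<lambda>j. f j mod p) (sorted_list_of_set J)"
  have xs: "set xs = J" "distinct xs" "sorted (map (\<lambda>j. f j mod p) xs)"
    using J by (simp_all add: xs_def)
  have len: "length xs = card J" using xs distinct_card by metis
  have inj: "inj_on ((!) xs) I" if "I \<subseteq> {..<length xs}" for I
    using that by (intro inj_on_nth[OF xs(2)]) auto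
  have sub: "(!) xs ` I \<subseteq> J" if "I \<subseteq> {..<length xs}" for I
    using that xs(1) nth_mem by fastforce
  show "\<exists>K\<subseteq>J. card K = p \<and> p dvd sum f K"
  proof (cases "\<exists>i<p-1. f (xs ! i) mod p = f (xs ! (i + p - 1)) mod p")
    case True
    then obtain i where i: "i < p - 1" "f (xs ! i) mod p = f (xs ! (i + p - 1)) mod p" by blast
    define I where "I = {i..<i+p}"
    have I: "I \<subseteq> {..<length xs}" using i J len by (auto simp: I_def)
    have same: "f (xs ! k) mod p = f (xs ! i) mod p" if "k \<in> I" for k
    proof -
      have k: "i \<le> k" "k \<le> i + p - 1" "i + p - 1 < length xs"
        using that I i p1 J len by (auto simp: I_def)
      have "f (xs ! i) mod p \<le> f (xs ! k) mod p" "f (xs ! k) mod p \<le> f (xs ! (i + p - 1)) mod p"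
        using sorted_nth_mono[OF xs(3), of i k] sorted_nth_mono[OF xs(3), of k "i + p - 1"] k by auto
      then show ?thesis using i by simp
    qed
    have "sum f ((!) xs ` I) = (\<Sum>k\<in>I. f (xs ! k))"
      using inj[OF I] by (simp add: sum.reindex)
    also have "[\<dots> = (\<Sum>k\<in>I. f (xs ! i))] (mod p)"
      using same by (intro cong_sum) (simp add: cong_def)
    also have "(\<Sum>k\<in>I. f (xs ! i)) = p * f (xs ! i)" by (simp add: I_def)
    finally have "p dvd sum f ((!) xs ` I)" by (simp add: cong_def dvd_eq_mod_eq_0)
    moreover have "card ((!) xs ` I) = p" using inj[OF I] by (simp add: card_image I_def)
    ultimately show ?thesis using sub[OF I] by blast
  next
    case False
    define A where "A i = f (xs ! i)" for i
    define B where "B i = f (xs ! (i + p - 1))" for i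
    \<comment> \<open>The pairs occupy the positions below 2p - 2, so this entry belongs to none of
      them.\<close>
    define l where "l = f (xs ! (2 * p - 2))"
    define R where "R = {(\<Sum>i<p-1. if c i then A i else B i) mod p | c :: nat \<Rightarrow> bool. True}"
    have "p \<le> card R"
      using two_choice_sums_cover[OF p, of "p - 1" A B] False p1 by (auto simp: R_def A_def B_def)
    moreover have "R \<subseteq> {..<p}" using p1 by (auto simp: R_def)
    ultimately have "R = {..<p}" by (metis card_lessThan card_seteq finite_lessThan)
    moreover have "(p - l mod p) mod p \<in> {..<p}" using p1 by simp
    ultimately have "(p - l mod p) mod p \<in> R" by simp
    then obtain c :: "nat \<Rightarrow> bool" where
      c: "(\<Sum>i<p-1. if c i then A i else B i) mod p = (p - l mod p) mod p"
      unfolding R_def mem_Collect_eq by metis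
    define g where "g i = (if c i then i else i + p - 1)" for i
    have ginj: "inj_on g {..<p-1}" by (auto simp: inj_on_def g_def split: if_splits)
    define I where "I = insert (2 * p - 2) (g ` {..<p-1})"
    have I: "I \<subseteq> {..<length xs}" using J len p1 by (auto simp: I_def g_def)
    have nin: "2 * p - 2 \<notin> g ` {..<p-1}" by (auto simp: g_def split: if_splits)
    have "sum f ((!) xs ` I) = (\<Sum>k\<in>I. f (xs ! k))"
      using inj[OF I] by (simp add: sum.reindex)
    also have "\<dots> = l + (\<Sum>k\<in>g ` {..<p-1}. f (xs ! k))"
      using nin by (simp add: I_def l_def)
    also have "(\<Sum>k\<in>g ` {..<p-1}. f (xs ! k)) = (\<Sum>i<p-1. if c i then A i else B i)"
      unfolding sum.reindex[OF ginj] by (intro sum.cong) (auto simp: g_def A_def B_def)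
    finally have s: "sum f ((!) xs ` I) = l + (\<Sum>i<p-1. if c i then A i else B i)" .
    have "[sum f ((!) xs ` I) = l mod p + (p - l mod p)] (mod p)"
      unfolding s using c by (intro cong_add) (auto simp: cong_def)
    also have "l mod p + (p - l mod p) = p" using p1 by (simp add: order_less_imp_le)
    finally have "p dvd sum f ((!) xs ` I)" by (simp add: cong_def dvd_eq_mod_eq_0)
    moreover have "card ((!) xs ` I) = p"
      using inj[OF I] nin ginj p1 by (simp add: card_image I_def)
    ultimately show ?thesis using sub[OF I] by blast
  qed
qed

text \<open>Greedy choice: from (k + 1)p + p - 1 indices, removing \<open>k\<close> blocks of size
  \<open>p\<close> leaves 2p - 1, enough for one more block.\<close>

lemma EGZ_disjoint_family:
  assumes "EGZ p" "finite J" "k * p + p - 1 \<le> card J" "p > 0"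
  shows "\<exists>P :: nat \<Rightarrow> nat set. (\<forall>i<k. P i \<subseteq> J \<and> card (P i) = p \<and> p dvd sum f (P i)) \<and>
    disjoint_family_on P {..<k}"
  using assms(3)
proof (induction k)
  case 0
  then show ?case by (simp add: disjoint_family_on_def)
next
  case (Suc k)
  then obtain P where P: "\<forall>i<k. P i \<subseteq> J \<and> card (P i) = p \<and> p dvd sum f (P i)"
    "disjoint_family_on P {..<k}" by force
  define Q where "Q = J - (\<Union>i<k. P i)"
  have finP: "finite (P i)" if "i < k" for i using P that assms(2) finite_subset by blast
  have "card (\<Union>i<k. P i) \<le> (\<Sum>i<k. card (P i))" by (rule card_UN_le) simp
  also have "\<dots> = k * p" using P by simp
  finally have "card (\<Union>i<k. P i) \<le> k * p" .
  moreover have "card Q = card J - card (\<Union>i<k. P i)"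
    unfolding Q_def using P(1) finP by (intro card_Diff_subset) auto
  moreover have "(Suc k) * p + p - 1 = k * p + (2 * p - 1)" using assms(4) by simp
  ultimately have "2 * p - 1 \<le> card Q" using Suc.prems by linarith
  moreover have "finite Q" using assms by (simp add: Q_def)
  ultimately obtain K where K: "K \<subseteq> Q" "card K = p" "p dvd sum f K"
    using assms(1) unfolding EGZ_def by blast
  have "disjoint_family_on (P(k := K)) {..<Suc k}"
    using P(2) K(1) unfolding disjoint_family_on_def Q_def by (auto simp: less_Suc_eq) blast+
  moreover have "\<forall>i<Suc k. (P(k := K)) i \<subseteq> J \<and> card ((P(k := K)) i) = p \<and> p dvd sum f ((P(k := K)) i)"
    using P K unfolding Q_def by (auto simp: less_Suc_eq)
  ultimately show ?case by blast
qed

text \<open>Cut out 2m - 1 disjoint blocks of size \<open>p\<close> with sums divisible by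
  \<open>p\<close>, then apply the property of \<open>m\<close> to the block sums divided by
  \<open>p\<close>.\<close>

lemma EGZ_mult:
  assumes p: "EGZ p" "p > 0" and m: "EGZ m" "m > 0"
  shows "EGZ (p * m)"
  unfolding EGZ_def
proof (intro allI impI)
  fix J :: "nat set" and f :: "nat \<Rightarrow> nat"
  assume J: "finite J" "2 * (p * m) - 1 \<le> card J"
  have "(2 * m - 1) * p + p = 2 * (p * m)"
    using m(2) by (cases m) (simp_all add: algebra_simps)
  then have "(2 * m - 1) * p + p - 1 \<le> card J" using J by simp
  then obtain P where P: "\<And>i. i < 2 * m - 1 \<Longrightarrow> P i \<subseteq> J \<and> card (P i) = p \<and> p dvd sum f (P i)"
    "disjoint_family_on P {..<2 * m - 1}"
    using EGZ_disjoint_family[OF p(1) J(1) _ p(2)] by blast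
  obtain L where L: "L \<subseteq> {..<2 * m - 1}" "card L = m" "m dvd sum (\<lambda>i. sum f (P i) div p) L"
    using m(1)[unfolded EGZ_def, rule_format, of "{..<2 * m - 1}"] by auto
  have fL: "finite L" using L finite_subset by blast
  have fP: "\<forall>i\<in>L. finite (P i)" using P(1) L(1) J(1) finite_subset by blast
  have dj: "\<forall>i\<in>L. \<forall>j\<in>L. i \<noteq> j \<longrightarrow> P i \<inter> P j = {}"
    using P(2) L(1) unfolding disjoint_family_on_def by blast
  have "sum f (\<Union>i\<in>L. P i) = (\<Sum>i\<in>L. sum f (P i))"
    using fL fP dj by (rule sum.UNION_disjoint)
  also have "\<dots> = (\<Sum>i\<in>L. p * (sum f (P i) div p))"
    using P(1) L(1) by (intro sum.cong) auto
  also have "\<dots> = p * (\<Sum>i\<in>L. sum f (P i) div p)" by (simp add: sum_distrib_left)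
  finally have "p * m dvd sum f (\<Union>i\<in>L. P i)" using L(3) by simp
  moreover have "card (\<Union>i\<in>L. P i) = p * m"
  proof -
    have "card (\<Union>i\<in>L. P i) = (\<Sum>i\<in>L. card (P i))" using fL fP dj by (rule card_UN_disjoint)
    also have "\<dots> = (\<Sum>i\<in>L. p)" using P(1) L(1) by (intro sum.cong) auto
    finally show ?thesis using L(2) by (simp add: mult.commute)
  qed
  moreover have "(\<Union>i\<in>L. P i) \<subseteq> J" using P(1) L(1) by blast
  ultimately show "\<exists>K\<subseteq>J. card K = p * m \<and> p * m dvd sum f K" by blast
qed

lemma EGZ_all:
  assumes "m > 0"
  shows "EGZ m"
  using assms
proof (induction m rule: less_induct)
  case (less m)
  show ?case
  proof (cases "m = 1")
    case True
    show ?thesis unfolding EGZ_def True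
    proof (intro allI impI)
      fix J :: "nat set" and f :: "nat \<Rightarrow> nat"
      assume "finite J" "2 * 1 - 1 \<le> card J"
      then obtain j where "j \<in> J" by fastforce
      then show "\<exists>K\<subseteq>J. card K = 1 \<and> 1 dvd sum f K" by (intro exI[of _ "{j}"]) auto
    qed
  next
    case False
    then obtain p where p: "prime p" "p dvd m" using prime_factor_nat by blast
    then obtain k where k: "m = p * k" by blast
    have "p > 1" "k > 0" using p(1) prime_gt_1_nat k less.prems by (auto intro: gr0I)
    then have "EGZ k" using less k by simp
    then show ?thesis using EGZ_mult[OF EGZ_prime[OF p(1)]] k \<open>p > 1\<close> \<open>k > 0\<close> by simp
  qed
qed

theorem Erdos_Ginzburg_Ziv:
  fixes f :: "'j \<Rightarrow> nat"
  assumes "m > 0" "finite J" "2 * m - 1 \<le> card J"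
  shows "\<exists>K\<subseteq>J. card K = m \<and> m dvd sum f K"
proof -
  obtain h where h: "bij_betw h {0..<card J} J" using ex_bij_betw_nat_finite[OF assms(2)] by blast
  obtain L where L: "L \<subseteq> {0..<card J}" "card L = m" "m dvd sum (f \<circ> h) L"
    using EGZ_all[OF assms(1), unfolded EGZ_def, rule_format, of "{0..<card J}" "f \<circ> h"] assms(3) by auto
  have inj: "inj_on h L" using h L(1) by (meson bij_betw_def inj_on_subset)
  have "h ` L \<subseteq> J" using h L(1) by (auto simp: bij_betw_def)
  moreover have "card (h ` L) = m" using inj L(2) by (simp add: card_image)
  moreover have "m dvd sum f (h ` L)" using inj L(3) by (simp add: sum.reindex)
  ultimately show ?thesis by blast
qed

text \<open>The form in which Erdos-Ginzburg-Ziv acts on monomials: a monomial with exponents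
  \<open>u\<close> is the family in which \<alpha> i is repeated \<open>u i\<close> times, and
  \<open>w\<close> counts how often each index is selected.\<close>

lemma zero_sum_subvector:
  fixes \<alpha> u :: "nat \<Rightarrow> nat"
  assumes "d > 0" "2 * d - 1 \<le> (\<Sum>i\<le>n. u i)"
  shows "\<exists>w. (\<forall>i. w i \<le> u i) \<and> (\<forall>i>n. w i = 0) \<and> (\<Sum>i\<le>n. w i) = d \<and> d dvd (\<Sum>i\<le>n. \<alpha> i * w i)"
proof -
  define J where "J = (SIGMA i:{..n}. {..<u i})"
  have J: "finite J" "card J = (\<Sum>i\<le>n. u i)" by (simp_all add: J_def)
  then obtain K where K: "K \<subseteq> J" "card K = d" "d dvd sum (\<lambda>(i, _). \<alpha> i) K"
    using Erdos_Ginzburg_Ziv[OF assms(1), of J "\<lambda>(i, _). \<alpha> i"] assms(2) by auto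
  define w where "w i = card {k. (i, k) \<in> K}" for i
  have fin: "finite {k. (i, k) \<in> K}" for i
    by (rule finite_subset[of _ "{..<u i}"]) (use K(1) in \<open>auto simp: J_def\<close>)
  have KS: "K = (SIGMA i:{..n}. {k. (i, k) \<in> K})" using K(1) by (auto simp: J_def)
  have "w i \<le> u i" for i
  proof -
    have "{k. (i, k) \<in> K} \<subseteq> {..<u i}" using K(1) by (auto simp: J_def)
    then show ?thesis using card_mono[of "{..<u i}"] by (simp add: w_def)
  qed
  moreover have "w i = 0" if "i > n" for i
  proof -
    have "{k. (i, k) \<in> K} = {}" using K(1) that by (auto simp: J_def)
    then show ?thesis by (simp add: w_def)
  qed
  moreover have "(\<Sum>i\<le>n. w i) = d"
    using K(2) fin by (subst (asm) KS) (simp add: w_def)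
  moreover have "sum (\<lambda>(i, _). \<alpha> i) K = (\<Sum>i\<le>n. \<alpha> i * w i)"
    using fin by (subst KS, subst sum.Sigma[symmetric]) (auto simp: w_def mult.commute)
  ultimately show ?thesis using K(3) by metis
qed

section \<open>Complexes over a polynomial ring modulo variables\<close>

text \<open>
  \<open>C i c\<close> is the part of degree \<open>c\<close> at position \<open>i\<close>, and \<open>d i\<close> maps position \<open>i + 1\<close> to position \<open>i\<close>. The operator
  \<open>x v\<close> is multiplication by the variable \<open>v\<close>, and \<open>U W i c\<close> is the part of degree \<open>c\<close> of \<open>WC\<^sub>i\<close>.
  The quotient of \<open>Cyc W\<close> by \<open>Bd W\<close> is the homology of \<open>C/WC\<close>.
\<close>

locale graded_complex =
  fixes V :: "'v set"
    and C :: "nat \<Rightarrow> int \<Rightarrow> 'm::ab_group_add set"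
    and d :: "nat \<Rightarrow> 'm \<Rightarrow> 'm"
    and x :: "'v \<Rightarrow> 'm \<Rightarrow> 'm"
    and U :: "'v set \<Rightarrow> nat \<Rightarrow> int \<Rightarrow> 'm set"
  assumes C_diff: "p \<in> C i c \<Longrightarrow> q \<in> C i c \<Longrightarrow> p - q \<in> C i c"
    and U_sub: "U W i c \<subseteq> C i c"
    and U_zero: "0 \<in> U W i c"
    and U_diff: "p \<in> U W i c \<Longrightarrow> q \<in> U W i c \<Longrightarrow> p - q \<in> U W i c"
    and U_empty: "U {} i c = {0}"
    and U_mono: "W \<subseteq> W' \<Longrightarrow> U W i c \<subseteq> U W' i c"
    and U_insert: "v \<in> V \<Longrightarrow> p \<in> U (insert v W) i c \<Longrightarrow>
          \<exists>f\<in>C i (c - 1). \<exists>w\<in>U W i c. p = x v f + w"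
    and x_diff: "x v (p - q) = x v p - x v q"
    and x_U: "v \<in> V \<Longrightarrow> p \<in> U W i c \<Longrightarrow> x v p \<in> U W i (c + 1)"
    and x_U_insert: "v \<in> V \<Longrightarrow> p \<in> C i c \<Longrightarrow> x v p \<in> U (insert v W) i (c + 1)"
    and x_reg: "v \<in> V \<Longrightarrow> v \<notin> W \<Longrightarrow> p \<in> C i c \<Longrightarrow> x v p \<in> U W i (c + 1) \<Longrightarrow> p \<in> U W i c"
    and d_diff: "d i (p - q) = d i p - d i q"
    and d_C: "p \<in> C (Suc i) c \<Longrightarrow> d i p \<in> C i c"
    and d_U: "p \<in> U W (Suc i) c \<Longrightarrow> d i p \<in> U W i c"
    and d_x: "d i (x v p) = x v (d i p)"
    and d_d: "p \<in> C (Suc (Suc i)) c \<Longrightarrow> d i (d (Suc i) p) = 0"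
begin

text \<open>Quotients are never formed: a cycle of C/WC is represented by an element of C whose
  differential lies in WC. So all \<open>W\<close> share one carrier and can be compared.\<close>

definition Cyc :: "'v set \<Rightarrow> nat \<Rightarrow> int \<Rightarrow> 'm set" where
  "Cyc W i c = {z \<in> C i c. \<forall>j. i = Suc j \<longrightarrow> d j z \<in> U W j c}"

definition Bd :: "'v set \<Rightarrow> nat \<Rightarrow> int \<Rightarrow> 'm set" where
  "Bd W i c = {z. \<exists>h\<in>C (Suc i) c. \<exists>w\<in>U W i c. z = d i h + w}"

lemma C_zero: "0 \<in> C i c"
  using U_zero U_sub by blast

lemma U_minus: "p \<in> U W i c \<Longrightarrow> - p \<in> U W i c"
  using U_diff[OF U_zero] by force

lemma U_add: "p \<in> U W i c \<Longrightarrow> q \<in> U W i c \<Longrightarrow> p + q \<in> U W i c"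
  using U_diff[of p W i c "- q"] U_minus by simp

lemma d_zero: "d i 0 = 0"
  using d_diff[of i 0 0] by simp

lemma d_add: "d i (p + q) = d i p + d i q"
  using d_diff[of i p "0 - q"] d_diff[of i 0 q] by (simp add: d_zero)

lemma x_zero: "x v 0 = 0"
  using x_diff[of v 0 0] by simp

lemma x_add: "x v (p + q) = x v p + x v q"
  using x_diff[of v p "0 - q"] x_diff[of v 0 q] by (simp add: x_zero)

lemma x_C: "v \<in> V \<Longrightarrow> p \<in> C i c \<Longrightarrow> x v p \<in> C i (c + 1)"
  using x_U_insert U_sub by blast

lemma Bd_mono: "W \<subseteq> W' \<Longrightarrow> Bd W i c \<subseteq> Bd W' i c"
  unfolding Bd_def using U_mono by blast

lemma U_Bd: "U W i c \<subseteq> Bd W i c"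
proof
  fix w assume "w \<in> U W i c"
  moreover have "w = d i 0 + w" by (simp add: d_zero)
  ultimately show "w \<in> Bd W i c" unfolding Bd_def using C_zero[of "Suc i" c] by blast
qed

lemma d_Bd: "h \<in> C (Suc i) c \<Longrightarrow> d i h \<in> Bd W i c"
proof -
  assume "h \<in> C (Suc i) c"
  moreover have "d i h = d i h + 0" by simp
  ultimately show ?thesis unfolding Bd_def using U_zero[of W i c] by blast
qed

text \<open>For \<open>C/WC\<close>, this is the exactness of \<open>H\<^sub>i(W)\<^sub>c \<rightarrow> H\<^sub>i(insert v W)\<^sub>c \<rightarrow> H\<^sub>i\<^sub>-\<^sub>1(W)\<^sub>c\<^sub>-\<^sub>1 \<rightarrow> H\<^sub>i\<^sub>-\<^sub>1(W)\<^sub>c\<close>,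
  where the last map is multiplication by \<open>v\<close>.\<close>

lemma Cyc_insert:
  assumes v: "v \<in> V" "v \<notin> W" and van: "Cyc W i c \<subseteq> Bd W i c"
    and inj: "\<And>j f. i = Suc j \<Longrightarrow> f \<in> Cyc W j (c - 1) \<Longrightarrow> x v f \<in> Bd W j c \<Longrightarrow> f \<in> Bd W j (c - 1)"
  shows "Cyc (insert v W) i c \<subseteq> Bd (insert v W) i c"
proof
  fix z assume z: "z \<in> Cyc (insert v W) i c"
  show "z \<in> Bd (insert v W) i c"
  proof (cases i)
    case 0
    then have "z \<in> Cyc W i c" using z by (simp add: Cyc_def)
    then show ?thesis using van Bd_mono[of W "insert v W"] by blast
  next
    case (Suc j)
    have zC: "z \<in> C (Suc j) c" and "d j z \<in> U (insert v W) j c"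
      using z Suc by (auto simp: Cyc_def)
    \<comment> \<open>The class of \<open>f\<close> is the image of \<open>z\<close> under the
      connecting map.\<close>
    then obtain f w where f: "f \<in> C j (c - 1)" and w: "w \<in> U W j c" and dz: "d j z = x v f + w"
      using U_insert[OF v(1)] by blast
    have xf: "x v f = d j z + (- w)" using dz by simp
    have fcyc: "f \<in> Cyc W j (c - 1)"
      unfolding Cyc_def
    proof (clarsimp simp: f)
      fix k assume k: "j = Suc k"
      have "x v (d k f) + d k w = d k (d j z)" using dz by (simp add: d_add d_x)
      also have "\<dots> = 0" using d_d zC k by blast
      finally have "x v (d k f) = - d k w" by (simp add: eq_neg_iff_add_eq_0)
      moreover have "d k w \<in> U W k c" using d_U w k by blast
      ultimately have "x v (d k f) \<in> U W k ((c - 1) + 1)" using U_minus by simp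
      then show "d k f \<in> U W k (c - 1)"
        using x_reg[OF v] d_C f k by blast
    qed
    have "x v f \<in> Bd W j c"
      unfolding Bd_def using xf zC U_minus[OF w] by blast
    then have "f \<in> Bd W j (c - 1)" using inj[OF Suc fcyc] by blast
    then obtain g w' where g: "g \<in> C (Suc j) (c - 1)" and w': "w' \<in> U W j (c - 1)" and fe: "f = d j g + w'"
      by (auto simp: Bd_def)
    have xg: "x v g \<in> C (Suc j) c" using x_C[OF v(1) g] by simp
    have xw: "x v w' \<in> U W j c" using x_U[OF v(1) w'] by simp
    \<comment> \<open>Since \<open>f\<close> bounds modulo \<open>W\<close>, subtracting
      \<open>x v g\<close> turns \<open>z\<close> into a cycle modulo \<open>W\<close>; the
      correction itself lies in the submodule generated with \<open>v\<close>.\<close>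
    have "d j (z - x v g) = x v w' + w"
      using dz fe by (simp add: d_diff d_x x_add)
    then have "z - x v g \<in> Cyc W i c"
      unfolding Cyc_def using Suc C_diff[OF zC xg] U_add[OF xw w] by auto
    then obtain h w'' where h: "h \<in> C (Suc i) c" and w'': "w'' \<in> U W i c" and e: "z - x v g = d i h + w''"
      using van unfolding Bd_def by blast
    have "x v g \<in> U (insert v W) i c"
      using x_U_insert[OF v(1) g, of W] Suc by simp
    then have "w'' + x v g \<in> U (insert v W) i c"
      using w'' U_mono[of W "insert v W" i c] U_add by blast
    moreover have "z = d i h + (w'' + x v g)" using e by (simp add: algebra_simps)
    ultimately show ?thesis using h by (auto simp: Bd_def)
  qed
qed

text \<open>Surjectivity of the connecting map onto the kernel of multiplication by
  \<open>v\<close>: the class of \<open>z\<close> is killed by \<open>v\<close> because homology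
  vanishes in degree \<open>c + 1\<close>, so it comes from a class \<open>h\<close> one position
  and one degree higher. That class is nonzero because its image is.\<close>

lemma Cyc_insert_nonboundary:
  assumes v: "v \<in> V" "v \<notin> W" and van: "Cyc W i (c + 1) \<subseteq> Bd W i (c + 1)"
    and z: "z \<in> Cyc W i c" "z \<notin> Bd W i c"
  shows "\<exists>h. h \<in> Cyc (insert v W) (Suc i) (c + 1) \<and> h \<notin> Bd (insert v W) (Suc i) (c + 1)"
proof -
  have zC: "z \<in> C i c" using z by (simp add: Cyc_def)
  have "x v z \<in> Cyc W i (c + 1)"
    unfolding Cyc_def
  proof (clarsimp simp: x_C[OF v(1) zC])
    fix j assume "i = Suc j"
    then show "d j (x v z) \<in> U W j (c + 1)"
      using z(1) x_U[OF v(1)] by (simp add: Cyc_def d_x)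
  qed
  then obtain h w where h: "h \<in> C (Suc i) (c + 1)" and w: "w \<in> U W i (c + 1)" and e: "x v z = d i h + w"
    using van unfolding Bd_def by blast
  have dh: "d i h = x v z - w" using e by simp
  have "x v z - w \<in> U (insert v W) i (c + 1)"
    using x_U_insert[OF v(1) zC] U_mono[of W "insert v W"] w U_diff by blast
  then have "h \<in> Cyc (insert v W) (Suc i) (c + 1)"
    using h dh by (simp add: Cyc_def)
  moreover have "h \<notin> Bd (insert v W) (Suc i) (c + 1)"
  proof
    assume "h \<in> Bd (insert v W) (Suc i) (c + 1)"
    then obtain g u where g: "g \<in> C (Suc (Suc i)) (c + 1)" and u: "u \<in> U (insert v W) (Suc i) (c + 1)"
      and he: "h = d (Suc i) g + u" unfolding Bd_def by blast
    obtain p w' where p: "p \<in> C (Suc i) c" and w': "w' \<in> U W (Suc i) (c + 1)" and ue: "u = x v p + w'"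
      using U_insert[OF v(1) u] by auto
    have "d i h = x v (d i p) + d i w'"
      using he ue d_d[OF g] by (simp add: d_add d_x)
    \<comment> \<open>A bound for \<open>h\<close> makes \<open>v\<close> times this difference
      vanish modulo \<open>W\<close>; cancelling \<open>v\<close> would make \<open>z\<close> a
      boundary.\<close>
    then have "x v (z - d i p) = d i w' + w" using dh by (simp add: x_diff algebra_simps)
    then have "x v (z - d i p) \<in> U W i (c + 1)" using d_U[OF w'] w U_add by simp
    then have "z - d i p \<in> U W i c"
      using x_reg[OF v] C_diff[OF zC d_C[OF p]] by blast
    moreover have "z = d i p + (z - d i p)" by simp
    ultimately have "z \<in> Bd W i c"
      unfolding Bd_def using p by blast
    then show False using z by blast
  qed
  ultimately show ?thesis by blast
qed

end

text \<open>The bound \<open>D\<close> admits partial resolutions. Homology at position 0 is the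
  resolved module: \<open>Th_reg\<close> says that the elements of \<open>Th\<close> form a regular
  sequence on it in any order, and \<open>top\<close> that its quotient by them vanishes above
  \<open>t\<close>. \<open>Th_reg\<close> stops at \<open>c < D\<close> because the product has
  degree \<open>c + 1\<close>.\<close>

locale regular_graded_complex = graded_complex +
  fixes Th :: "'a set" and D t :: int
  assumes finV: "finite V" and Th_V: "Th \<subseteq> V"
    and exact: "c \<le> D \<Longrightarrow> z \<in> C (Suc i) c \<Longrightarrow> d i z = 0 \<Longrightarrow> z \<in> d (Suc i) ` C (Suc (Suc i)) c"
    and Th_reg: "v \<in> Th \<Longrightarrow> W \<subseteq> Th \<Longrightarrow> v \<notin> W \<Longrightarrow> c < D \<Longrightarrow> f \<in> C 0 c \<Longrightarrow>
      x v f \<in> Bd W 0 (c + 1) \<Longrightarrow> f \<in> Bd W 0 c"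
    and top: "c \<le> D \<Longrightarrow> t < c \<Longrightarrow> C 0 c \<subseteq> Bd Th 0 c"
begin

text \<open>Dividing by a regular sequence creates no higher homology.\<close>

lemma Th_exact:
  assumes "W \<subseteq> Th" "c \<le> D"
  shows "Cyc W (Suc i) c \<subseteq> Bd W (Suc i) c"
proof -
  have "finite W" using finite_subset[OF _ finV] assms(1) Th_V by simp
  then show ?thesis using assms
  proof (induction W arbitrary: i c)
    case empty
    then show ?case
      using exact[OF empty.prems(2)] d_Bd by (force simp: Cyc_def U_empty)
  next
    case (insert v W)
    show ?case
    proof (rule Cyc_insert)
      show "v \<in> V" using insert Th_V by blast
      fix j f assume j: "Suc i = Suc j" and f: "f \<in> Cyc W j (c - 1)" and xf: "x v f \<in> Bd W j c"
      show "f \<in> Bd W j (c - 1)"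
      \<comment> \<open>Injectivity of multiplication by \<open>v\<close> is regularity at position
        0; higher up, the source homology already vanishes by induction.\<close>
      proof (cases j)
        case 0
        then show ?thesis
          using Th_reg[of v W "c - 1" f] insert.prems insert.hyps f xf by (auto simp: Cyc_def)
      next
        case (Suc k)
        then show ?thesis using insert.IH[of "c - 1" k] insert.prems f by auto
      qed
    qed (use insert in auto)
  qed
qed

text \<open>The variables outside \<open>Th\<close> need not be regular. The connecting map lowers
  position and degree both by one, so a degree above the line \<open>int i + t\<close> maps to a
  degree above the same line, where homology vanishes by induction.\<close>

lemma Cyc_vanish:
  assumes "Th \<subseteq> W" "W \<subseteq> V" "c \<le> D" "c > int i + t"
  shows "Cyc W i c \<subseteq> Bd W i c"
proof -
  define Y where "Y = W - Th"
  have "finite Y" using finite_subset[OF _ finV] assms unfolding Y_def by simp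
  moreover have "Y \<subseteq> V - Th" using assms by (auto simp: Y_def)
  ultimately have "Cyc (Y \<union> Th) i c \<subseteq> Bd (Y \<union> Th) i c" using assms(3,4)
  proof (induction Y arbitrary: i c)
    case empty
    show ?case
    proof (cases i)
      case 0
      then show ?thesis using top[of c] empty by (auto simp: Cyc_def)
    next
      case (Suc j)
      then show ?thesis using Th_exact[of Th c j] empty by auto
    qed
  next
    case (insert v Y)
    have "Cyc (insert v (Y \<union> Th)) i c \<subseteq> Bd (insert v (Y \<union> Th)) i c"
    proof (rule Cyc_insert)
      fix j f assume j: "i = Suc j" and f: "f \<in> Cyc (Y \<union> Th) j (c - 1)"
      then show "f \<in> Bd (Y \<union> Th) j (c - 1)"
        using insert.IH[of "c - 1" j] insert.prems by auto
    qed (use insert in auto)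
    then show ?case by simp
  qed
  moreover have "Y \<union> Th = W" using assms by (auto simp: Y_def)
  ultimately show ?thesis by simp
qed

text \<open>Each variable outside \<open>Th\<close> moves the class one step along the line of
  degree \<open>int i + t\<close>. \<open>Cyc_vanish\<close> supplies the vanishing just above that
  line which every step requires.\<close>

lemma Cyc_nonboundary:
  assumes z: "z \<in> C 0 t" "z \<notin> Bd Th 0 t" and D: "int (card (V - Th)) + t \<le> D"
  shows "\<exists>h. h \<in> Cyc V (card (V - Th)) (int (card (V - Th)) + t) \<and>
    h \<notin> Bd V (card (V - Th)) (int (card (V - Th)) + t)"
proof -
  have "\<exists>h. h \<in> Cyc (Y \<union> Th) (card Y) (int (card Y) + t) \<and> h \<notin> Bd (Y \<union> Th) (card Y) (int (card Y) + t)"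
    if "finite Y" "Y \<subseteq> V - Th" "int (card Y) + t \<le> D" for Y
    using that
  proof (induction Y)
    case empty
    then show ?case using z by (auto simp: Cyc_def)
  next
    case (insert v Y)
    then obtain h where h: "h \<in> Cyc (Y \<union> Th) (card Y) (int (card Y) + t)"
      "h \<notin> Bd (Y \<union> Th) (card Y) (int (card Y) + t)" by auto
    have "\<exists>h. h \<in> Cyc (insert v (Y \<union> Th)) (Suc (card Y)) (int (card Y) + t + 1) \<and>
      h \<notin> Bd (insert v (Y \<union> Th)) (Suc (card Y)) (int (card Y) + t + 1)"
      by (rule Cyc_insert_nonboundary[OF _ _ _ h], use insert Th_V in \<open>auto intro!: Cyc_vanish[THEN subsetD]\<close>)
    then show ?case using insert by (simp add: algebra_simps)
  qed
  from this[of "V - Th"] show ?thesis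
    using D finV Th_V by (simp add: Un_absorb2)
qed

end

section \<open>Polynomials and monomial ideals\<close>

lemma sum_single_keys: "p = (\<Sum>m\<in>Poly_Mapping.keys p. Poly_Mapping.single m (Poly_Mapping.lookup p m))"
proof (rule poly_mapping_eqI)
  fix k
  have "(\<Sum>m\<in>Poly_Mapping.keys p. Poly_Mapping.lookup p m when m = k) = Poly_Mapping.lookup p k"
    by (cases "k \<in> Poly_Mapping.keys p") (auto simp: when_def in_keys_iff)
  then show "Poly_Mapping.lookup p k =
      Poly_Mapping.lookup (\<Sum>m\<in>Poly_Mapping.keys p. Poly_Mapping.single m (Poly_Mapping.lookup p m)) k"
    by (simp add: lookup_sum lookup_single)
qed

lemma single_mult_expand:
  fixes p :: "('v, 'a::comm_ring_1) mpoly"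
  shows "Poly_Mapping.single a s * p =
    (\<Sum>m\<in>Poly_Mapping.keys p. Poly_Mapping.single (a + m) (s * Poly_Mapping.lookup p m))"
proof -
  have "Poly_Mapping.single a s * p =
      Poly_Mapping.single a s * (\<Sum>m\<in>Poly_Mapping.keys p. Poly_Mapping.single m (Poly_Mapping.lookup p m))"
    using sum_single_keys[of p] by simp
  also have "\<dots> = (\<Sum>m\<in>Poly_Mapping.keys p. Poly_Mapping.single (a + m) (s * Poly_Mapping.lookup p m))"
    by (simp only: sum_distrib_left mult_single)
  finally show ?thesis .
qed

lemma lookup_single_mult:
  fixes p :: "('v, 'a::comm_ring_1) mpoly"
  shows "Poly_Mapping.lookup (Poly_Mapping.single a s * p) (a + m) = s * Poly_Mapping.lookup p m"
proof -
  have "(\<Sum>k\<in>Poly_Mapping.keys p. s * Poly_Mapping.lookup p k when k = m) = s * Poly_Mapping.lookup p m"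
    by (cases "m \<in> Poly_Mapping.keys p") (auto simp: when_def in_keys_iff)
  then show ?thesis
    by (simp add: single_mult_expand lookup_sum lookup_single)
qed

lemma keys_Mon_mult:
  fixes p :: "('v, 'a::comm_ring_1) mpoly"
  shows "Poly_Mapping.keys (Mon a * p) = (+) a ` Poly_Mapping.keys p"
proof
  show "Poly_Mapping.keys (Mon a * p) \<subseteq> (+) a ` Poly_Mapping.keys p"
    using keys_mult[of "Mon a :: ('v, 'a) mpoly" p] by (auto split: if_splits)
  show "(+) a ` Poly_Mapping.keys p \<subseteq> Poly_Mapping.keys (Mon a * p)"
    by (auto simp: in_keys_iff lookup_single_mult)
qed

lemma keys_add_nat: "Poly_Mapping.keys (a + b :: 'v \<Rightarrow>\<^sub>0 nat) = Poly_Mapping.keys a \<union> Poly_Mapping.keys b"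
  by (auto simp: in_keys_iff lookup_add)

lemma mdeg_superset:
  "finite A \<Longrightarrow> Poly_Mapping.keys m \<subseteq> A \<Longrightarrow> mdeg m = (\<Sum>v\<in>A. Poly_Mapping.lookup m v)"
  unfolding mdeg_def by (rule sum.mono_neutral_left) (auto simp: in_keys_iff)

lemma mdeg_add: "mdeg (a + b) = mdeg a + mdeg b"
  using mdeg_superset[of "Poly_Mapping.keys a \<union> Poly_Mapping.keys b" a]
    mdeg_superset[of "Poly_Mapping.keys a \<union> Poly_Mapping.keys b" b]
  by (simp add: mdeg_def[of "a + b"] keys_add_nat lookup_add sum.distrib)

lemma mdeg_zero [simp]: "mdeg 0 = 0"
  by (simp add: mdeg_def)

lemma mdeg_single [simp]: "mdeg (Poly_Mapping.single v k) = k"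
  by (simp add: mdeg_def)

lemma mdeg_eq_0_iff: "mdeg m = 0 \<longleftrightarrow> m = 0"
proof
  assume "mdeg m = 0"
  then have "\<forall>v\<in>Poly_Mapping.keys m. Poly_Mapping.lookup m v = 0" by (simp add: mdeg_def)
  then show "m = 0" by (intro poly_mapping_eqI) (metis lookup_zero in_keys_iff)
qed simp

lemma mdeg_sum: "mdeg (sum f A) = (\<Sum>x\<in>A. mdeg (f x))"
  by (induction A rule: infinite_finite_induct) (auto simp: mdeg_add)

lemma minus_single_add:
  "v \<in> Poly_Mapping.keys m \<Longrightarrow> Poly_Mapping.single v 1 + (m - Poly_Mapping.single v 1) = (m :: 'v \<Rightarrow>\<^sub>0 nat)"
  by (rule poly_mapping_eqI) (auto simp: lookup_add lookup_minus lookup_single when_def in_keys_iff)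

section \<open>Graded pieces of free modules\<close>

text \<open>Degrees are integers so that the shift \<open>c - int (a j)\<close> may fall below zero,
  where the piece is zero.\<close>

definition Hom :: "'v set \<Rightarrow> int \<Rightarrow> ('v, 'a::comm_ring_1) mpoly set" where
  "Hom V c = {p. \<forall>m\<in>Poly_Mapping.keys p. Poly_Mapping.keys m \<subseteq> V \<and> int (mdeg m) = c}"

text \<open>The ideal generated by the variables in \<open>W\<close>, read off monomial by monomial,
  which makes cancelling a variable outside \<open>W\<close> immediate.\<close>

definition mono_ideal :: "'v set \<Rightarrow> ('v, 'a::comm_ring_1) mpoly set" where
  "mono_ideal W = {p. \<forall>m\<in>Poly_Mapping.keys p. Poly_Mapping.keys m \<inter> W \<noteq> {}}"

lemma Hom_zero [simp]: "0 \<in> Hom V c"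
  by (simp add: Hom_def)

lemma Hom_polys: "p \<in> Hom V c \<Longrightarrow> p \<in> polys V"
  by (auto simp: Hom_def polys_def)

lemma keys_minus_subset:
  "Poly_Mapping.keys (p - q) \<subseteq> Poly_Mapping.keys p \<union> Poly_Mapping.keys (q :: ('v, 'a::comm_ring_1) mpoly)"
  by (auto simp: in_keys_iff lookup_minus)

lemma Hom_diff: "p \<in> Hom V c \<Longrightarrow> q \<in> Hom V c \<Longrightarrow> p - q \<in> Hom V c"
  unfolding Hom_def using keys_minus_subset[of p q] by blast

lemma Hom_add: "p \<in> Hom V c \<Longrightarrow> q \<in> Hom V c \<Longrightarrow> p + q \<in> Hom V c"
  unfolding Hom_def using Poly_Mapping.keys_add[of p q] by blast

lemma Hom_sum: "(\<And>x. x \<in> A \<Longrightarrow> f x \<in> Hom V c) \<Longrightarrow> sum f A \<in> Hom V c"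
  by (induction A rule: infinite_finite_induct) (auto intro: Hom_add)

lemma Hom_mult:
  assumes "p \<in> Hom V c" "q \<in> Hom V e"
  shows "p * q \<in> Hom V (c + e)"
  unfolding Hom_def
proof (clarify, intro conjI)
  fix m assume "m \<in> Poly_Mapping.keys (p * q)"
  then obtain a b where ab: "m = a + b" "a \<in> Poly_Mapping.keys p" "b \<in> Poly_Mapping.keys q"
    using keys_mult[of p q] by auto
  then show "Poly_Mapping.keys m \<subseteq> V" "int (mdeg m) = c + e"
    using assms by (auto simp: Hom_def keys_add_nat mdeg_add)
qed

lemma Hom_single: "Poly_Mapping.keys m \<subseteq> V \<Longrightarrow> int (mdeg m) = c \<Longrightarrow> Poly_Mapping.single m s \<in> Hom V c"
  by (simp add: Hom_def)

lemma Hom_Const: "Const s \<in> Hom V 0"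
  by (rule Hom_single) auto

lemma Hom_Var: "v \<in> V \<Longrightarrow> Var v \<in> Hom V 1"
  by (rule Hom_single) auto

lemma Hom_neg: "c < 0 \<Longrightarrow> p \<in> Hom V c \<Longrightarrow> p = 0"
  by (auto simp: Hom_def simp flip: keys_eq_empty)

lemma Hom_const_term:
  assumes "p \<in> Hom V c" "Poly_Mapping.lookup p 0 \<noteq> 0"
  shows "c = 0" and "p = Const (Poly_Mapping.lookup p 0)"
proof -
  have "0 \<in> Poly_Mapping.keys p" using assms(2) by (simp add: in_keys_iff)
  then show c: "c = 0" using assms(1) by (auto simp: Hom_def)
  show "p = Const (Poly_Mapping.lookup p 0)"
  proof (rule poly_mapping_eqI)
    fix k
    show "Poly_Mapping.lookup p k = Poly_Mapping.lookup (Const (Poly_Mapping.lookup p 0)) k"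
    proof (cases "k = 0")
      case False
      then have "mdeg k \<noteq> 0" by (simp add: mdeg_eq_0_iff)
      then have "k \<notin> Poly_Mapping.keys p" using assms(1) c by (auto simp: Hom_def)
      then show ?thesis using False by (simp add: in_keys_iff lookup_single)
    qed simp
  qed
qed

lemma mono_ideal_zero [simp]: "0 \<in> mono_ideal W"
  by (simp add: mono_ideal_def)

lemma mono_ideal_diff: "p \<in> mono_ideal W \<Longrightarrow> q \<in> mono_ideal W \<Longrightarrow> p - q \<in> mono_ideal W"
  unfolding mono_ideal_def using keys_minus_subset[of p q] by blast

lemma mono_ideal_add: "p \<in> mono_ideal W \<Longrightarrow> q \<in> mono_ideal W \<Longrightarrow> p + q \<in> mono_ideal W"
  unfolding mono_ideal_def using Poly_Mapping.keys_add[of p q] by blast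

lemma mono_ideal_sum: "(\<And>x. x \<in> A \<Longrightarrow> f x \<in> mono_ideal W) \<Longrightarrow> sum f A \<in> mono_ideal W"
  by (induction A rule: infinite_finite_induct) (auto intro: mono_ideal_add)

lemma mono_ideal_mult:
  assumes "q \<in> mono_ideal W"
  shows "p * q \<in> mono_ideal W"
  unfolding mono_ideal_def
proof clarify
  fix m assume "m \<in> Poly_Mapping.keys (p * q)" and e: "Poly_Mapping.keys m \<inter> W = {}"
  then obtain a b where "m = a + b" "b \<in> Poly_Mapping.keys q"
    using keys_mult[of p q] by auto
  then show False using assms e by (auto simp: mono_ideal_def keys_add_nat)
qed

lemma mono_ideal_Var_mult: "Var v * p \<in> mono_ideal (insert v W)"
  by (auto simp: mono_ideal_def keys_Mon_mult keys_add_nat)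

lemma mono_ideal_regular:
  assumes "v \<notin> W" "Var v * p \<in> mono_ideal W"
  shows "p \<in> mono_ideal W"
  using assms by (auto simp: mono_ideal_def keys_Mon_mult keys_add_nat split: if_splits)

lemma mono_ideal_const_term: "p \<in> mono_ideal W \<Longrightarrow> Poly_Mapping.lookup p 0 = 0"
  by (force simp: mono_ideal_def simp flip: not_in_keys_iff_lookup_eq_zero)

lemma mono_idealI_const_term:
  assumes "p \<in> Hom V c" "Poly_Mapping.lookup p 0 = 0"
  shows "p \<in> mono_ideal V"
  unfolding mono_ideal_def
proof clarify
  fix m assume m: "m \<in> Poly_Mapping.keys p" "Poly_Mapping.keys m \<inter> V = {}"
  then have "Poly_Mapping.keys m \<subseteq> V" using assms(1) by (simp add: Hom_def)
  then have "m = 0" using m(2) by (simp add: inf.absorb1)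
  then show False using m assms(2) by (auto simp: in_keys_iff)
qed

text \<open>The monomials of \<open>p\<close> that avoid \<open>W\<close> must contain
  \<open>v\<close>; dividing them by \<open>v\<close> gives \<open>f\<close>, and the others form
  \<open>w\<close>.\<close>

lemma mono_ideal_insert_split:
  assumes p: "p \<in> Hom V c" "p \<in> mono_ideal (insert v W)" and v: "v \<in> V"
  shows "\<exists>f\<in>Hom V (c - 1). \<exists>w\<in>Hom V c. w \<in> mono_ideal W \<and> p = Var v * f + w"
proof -
  define A where "A = {m \<in> Poly_Mapping.keys p. Poly_Mapping.keys m \<inter> W = {}}"
  define s where "s m = Poly_Mapping.single m (Poly_Mapping.lookup p m)" for m
  define f where "f = (\<Sum>m\<in>A. Poly_Mapping.single (m - Poly_Mapping.single v 1) (Poly_Mapping.lookup p m))"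
  define w where "w = sum s (Poly_Mapping.keys p - A)"
  have vm: "v \<in> Poly_Mapping.keys m" if "m \<in> A" for m
    using p(2) that by (auto simp: mono_ideal_def A_def)
  have "Var v * f = sum s A"
    unfolding f_def sum_distrib_left
    by (rule sum.cong) (auto simp: mult_single minus_single_add[OF vm, unfolded One_nat_def] s_def)
  moreover have "p = sum s (Poly_Mapping.keys p)" unfolding s_def by (rule sum_single_keys)
  moreover have "sum s (Poly_Mapping.keys p) = sum s A + sum s (Poly_Mapping.keys p - A)"
    by (subst sum.subset_diff[of A]) (auto simp: A_def add.commute)
  ultimately have "p = Var v * f + w" by (simp add: w_def)
  moreover have "f \<in> Hom V (c - 1)"
    unfolding f_def
  proof (intro Hom_sum Hom_single)
    fix m assume m: "m \<in> A"
    have "Poly_Mapping.keys (Poly_Mapping.single v 1 + (m - Poly_Mapping.single v 1)) \<subseteq> V"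
      "int (mdeg (Poly_Mapping.single v 1 + (m - Poly_Mapping.single v 1))) = c"
      using p(1) m minus_single_add[OF vm[OF m]] by (auto simp: Hom_def A_def)
    then show "Poly_Mapping.keys (m - Poly_Mapping.single v 1) \<subseteq> V"
      "int (mdeg (m - Poly_Mapping.single v 1)) = c - 1"
      by (auto simp: keys_add_nat mdeg_add)
  qed
  moreover have "w \<in> Hom V c"
    unfolding w_def s_def using p(1) by (intro Hom_sum Hom_single) (auto simp: Hom_def)
  moreover have "w \<in> mono_ideal W"
    unfolding w_def s_def by (intro mono_ideal_sum) (auto simp: mono_ideal_def A_def)
  ultimately show ?thesis by blast
qed

text \<open>Elements of a free module of rank \<open>r\<close> are functions vanishing from \<open>r\<close> on;
  the basis vector \<open>j\<close> has degree \<open>a j\<close>.\<close>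

definition free_deg :: "'v set \<Rightarrow> nat \<Rightarrow> (nat \<Rightarrow> nat) \<Rightarrow> int \<Rightarrow> (nat \<Rightarrow> ('v, 'a::comm_ring_1) mpoly) set" where
  "free_deg V r a c = {f. (\<forall>j. f j \<in> Hom V (c - int (a j))) \<and> (\<forall>j\<ge>r. f j = 0)}"

definition mat_map :: "nat \<Rightarrow> (nat \<Rightarrow> nat \<Rightarrow> ('v, 'a::comm_ring_1) mpoly) \<Rightarrow>
    (nat \<Rightarrow> ('v, 'a) mpoly) \<Rightarrow> nat \<Rightarrow> ('v, 'a) mpoly" where
  "mat_map r M w = (\<lambda>j. \<Sum>k<r. M j k * w k)"

lemma free_deg_zero: "0 \<in> free_deg V r a c"
  by (simp add: free_deg_def)

lemma free_deg_diff: "f \<in> free_deg V r a c \<Longrightarrow> g \<in> free_deg V r a c \<Longrightarrow> f - g \<in> free_deg V r a c"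
  by (auto simp: free_deg_def Hom_diff)

lemma free_deg_mult: "q \<in> Hom V e \<Longrightarrow> f \<in> free_deg V r a c \<Longrightarrow> (\<lambda>j. q * f j) \<in> free_deg V r a (c + e)"
  unfolding free_deg_def using Hom_mult[of q V e "f _"] by (force simp: algebra_simps)

lemma mat_map_diff: "mat_map r M (f - g) = mat_map r M f - mat_map r M g"
  by (auto simp: mat_map_def algebra_simps sum_subtractf)

lemma mat_map_add: "mat_map r M (f + g) = mat_map r M f + mat_map r M g"
  by (auto simp: mat_map_def algebra_simps sum.distrib)

lemma mat_map_zero [simp]: "mat_map r M 0 = 0"
  by (auto simp: mat_map_def)

lemma mat_map_mult: "mat_map r M (\<lambda>j. q * f j) = (\<lambda>j. q * mat_map r M f j)"
  by (auto simp: mat_map_def sum_distrib_left mult.left_commute)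

lemma mat_map_free_deg:
  assumes M: "\<And>k. k < r \<Longrightarrow> (\<lambda>j. M j k) \<in> free_deg V r' a' (int (a k))" and w: "w \<in> free_deg V r a c"
  shows "mat_map r M w \<in> free_deg V r' a' c"
  unfolding free_deg_def
proof (clarify, intro conjI allI impI)
  fix j
  show "mat_map r M w j \<in> Hom V (c - int (a' j))"
    unfolding mat_map_def
  proof (rule Hom_sum)
    fix k assume "k \<in> {..<r}"
    then have "M j k \<in> Hom V (int (a k) - int (a' j))" "w k \<in> Hom V (c - int (a k))"
      using M w by (auto simp: free_deg_def)
    from Hom_mult[OF this] show "M j k * w k \<in> Hom V (c - int (a' j))" by simp
  qed
  assume "r' \<le> j"
  then show "mat_map r M w j = 0" using M by (simp add: mat_map_def free_deg_def)
qed

section \<open>Minimal complexes of graded free modules\<close>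

locale minimal_free_complex =
  fixes V :: "'v set" and rk :: "nat \<Rightarrow> nat" and dg :: "nat \<Rightarrow> nat \<Rightarrow> nat"
    and mt :: "nat \<Rightarrow> nat \<Rightarrow> nat \<Rightarrow> ('v, 'a::field) mpoly"
  assumes cols: "k < rk (Suc i) \<Longrightarrow> (\<lambda>j. mt i j k) \<in> free_deg V (rk i) (dg i) (int (dg (Suc i) k))"
    and minimal: "k < rk (Suc i) \<Longrightarrow> Poly_Mapping.lookup (mt i j k) 0 = 0"
    and comp_zero: "w \<in> free_deg V (rk (Suc (Suc i))) (dg (Suc (Suc i))) c \<Longrightarrow>
      mat_map (rk (Suc i)) (mt i) (mat_map (rk (Suc (Suc i))) (mt (Suc i)) w) = 0"
begin

abbreviation "F i c \<equiv> free_deg V (rk i) (dg i) c"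
abbreviation "bdry i \<equiv> mat_map (rk (Suc i)) (mt i)"
abbreviation "FU W i c \<equiv> {f \<in> F i c. \<forall>j. f j \<in> mono_ideal W}"

text \<open>Freeness is what makes every variable outside \<open>W\<close> regular modulo
  \<open>W\<close>: WC is the monomial ideal in each coordinate.\<close>

lemma graded_complex: "graded_complex V F bdry (\<lambda>v f j. Var v * f j) FU"
proof
  fix p q :: "nat \<Rightarrow> ('v, 'a) mpoly" and W W' :: "'v set" and v i c
  show "p \<in> F i c \<Longrightarrow> q \<in> F i c \<Longrightarrow> p - q \<in> F i c" by (rule free_deg_diff)
  show "FU W i c \<subseteq> F i c" by blast
  show "0 \<in> FU W i c" by (simp add: free_deg_zero)
  show "p \<in> FU W i c \<Longrightarrow> q \<in> FU W i c \<Longrightarrow> p - q \<in> FU W i c"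
    by (simp add: free_deg_diff mono_ideal_diff)
  show "FU {} i c = {0}"
    by (auto simp: mono_ideal_def free_deg_zero fun_eq_iff simp flip: keys_eq_empty)
  show "W \<subseteq> W' \<Longrightarrow> FU W i c \<subseteq> FU W' i c"
    by (fastforce simp: mono_ideal_def)
  show "\<exists>f\<in>F i (c - 1). \<exists>w\<in>FU W i c. p = (\<lambda>j. Var v * f j) + w"
    if v: "v \<in> V" and p: "p \<in> FU (insert v W) i c"
  proof -
    \<comment> \<open>The splitting is done coordinatewise, with zero parts beyond the rank so that
      both summands stay in the free module.\<close>
    have "\<exists>f w. f \<in> Hom V (c - int (dg i j) - 1) \<and> w \<in> Hom V (c - int (dg i j)) \<and> w \<in> mono_ideal W \<and>
      p j = Var v * f + w \<and> (j \<ge> rk i \<longrightarrow> f = 0 \<and> w = 0)" for j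
    proof (cases "j \<ge> rk i")
      case True
      then have "p j = 0" using p by (simp add: free_deg_def)
      then show ?thesis by (intro exI[of _ 0]) simp
    next
      case False
      then show ?thesis
        using mono_ideal_insert_split[of "p j" V "c - int (dg i j)" v W] v p by (auto simp: free_deg_def)
    qed
    then obtain f w where *: "\<And>j. f j \<in> Hom V (c - int (dg i j) - 1) \<and> w j \<in> Hom V (c - int (dg i j)) \<and>
      w j \<in> mono_ideal W \<and> p j = Var v * f j + w j \<and> (j \<ge> rk i \<longrightarrow> f j = 0 \<and> w j = 0)" by metis
    have "f \<in> F i (c - 1)" "w \<in> FU W i c" using * by (auto simp: free_deg_def algebra_simps)
    moreover have "p = (\<lambda>j. Var v * f j) + w" using * by (simp add: fun_eq_iff)
    ultimately show ?thesis by blast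
  qed
  show "(\<lambda>j. Var v * (p - q) j) = (\<lambda>j. Var v * p j) - (\<lambda>j. Var v * q j)"
    by (simp add: fun_eq_iff right_diff_distrib)
  show "v \<in> V \<Longrightarrow> p \<in> FU W i c \<Longrightarrow> (\<lambda>j. Var v * p j) \<in> FU W i (c + 1)"
    using free_deg_mult[OF Hom_Var, of v V p "rk i" "dg i" c] by (simp add: mono_ideal_mult)
  show "v \<in> V \<Longrightarrow> p \<in> F i c \<Longrightarrow> (\<lambda>j. Var v * p j) \<in> FU (insert v W) i (c + 1)"
    using free_deg_mult[OF Hom_Var, of v V p "rk i" "dg i" c] mono_ideal_Var_mult
    by (auto simp del: One_nat_def)
  show "v \<notin> W \<Longrightarrow> p \<in> F i c \<Longrightarrow> (\<lambda>j. Var v * p j) \<in> FU W i (c + 1) \<Longrightarrow> p \<in> FU W i c"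
    using mono_ideal_regular[of v W "p _"] by simp
  show "bdry i (p - q) = bdry i p - bdry i q" by (rule mat_map_diff)
  show dF: "p \<in> F (Suc i) c \<Longrightarrow> bdry i p \<in> F i c" by (rule mat_map_free_deg[OF cols])
  show "p \<in> FU W (Suc i) c \<Longrightarrow> bdry i p \<in> FU W i c"
    using mat_map_free_deg[OF cols] by (auto simp: mat_map_def intro!: mono_ideal_sum mono_ideal_mult)
  show "bdry i (\<lambda>j. Var v * p j) = (\<lambda>j. Var v * bdry i p j)" by (rule mat_map_mult)
  show "p \<in> F (Suc (Suc i)) c \<Longrightarrow> bdry i (bdry (Suc i) p) = 0" by (rule comp_zero)
qed

sublocale graded_complex V F bdry "\<lambda>v f j. Var v * f j" FU
  by (rule graded_complex)

lemma boundary_const_term: "Poly_Mapping.lookup (bdry i w j) 0 = 0"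
proof -
  have "Poly_Mapping.lookup (mt i j k * w k) 0 = 0" if k: "k < rk (Suc i)" for k
  proof -
    have "mt i j k \<in> mono_ideal V"
      using cols[OF k] minimal[OF k] unfolding free_deg_def by (blast intro: mono_idealI_const_term)
    then have "w k * mt i j k \<in> mono_ideal V" by (rule mono_ideal_mult)
    then show ?thesis by (simp add: mono_ideal_const_term mult.commute)
  qed
  then show ?thesis by (simp add: mat_map_def lookup_sum)
qed

definition unit :: "nat \<Rightarrow> nat \<Rightarrow> ('v, 'a) mpoly" where
  "unit k = (\<lambda>j. if j = k then 1 else 0)"

text \<open>By minimality the differential vanishes modulo all variables, so every basis vector is a
  cycle there.\<close>

lemma unit_Cyc:
  assumes k: "k < rk i"
  shows "unit k \<in> Cyc V i (int (dg i k))"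
proof -
  have F: "unit k \<in> F i (int (dg i k))"
    using k Hom_Const[of 1 V] by (auto simp: free_deg_def unit_def)
  have "bdry l (unit k) \<in> FU V l (int (dg i k))" if "i = Suc l" for l
  proof -
    have "bdry l (unit k) \<in> F l (int (dg i k))" using d_C F that by blast
    then show ?thesis
      using boundary_const_term unfolding free_deg_def by (blast intro: mono_idealI_const_term)
  qed
  then show ?thesis using F by (simp add: Cyc_def)
qed

lemma Bd_const_term: "z \<in> Bd V i c \<Longrightarrow> Poly_Mapping.lookup (z j) 0 = 0"
  unfolding Bd_def using mono_ideal_const_term by (fastforce simp: lookup_add boundary_const_term)

lemma unit_not_Bd: "unit k \<notin> Bd V i c"
  using Bd_const_term[of "unit k" i c k] by (auto simp: unit_def)

text \<open>Without a basis vector of degree \<open>c\<close>, no coordinate of \<open>z\<close> can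
  have a constant term, so \<open>z\<close> would vanish modulo all variables.\<close>

lemma not_Bd_generator:
  assumes "z \<in> F i c" "z \<notin> Bd V i c"
  shows "\<exists>j<rk i. int (dg i j) = c"
proof (rule ccontr)
  assume *: "\<not> ?thesis"
  have "z j \<in> mono_ideal V" for j
  proof (cases "j < rk i")
    case True
    then have "c - int (dg i j) \<noteq> 0" using * by auto
    moreover have "z j \<in> Hom V (c - int (dg i j))" using assms by (simp add: free_deg_def)
    ultimately show ?thesis using Hom_const_term(1) mono_idealI_const_term by blast
  next
    case False
    then show ?thesis using assms by (simp add: free_deg_def)
  qed
  then have "z \<in> FU V i c" using assms by simp
  then show False using U_Bd assms by blast
qed

end

section \<open>Monomial maps\<close>

text \<open>The exponent vector of the image of a monomial of S. A variable of S is itself an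
  exponent vector \<open>v\<close>, and \<open>m\<close> gives its multiplicity.\<close>

definition monom_image :: "(('w \<Rightarrow>\<^sub>0 nat) \<Rightarrow>\<^sub>0 nat) \<Rightarrow> 'w \<Rightarrow>\<^sub>0 nat" where
  "monom_image m = (\<Sum>v\<in>Poly_Mapping.keys m. Poly_Mapping.map ((*) (Poly_Mapping.lookup m v)) v)"

lemma lookup_map_times:
  "Poly_Mapping.lookup (Poly_Mapping.map ((*) k) v) i = (k::nat) * Poly_Mapping.lookup v i"
  by (simp add: Poly_Mapping.map.rep_eq when_def)

lemma lookup_monom_image:
  assumes "finite A" "Poly_Mapping.keys m \<subseteq> A"
  shows "Poly_Mapping.lookup (monom_image m) i = (\<Sum>v\<in>A. Poly_Mapping.lookup m v * Poly_Mapping.lookup v i)"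
proof -
  have "Poly_Mapping.lookup (monom_image m) i =
      (\<Sum>v\<in>Poly_Mapping.keys m. Poly_Mapping.lookup m v * Poly_Mapping.lookup v i)"
    by (simp add: monom_image_def lookup_sum lookup_map_times)
  also have "\<dots> = (\<Sum>v\<in>A. Poly_Mapping.lookup m v * Poly_Mapping.lookup v i)"
    using assms by (intro sum.mono_neutral_left) (auto simp: in_keys_iff)
  finally show ?thesis .
qed

lemma monom_image_add: "monom_image (a + b) = monom_image a + monom_image b"
proof (rule poly_mapping_eqI)
  fix i
  let ?A = "Poly_Mapping.keys a \<union> Poly_Mapping.keys b"
  show "Poly_Mapping.lookup (monom_image (a + b)) i = Poly_Mapping.lookup (monom_image a + monom_image b) i"
    using lookup_monom_image[of ?A a i] lookup_monom_image[of ?A b i] lookup_monom_image[of ?A "a + b" i]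
    by (simp add: lookup_add keys_add_nat algebra_simps sum.distrib)
qed

lemma monom_image_zero [simp]: "monom_image 0 = 0"
  by (simp add: monom_image_def)

lemma monom_image_single [simp]: "monom_image (Poly_Mapping.single v 1) = v"
  by (rule poly_mapping_eqI) (simp add: monom_image_def lookup_map_times)

lemma Mon_power: "(Mon v :: ('w, 'a::comm_ring_1) mpoly) ^ k = Mon (Poly_Mapping.map ((*) k) v)"
proof (induction k)
  case 0
  have "Poly_Mapping.map ((*) 0) v = 0" by (rule poly_mapping_eqI) (simp add: lookup_map_times)
  then show ?case by (simp only: power_0 single_one)
next
  case (Suc k)
  have "v + Poly_Mapping.map ((*) k) v = Poly_Mapping.map ((*) (Suc k)) v"
    by (rule poly_mapping_eqI) (simp add: lookup_map_times lookup_add)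
  then show ?case by (simp only: power_Suc Suc mult_single mult_1_left)
qed

lemma prod_Mon: "(\<Prod>v\<in>A. Mon (g v) :: ('w, 'a::comm_ring_1) mpoly) = Mon (sum g A)"
  by (induction A rule: infinite_finite_induct) (auto simp: mult_single)

lemma subst_Mon_eq:
  "subst Mon (p :: ('w \<Rightarrow>\<^sub>0 nat, 'a::comm_ring_1) mpoly) =
    (\<Sum>m\<in>Poly_Mapping.keys p. Poly_Mapping.single (monom_image m) (Poly_Mapping.lookup p m))"
  unfolding subst_def by (simp add: Mon_power prod_Mon mult_single monom_image_def)

lemma subst_Mon_single: "subst Mon (Poly_Mapping.single m s) = Poly_Mapping.single (monom_image m) s"
  by (cases "s = 0") (simp_all add: subst_Mon_eq)

lemma subst_Mon_add: "subst Mon (p + q) = subst Mon p + subst Mon q"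
  unfolding subst_Mon_eq by (rule setsum_keys_plus_distrib) (auto simp: single_add)

lemma subst_Mon_zero [simp]: "subst Mon 0 = 0"
  by (simp add: subst_Mon_eq)

lemma subst_Mon_diff: "subst Mon (p - q) = subst Mon p - subst Mon q"
  using subst_Mon_add[of "p - q" q] by (simp add: algebra_simps)

lemma subst_Mon_sum: "subst Mon (sum f A) = (\<Sum>x\<in>A. subst Mon (f x))"
  by (induction A rule: infinite_finite_induct) (auto simp: subst_Mon_add)

lemma subst_Mon_single_mult:
  "subst Mon (Poly_Mapping.single a s * p) = Poly_Mapping.single (monom_image a) s * subst Mon p"
  by (simp add: single_mult_expand[of a s p] subst_Mon_sum subst_Mon_single subst_Mon_eq[of p]
      sum_distrib_left mult_single monom_image_add)

lemma subst_Mon_mult: "subst Mon (p * q) = subst Mon p * subst Mon q"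
proof -
  have "subst Mon (p * q) = subst Mon ((\<Sum>m\<in>Poly_Mapping.keys p. Poly_Mapping.single m (Poly_Mapping.lookup p m)) * q)"
    using sum_single_keys[of p] by simp
  also have "\<dots> = subst Mon p * subst Mon q"
    by (simp add: sum_distrib_right subst_Mon_sum subst_Mon_single_mult subst_Mon_eq[of p])
  finally show ?thesis .
qed

text \<open>Only an inclusion, since monomials with the same image may cancel; this cancellation is
  what produces I(X).\<close>

lemma keys_subst_Mon: "Poly_Mapping.keys (subst Mon p) \<subseteq> monom_image ` Poly_Mapping.keys p"
proof
  fix u assume "u \<in> Poly_Mapping.keys (subst Mon p)"
  then have "(\<Sum>m\<in>Poly_Mapping.keys p. Poly_Mapping.lookup p m when monom_image m = u) \<noteq> 0"
    by (simp add: in_keys_iff subst_Mon_eq lookup_sum lookup_single)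
  then obtain m where "m \<in> Poly_Mapping.keys p" "(Poly_Mapping.lookup p m when monom_image m = u) \<noteq> 0"
    by (meson sum.neutral)
  then show "u \<in> monom_image ` Poly_Mapping.keys p" by auto
qed

lemma finite_monoms:
  assumes V: "finite V"
  shows "finite {m :: 'v \<Rightarrow>\<^sub>0 nat. Poly_Mapping.keys m \<subseteq> V \<and> mdeg m \<le> N}" (is "finite ?S")
proof (rule finite_imageD)
  let ?f = "\<lambda>u. restrict (Poly_Mapping.lookup u) V"
  show "finite (?f ` ?S)"
  proof (rule finite_subset)
    show "?f ` ?S \<subseteq> PiE V (\<lambda>_. {..N})"
    proof (rule image_subsetI, rule PiE_I)
      fix u i assume u: "u \<in> ?S" and i: "i \<in> V"
      have "Poly_Mapping.lookup u i \<le> (\<Sum>i\<in>V. Poly_Mapping.lookup u i)"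
        by (rule member_le_sum) (use i V in auto)
      also have "\<dots> = mdeg u" using u mdeg_superset[OF V, of u] by simp
      finally show "?f u i \<in> {..N}" using i u by simp
    qed simp
    show "finite (PiE V (\<lambda>_. {..N}))" by (rule finite_PiE) (auto simp: V)
  qed
  show "inj_on ?f ?S"
  proof (rule inj_onI, rule poly_mapping_eqI)
    fix a b i assume ab: "a \<in> ?S" "b \<in> ?S" "?f a = ?f b"
    show "Poly_Mapping.lookup a i = Poly_Mapping.lookup b i"
    proof (cases "i \<in> V")
      case True
      then show ?thesis using fun_cong[OF ab(3), of i] by simp
    next
      case False
      then have "i \<notin> Poly_Mapping.keys a" "i \<notin> Poly_Mapping.keys b"
        using ab by auto
      then show ?thesis by (simp add: in_keys_iff)
    qed
  qed
qed

definition vec_monom :: "nat \<Rightarrow> (nat \<Rightarrow> nat) \<Rightarrow> nat \<Rightarrow>\<^sub>0 nat" where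
  "vec_monom n f = Abs_poly_mapping (\<lambda>i. if i \<le> n then f i else 0)"

lemma lookup_vec_monom [simp]: "Poly_Mapping.lookup (vec_monom n f) i = (if i \<le> n then f i else 0)"
  unfolding vec_monom_def
  by (subst lookup_Abs_poly_mapping) (auto intro: finite_subset[of _ "{..n}"] split: if_splits)

lemma keys_vec_monom: "Poly_Mapping.keys (vec_monom n f) \<subseteq> {..n}"
  by (auto simp: in_keys_iff split: if_splits)

section \<open>The coordinate ring of the toric variety\<close>

locale toric =
  fixes n d :: nat and \<alpha> :: "nat \<Rightarrow> nat"
  assumes d_pos: "d > 0"
begin

text \<open>Invariance under \<open>Gamma\<close> only; the scalar matrix in
  \<open>Gamma_bar\<close> adds the condition that \<open>d\<close> divides the degree.\<close>

definition invar :: "(nat \<Rightarrow>\<^sub>0 nat) \<Rightarrow> bool" where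
  "invar u \<longleftrightarrow> Poly_Mapping.keys u \<subseteq> {..n} \<and> d dvd (\<Sum>i\<le>n. \<alpha> i * Poly_Mapping.lookup u i)"

definition V :: "(nat \<Rightarrow>\<^sub>0 nat) set" where
  "V = {u. invar u \<and> mdeg u = d}"

definition Th :: "(nat \<Rightarrow>\<^sub>0 nat) set" where
  "Th = (\<lambda>i. Poly_Mapping.single i d) ` {..n}"

lemma invar_zero: "invar 0"
  by (simp add: invar_def)

lemma invar_add: "invar a \<Longrightarrow> invar b \<Longrightarrow> invar (a + b)"
  by (auto simp: invar_def keys_add_nat lookup_add distrib_left sum.distrib)

lemma invar_cancel: "invar (a + b) \<Longrightarrow> invar a \<Longrightarrow> invar b"
  by (auto simp: invar_def keys_add_nat lookup_add distrib_left sum.distrib dvd_add_right_iff)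

lemma mdeg_n: "Poly_Mapping.keys u \<subseteq> {..n} \<Longrightarrow> mdeg u = (\<Sum>i\<le>n. Poly_Mapping.lookup u i)"
  by (rule mdeg_superset) auto

lemma Th_V: "Th \<subseteq> V"
proof -
  have "(\<Sum>k\<le>n. \<alpha> k * (d when i = k)) = \<alpha> i * d" if "i \<le> n" for i
    using that by (simp add: when_def if_distrib cong: if_cong)
  then show ?thesis using d_pos by (auto simp: Th_def V_def invar_def lookup_single)
qed

lemma finite_V: "finite V"
  by (rule finite_subset[OF _ finite_monoms[of "{..n}" d]]) (auto simp: V_def invar_def)

lemma monom_image_invar:
  assumes "Poly_Mapping.keys m \<subseteq> V"
  shows "invar (monom_image m)" "mdeg (monom_image m) = d * mdeg m"
proof -
  have map: "invar (Poly_Mapping.map ((*) k) v)" if "invar v" for k v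
  proof -
    have "Poly_Mapping.keys (Poly_Mapping.map ((*) k) v) \<subseteq> Poly_Mapping.keys v"
      by (auto simp: lookup_map_times in_keys_iff)
    then show ?thesis
      using that by (auto simp: invar_def lookup_map_times mult.left_commute[of _ k] simp flip: sum_distrib_left)
  qed
  have mm: "mdeg (Poly_Mapping.map ((*) k) v) = k * mdeg v" for k and v :: "nat \<Rightarrow>\<^sub>0 nat"
  proof -
    have "mdeg (Poly_Mapping.map ((*) k) v) =
        (\<Sum>i\<in>Poly_Mapping.keys v. Poly_Mapping.lookup (Poly_Mapping.map ((*) k) v) i)"
      by (rule mdeg_superset) (auto simp: in_keys_iff lookup_map_times)
    then show ?thesis by (simp add: lookup_map_times mdeg_def sum_distrib_left)
  qed
  have sum: "invar (sum f A)" if "\<And>v. v \<in> A \<Longrightarrow> invar (f v)" for f and A :: "(nat \<Rightarrow>\<^sub>0 nat) set"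
    using that by (induction A rule: infinite_finite_induct) (auto simp: invar_zero invar_add)
  show "invar (monom_image m)"
    unfolding monom_image_def using assms by (intro sum map) (auto simp: V_def)
  show "mdeg (monom_image m) = d * mdeg m"
    unfolding monom_image_def mdeg_sum mm mdeg_def[of m] sum_distrib_left
    using assms by (intro sum.cong) (auto simp: V_def)
qed

text \<open>By the Erdos--Ginzburg--Ziv theorem, an invariant monomial of degree \<open>c d\<close> with \<open>c \<ge> 2\<close> splits
  off an invariant monomial of degree \<open>d\<close>.\<close>

lemma monom_image_surj:
  assumes "invar u" "mdeg u = d * c"
  shows "\<exists>m. Poly_Mapping.keys m \<subseteq> V \<and> monom_image m = u \<and> mdeg m = c"
  using assms
proof (induction c arbitrary: u)
  case 0
  then show ?case using d_pos by (intro exI[of _ 0]) (auto simp: mdeg_eq_0_iff)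
next
  case (Suc c)
  show ?case
  proof (cases "c = 0")
    case True
    then show ?thesis using Suc.prems
      by (intro exI[of _ "Poly_Mapping.single u 1"]) (auto simp: V_def simp del: One_nat_def)
  next
    case False
    then obtain c' where c': "c = Suc c'" by (cases c) auto
    have "2 * d - 1 \<le> (\<Sum>i\<le>n. Poly_Mapping.lookup u i)"
      using Suc.prems mdeg_n[of u] c' by (simp add: invar_def)
    then obtain w where w: "\<forall>i. w i \<le> Poly_Mapping.lookup u i" "(\<Sum>i\<le>n. w i) = d"
      "d dvd (\<Sum>i\<le>n. \<alpha> i * w i)"
      using zero_sum_subvector[OF d_pos, where n = n and u = "Poly_Mapping.lookup u" and \<alpha> = \<alpha>] by blast
    define a where "a = vec_monom n w"
    define b where "b = u - a"
    have uab: "u = a + b"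
      by (rule poly_mapping_eqI) (use w(1) in \<open>auto simp: a_def b_def lookup_add lookup_minus\<close>)
    have ia: "invar a"
      using w(3) keys_vec_monom[of n w] by (simp add: invar_def a_def)
    moreover have da: "mdeg a = d"
      using w(2) mdeg_n[of a] keys_vec_monom[of n w] by (simp add: a_def)
    ultimately have aV: "a \<in> V" by (simp add: V_def)
    have "invar b" using invar_cancel ia Suc.prems(1) uab by blast
    moreover have "mdeg b = d * c" using Suc.prems(2) uab da by (simp add: mdeg_add)
    ultimately obtain m where m: "Poly_Mapping.keys m \<subseteq> V" "monom_image m = b" "mdeg m = c"
      using Suc.IH by blast
    show ?thesis
      by (rule exI[of _ "Poly_Mapping.single a 1 + m"])
        (use m aV uab in \<open>auto simp: keys_add_nat monom_image_add mdeg_add simp del: One_nat_def\<close>)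
  qed
qed

text \<open>Membership of an invariant monomial in the ideal of A generated by the x_i^d selected by
  \<open>W\<close>. Divisibility in the polynomial ring suffices because the cofactor is again
  invariant.\<close>

definition divisible :: "(nat \<Rightarrow>\<^sub>0 nat) set \<Rightarrow> (nat \<Rightarrow>\<^sub>0 nat) \<Rightarrow> bool" where
  "divisible W u \<longleftrightarrow> (\<exists>i\<le>n. Poly_Mapping.single i d \<in> W \<and> d \<le> Poly_Mapping.lookup u i)"

lemma keys_subst_Hom:
  assumes "f \<in> Hom V c" "u \<in> Poly_Mapping.keys (subst Mon f)"
  shows "invar u" "int (mdeg u) = int d * c"
  using keys_subst_Mon[of f] assms monom_image_invar by (fastforce simp: Hom_def)+

text \<open>The ideal generated by \<open>I(X)\<close> and the variables in \<open>W\<close>, degree by degree.\<close>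

lemma kernel_plus_mono_ideal_iff:
  fixes f :: "(nat \<Rightarrow>\<^sub>0 nat, 'a::comm_ring_1) mpoly"
  assumes W: "W \<subseteq> Th" and f: "f \<in> Hom V c"
  shows "(\<exists>p\<in>Hom V c. \<exists>w\<in>Hom V c. subst Mon p = 0 \<and> w \<in> mono_ideal W \<and> f = p + w) \<longleftrightarrow>
    (\<forall>u\<in>Poly_Mapping.keys (subst Mon f). divisible W u)"
proof
  assume "\<exists>p\<in>Hom V c. \<exists>w\<in>Hom V c. subst Mon p = 0 \<and> w \<in> mono_ideal W \<and> f = p + w"
  then obtain p w where pw: "w \<in> Hom V c" "subst Mon p = 0" "w \<in> mono_ideal W" "f = p + w" by blast
  show "\<forall>u\<in>Poly_Mapping.keys (subst Mon f). divisible W u"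
  proof
    fix u assume "u \<in> Poly_Mapping.keys (subst Mon f)"
    then have "u \<in> Poly_Mapping.keys (subst Mon w)" using pw by (simp add: subst_Mon_add)
    then obtain m where m: "m \<in> Poly_Mapping.keys w" "u = monom_image m" using keys_subst_Mon by blast
    then obtain v where v: "v \<in> Poly_Mapping.keys m" "v \<in> W" using pw(3) by (auto simp: mono_ideal_def)
    then obtain i where i: "i \<le> n" "v = Poly_Mapping.single i d" using W by (auto simp: Th_def)
    have "u = v + monom_image (m - Poly_Mapping.single v 1)"
      using monom_image_add[of "Poly_Mapping.single v 1" "m - Poly_Mapping.single v 1"]
      unfolding m(2) minus_single_add[OF v(1)] by (simp only: monom_image_single)
    then show "divisible W u" using i v(2) by (auto simp: divisible_def lookup_add)
  qed
next
  assume div: "\<forall>u\<in>Poly_Mapping.keys (subst Mon f). divisible W u"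
  \<comment> \<open>Split off x_i^d, lift the cofactor to S and multiply the lift by the variable of
    S that maps to x_i^d.\<close>
  have "\<exists>m. Poly_Mapping.keys m \<subseteq> V \<and> int (mdeg m) = c \<and> Poly_Mapping.keys m \<inter> W \<noteq> {} \<and> monom_image m = u"
    if u: "u \<in> Poly_Mapping.keys (subst Mon f)" for u
  proof -
    obtain i where i: "i \<le> n" "Poly_Mapping.single i d \<in> W" "d \<le> Poly_Mapping.lookup u i"
      using div u by (auto simp: divisible_def)
    define v where "v = Poly_Mapping.single i d"
    define b where "b = u - v"
    have uvb: "u = v + b"
      by (rule poly_mapping_eqI) (use i(3) in \<open>auto simp: v_def b_def lookup_add lookup_minus lookup_single when_def\<close>)
    have v: "v \<in> V" "v \<in> W" using i(2) W Th_V by (auto simp: v_def)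
    have ib: "invar b" using invar_cancel[of v b] keys_subst_Hom(1)[OF f u] uvb v by (simp add: V_def)
    have "int d + int (mdeg b) = int d * c"
      using keys_subst_Hom(2)[OF f u] uvb by (simp add: mdeg_add v_def)
    then have e: "int (mdeg b) = int d * (c - 1)" by (simp add: algebra_simps)
    then have "0 \<le> int d * (c - 1)" by linarith
    \<comment> \<open>The cofactor has degree d (c - 1), so its degree in S is the natural number
      \<open>nat (c - 1)\<close>.\<close>
    then have "c \<ge> 1" using d_pos by (simp add: zero_le_mult_iff)
    then have "int (mdeg b) = int (d * nat (c - 1))" using e by simp
    then have "mdeg b = d * nat (c - 1)" by linarith
    then obtain m where m: "Poly_Mapping.keys m \<subseteq> V" "monom_image m = b" "mdeg m = nat (c - 1)"
      using monom_image_surj ib by blast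
    show ?thesis
      by (rule exI[of _ "Poly_Mapping.single v 1 + m"])
        (use m v uvb \<open>c \<ge> 1\<close> in \<open>auto simp: keys_add_nat monom_image_add mdeg_add simp del: One_nat_def\<close>)
  qed
  then obtain g where g: "\<And>u. u \<in> Poly_Mapping.keys (subst Mon f) \<Longrightarrow> Poly_Mapping.keys (g u) \<subseteq> V \<and>
      int (mdeg (g u)) = c \<and> Poly_Mapping.keys (g u) \<inter> W \<noteq> {} \<and> monom_image (g u) = u" by metis
  \<comment> \<open>Lifting the image of \<open>f\<close> term by term gives an element of the
    monomial ideal that differs from \<open>f\<close> by an element of I(X).\<close>
  define w where "w = (\<Sum>u\<in>Poly_Mapping.keys (subst Mon f). Poly_Mapping.single (g u) (Poly_Mapping.lookup (subst Mon f) u))"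
  have w: "w \<in> Hom V c" "w \<in> mono_ideal W"
    unfolding w_def using g by (intro Hom_sum Hom_single mono_ideal_sum; auto simp: mono_ideal_def)+
  have "subst Mon w = (\<Sum>u\<in>Poly_Mapping.keys (subst Mon f). Poly_Mapping.single u (Poly_Mapping.lookup (subst Mon f) u))"
    unfolding w_def subst_Mon_sum subst_Mon_single using g by (intro sum.cong) auto
  also have "\<dots> = subst Mon f" by (rule sum_single_keys[symmetric])
  finally have "subst Mon (f - w) = 0" by (simp add: subst_Mon_diff)
  then show "\<exists>p\<in>Hom V c. \<exists>w\<in>Hom V c. subst Mon p = 0 \<and> w \<in> mono_ideal W \<and> f = p + w"
    using w Hom_diff[OF f w(1)] by (intro bexI[of _ "f - w"] bexI[of _ w]) auto
qed

end

text \<open>A minimal resolution of \<open>S/I(X)\<close>, exact in degrees up to \<open>D\<close>. It starts with \<open>F 0 = S\<close>, so its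
  modules \<open>F (i + 1)\<close> are the modules at position \<open>i\<close> of a resolution of \<open>I(X)\<close>.\<close>

locale toric_complex = toric n d \<alpha> + minimal_free_complex V rk dg mt
  for n d \<alpha> rk dg and mt :: "nat \<Rightarrow> nat \<Rightarrow> nat \<Rightarrow> (nat \<Rightarrow>\<^sub>0 nat, 'a::field) mpoly" +
  fixes D t :: int
  assumes rk0: "rk 0 = 1" and dg0: "dg 0 = (\<lambda>_. 0)"
    and exact0: "c \<le> D \<Longrightarrow> bdry 0 ` F (Suc 0) c = {f \<in> F 0 c. subst Mon (f 0) = 0}"
    and exactS: "c \<le> D \<Longrightarrow> z \<in> F (Suc i) c \<Longrightarrow> bdry i z = 0 \<Longrightarrow> z \<in> bdry (Suc i) ` F (Suc (Suc i)) c"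
    and top_degree: "invar u \<Longrightarrow> int (mdeg u) = int d * c \<Longrightarrow> t < c \<Longrightarrow> \<exists>i\<le>n. d \<le> Poly_Mapping.lookup u i"
    and top_attained: "\<exists>u. invar u \<and> int (mdeg u) = int d * t \<and> (\<forall>i. Poly_Mapping.lookup u i < d)"
begin

lemma F0: "f \<in> F 0 c \<longleftrightarrow> f 0 \<in> Hom V c \<and> (\<forall>j\<ge>1. f j = 0)"
proof
  assume *: "f 0 \<in> Hom V c \<and> (\<forall>j\<ge>1. f j = 0)"
  have "f j \<in> Hom V c" for j using * by (cases j) auto
  then show "f \<in> F 0 c" using * by (simp add: free_deg_def rk0 dg0)
qed (simp add: free_deg_def rk0 dg0)

text \<open>At position 0 the boundaries modulo \<open>W\<close> are I(X) plus the ideal of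
  \<open>W\<close>; this turns regularity and top degree into questions about exponents.\<close>

lemma Bd0_iff:
  assumes W: "W \<subseteq> Th" and c: "c \<le> D" and f: "f \<in> F 0 c"
  shows "f \<in> Bd W 0 c \<longleftrightarrow> (\<forall>u\<in>Poly_Mapping.keys (subst Mon (f 0)). divisible W u)"
proof -
  have f0: "f 0 \<in> Hom V c" using f by (simp add: F0)
  have "f \<in> Bd W 0 c \<longleftrightarrow> (\<exists>p w. p \<in> bdry 0 ` F (Suc 0) c \<and> w \<in> FU W 0 c \<and> f = p + w)"
    unfolding Bd_def by blast
  also have "\<dots> \<longleftrightarrow> (\<exists>p w. p \<in> F 0 c \<and> subst Mon (p 0) = 0 \<and> w \<in> FU W 0 c \<and> f = p + w)"
    using exact0[OF c] by blast
  also have "\<dots> \<longleftrightarrow> (\<exists>p\<in>Hom V c. \<exists>w\<in>Hom V c. subst Mon p = 0 \<and> w \<in> mono_ideal W \<and> f 0 = p + w)" (is "?L \<longleftrightarrow> ?R")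
  proof
    assume ?L
    then show ?R by (auto simp: F0)
  next
    assume ?R
    then obtain p w where pw: "p \<in> Hom V c" "w \<in> Hom V c" "subst Mon p = 0" "w \<in> mono_ideal W" "f 0 = p + w"
      by blast
    let ?e = "\<lambda>q j. if j = 0 then q else (0 :: (nat \<Rightarrow>\<^sub>0 nat, 'a) mpoly)"
    have "f = ?e p + ?e w"
    proof
      fix j show "f j = (?e p + ?e w) j" using pw f by (cases "j = 0") (auto simp: F0)
    qed
    moreover have "?e p \<in> F 0 c" "?e w \<in> FU W 0 c" using pw by (auto simp: F0)
    moreover have "subst Mon (?e p 0) = 0" using pw by simp
    ultimately show ?L by blast
  qed
  also have "\<dots> \<longleftrightarrow> (\<forall>u\<in>Poly_Mapping.keys (subst Mon (f 0)). divisible W u)"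
    by (rule kernel_plus_mono_ideal_iff[OF W f0])
  finally show ?thesis .
qed

sublocale regular_graded_complex V F bdry "\<lambda>v f j. Var v * f j" FU Th D t
proof
  show "finite V" by (rule finite_V)
  show "Th \<subseteq> V" by (rule Th_V)
  show "z \<in> bdry (Suc i) ` F (Suc (Suc i)) c" if "c \<le> D" "z \<in> F (Suc i) c" "bdry i z = 0" for c z i
    using exactS that by blast
  show "f \<in> Bd W 0 c" if v: "v \<in> Th" "W \<subseteq> Th" "v \<notin> W" and c: "c < D" and f: "f \<in> F 0 c"
    and xf: "(\<lambda>j. Var v * f j) \<in> Bd W 0 (c + 1)" for v W c f
  proof -
    have xF: "(\<lambda>j. Var v * f j) \<in> F 0 (c + 1)" using x_C v(1) Th_V f by blast
    have "\<forall>u\<in>Poly_Mapping.keys (Mon v * subst Mon (f 0)). divisible W u"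
      using xf c v(2) xF subst_Mon_single_mult[of "Poly_Mapping.single v 1" 1 "f 0"]
      by (subst (asm) Bd0_iff) (auto simp: monom_image_single[unfolded One_nat_def])
    then have *: "divisible W (v + u)" if "u \<in> Poly_Mapping.keys (subst Mon (f 0))" for u
      using that by (auto simp: keys_Mon_mult)
    obtain k where k: "v = Poly_Mapping.single k d" using v(1) by (auto simp: Th_def)
    have "divisible W u" if uk: "u \<in> Poly_Mapping.keys (subst Mon (f 0))" for u
    proof -
      obtain i where i: "i \<le> n" "Poly_Mapping.single i d \<in> W" "d \<le> Poly_Mapping.lookup (v + u) i"
        using *[OF uk] by (auto simp: divisible_def)
      then have "i \<noteq> k" using k v(3) by auto
      then have "d \<le> Poly_Mapping.lookup u i" using i(3) k by (simp add: lookup_add lookup_single)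
      then show ?thesis using i by (auto simp: divisible_def)
    qed
    then show ?thesis using Bd0_iff[OF v(2) _ f] c by simp
  qed
  show "F 0 c \<subseteq> Bd Th 0 c" if c: "c \<le> D" "t < c" for c
  proof
    fix f :: "nat \<Rightarrow> (nat \<Rightarrow>\<^sub>0 nat, 'a) mpoly" assume f: "f \<in> F 0 c"
    then have f0: "f 0 \<in> Hom V c" by (simp add: F0)
    have "divisible Th u" if "u \<in> Poly_Mapping.keys (subst Mon (f 0))" for u
      using top_degree[OF keys_subst_Hom[OF f0 that] c(2)] by (auto simp: divisible_def Th_def)
    then show "f \<in> Bd Th 0 c" using Bd0_iff[OF _ c(1) f] by simp
  qed
qed

text \<open>A basis vector is a nonzero class modulo all variables, so its degree cannot exceed the
  vanishing line.\<close>

theorem generator_degree_le: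
  assumes "k < rk i" "int (dg i k) \<le> D"
  shows "int (dg i k) \<le> int i + t"
proof (rule ccontr)
  assume "\<not> ?thesis"
  then have "Cyc V i (int (dg i k)) \<subseteq> Bd V i (int (dg i k))"
    using Cyc_vanish[of V] Th_V assms(2) by simp
  then show False using unit_Cyc[OF assms(1)] unit_not_Bd by blast
qed

text \<open>Start from the reduced monomial of top degree, which is nonzero in A modulo
  \<open>Th\<close>, and push its class through the remaining variables.\<close>

theorem extremal_generator:
  assumes "int (card (V - Th)) + t \<le> D"
  shows "\<exists>j<rk (card (V - Th)). int (dg (card (V - Th)) j) = int (card (V - Th)) + t"
proof -
  obtain u where u: "invar u" "int (mdeg u) = int d * t" "\<forall>i. Poly_Mapping.lookup u i < d"
    using top_attained by blast
  then have "0 \<le> int d * t" by linarith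
  then have t0: "t \<ge> 0" using d_pos by (simp add: zero_le_mult_iff)
  then have "int (mdeg u) = int (d * nat t)" using u(2) by simp
  then have "mdeg u = d * nat t" by linarith
  then obtain m where m: "Poly_Mapping.keys m \<subseteq> V" "monom_image m = u" "mdeg m = nat t"
    using monom_image_surj u(1) by blast
  define z where "z = (\<lambda>j::nat. if j = 0 then Mon m else (0 :: (nat \<Rightarrow>\<^sub>0 nat, 'a) mpoly))"
  have z: "z \<in> F 0 t" using m t0 by (auto simp: F0 z_def intro: Hom_single)
  have "\<not> divisible Th u" using u(3) by (auto simp: divisible_def not_le)
  then have "z \<notin> Bd Th 0 t"
    using assms by (subst Bd0_iff[OF _ _ z]) (auto simp: z_def subst_Mon_single m(2))
  from Cyc_nonboundary[OF z this assms] obtain h where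
    "h \<in> Cyc V (card (V - Th)) (int (card (V - Th)) + t)"
    "h \<notin> Bd V (card (V - Th)) (int (card (V - Th)) + t)" by blast
  then show ?thesis using not_Bd_generator by (auto simp: Cyc_def)
qed

end

section \<open>Existence of minimal graded free resolutions\<close>

definition graded_submodule :: "'v set \<Rightarrow> nat \<Rightarrow> (nat \<Rightarrow> nat) \<Rightarrow>
    (int \<Rightarrow> (nat \<Rightarrow> ('v, 'a::comm_ring_1) mpoly) set) \<Rightarrow> bool" where
  "graded_submodule V r a K \<longleftrightarrow> (\<forall>c. K c \<subseteq> free_deg V r a c) \<and> (\<forall>c. 0 \<in> K c) \<and>
     (\<forall>c f g. f \<in> K c \<longrightarrow> g \<in> K c \<longrightarrow> f - g \<in> K c) \<and>
     (\<forall>c e q f. q \<in> Hom V e \<longrightarrow> f \<in> K c \<longrightarrow> (\<lambda>j. q * f j) \<in> K (c + e))"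

lemma fun_sum_apply: "(\<Sum>x\<in>A. f x) j = (\<Sum>x\<in>A. f x j)"
  by (induction A rule: infinite_finite_induct) auto

text \<open>The graded pieces of a free module are spanned by finitely many monomial multiples of
  basis vectors, so a maximal independent subset of \<open>K c\<close> is finite.\<close>

lemma graded_piece_finite_span:
  fixes K :: "int \<Rightarrow> (nat \<Rightarrow> ('v, 'a::field) mpoly) set"
  assumes V: "finite V" and K: "graded_submodule V r a K"
  shows "\<exists>B\<subseteq>K c. finite B \<and> (\<forall>f\<in>K c. \<exists>s. f = (\<lambda>j. \<Sum>h\<in>B. Const (s h) * h j))"
proof -
  define scale where "scale s f = (\<lambda>j. Const s * f j)" for s :: 'a and f :: "nat \<Rightarrow> ('v, 'a) mpoly"
  interpret vs: vector_space scale
  proof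
    fix s t :: 'a and f g :: "nat \<Rightarrow> ('v, 'a) mpoly"
    show "scale s (f + g) = scale s f + scale s g"
      by (simp add: scale_def fun_eq_iff distrib_left)
    show "scale (s + t) f = scale s f + scale t f"
      by (simp add: scale_def fun_eq_iff distrib_right single_add)
    show "scale s (scale t f) = scale (s * t) f"
      by (simp add: scale_def fun_eq_iff mult_single flip: mult.assoc)
    show "scale 1 f = f"
      by (simp add: scale_def fun_eq_iff)
  qed
  define E where "E = (\<lambda>(j0, m) (j :: nat). if j = j0 then Mon m else (0 :: ('v, 'a) mpoly))"
  define T where "T = E ` ({..<r} \<times> {m. Poly_Mapping.keys m \<subseteq> V \<and> mdeg m \<le> nat c})"
  have T: "finite T"
    unfolding T_def using finite_monoms[OF V] by blast
  have "free_deg V r a c \<subseteq> vs.span T"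
  proof
    fix f :: "nat \<Rightarrow> ('v, 'a) mpoly" assume f: "f \<in> free_deg V r a c"
    have "f = (\<Sum>j0<r. \<Sum>m\<in>Poly_Mapping.keys (f j0). scale (Poly_Mapping.lookup (f j0) m) (E (j0, m)))"
    proof
      fix j
      have "(\<Sum>j0<r. \<Sum>m\<in>Poly_Mapping.keys (f j0). scale (Poly_Mapping.lookup (f j0) m) (E (j0, m))) j =
        (\<Sum>j0<r. if j = j0 then \<Sum>m\<in>Poly_Mapping.keys (f j0). Poly_Mapping.single m (Poly_Mapping.lookup (f j0) m) else 0)"
        unfolding fun_sum_apply
        by (intro sum.cong) (auto simp: scale_def E_def mult_single)
      also have "\<dots> = (\<Sum>j0<r. if j = j0 then f j0 else 0)"
        using sum_single_keys[of "f _"] by (intro sum.cong) auto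
      also have "\<dots> = f j" using f by (simp add: free_deg_def)
      finally show "f j = (\<Sum>j0<r. \<Sum>m\<in>Poly_Mapping.keys (f j0). scale (Poly_Mapping.lookup (f j0) m) (E (j0, m))) j" ..
    qed
    also have "\<dots> \<in> vs.span T"
    proof (intro vs.span_sum vs.span_scale vs.span_base)
      fix j0 m assume j0: "j0 \<in> {..<r}" and m: "m \<in> Poly_Mapping.keys (f j0)"
      have "Poly_Mapping.keys m \<subseteq> V" "int (mdeg m) = c - int (a j0)"
        using f m by (auto simp: free_deg_def Hom_def)
      then show "E (j0, m) \<in> T" using j0 by (auto simp: T_def)
    qed
    finally show "f \<in> vs.span T" .
  qed
  moreover obtain B where B: "B \<subseteq> K c" "vs.independent B" "K c \<subseteq> vs.span B"
    using vs.maximal_independent_subset[of "K c"] by blast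
  moreover have "K c \<subseteq> free_deg V r a c" using K by (simp add: graded_submodule_def)
  ultimately have "B \<subseteq> vs.span T" by blast
  then have fB: "finite B" using vs.independent_span_bound[OF T B(2)] by blast
  have "\<exists>s. f = (\<lambda>j. \<Sum>h\<in>B. Const (s h) * h j)" if "f \<in> K c" for f
  proof -
    have "f \<in> range (\<lambda>u. \<Sum>v\<in>B. scale (u v) v)"
      using B(3) that vs.span_finite[OF fB] by blast
    then obtain s where "f = (\<Sum>v\<in>B. scale (s v) v)" by blast
    then show ?thesis by (auto simp: fun_eq_iff fun_sum_apply scale_def)
  qed
  then show ?thesis using B(1) fB by blast
qed

text \<open>Each generator is stored together with its degree, since the function alone does not
  record it.\<close>

definition generates_upto :: "'v set \<Rightarrow> int \<Rightarrow> (int \<Rightarrow> (nat \<Rightarrow> ('v, 'a::comm_ring_1) mpoly) set) \<Rightarrow>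
    (nat \<times> (nat \<Rightarrow> ('v, 'a) mpoly)) set \<Rightarrow> bool" where
  "generates_upto V D K G \<longleftrightarrow> finite G \<and> (\<forall>g\<in>G. snd g \<in> K (int (fst g)) \<and> int (fst g) \<le> D) \<and>
     (\<forall>c\<le>D. \<forall>f\<in>K c. \<exists>w. (\<forall>g\<in>G. w g \<in> Hom V (c - int (fst g))) \<and> f = (\<lambda>j. \<Sum>g\<in>G. w g * snd g j))"

text \<open>Collecting spanning sets of the pieces of degree 0 to \<open>D\<close> suffices;
  constants are the only coefficients required, and pieces of negative degree are zero.\<close>

lemma generates_upto_exists:
  fixes K :: "int \<Rightarrow> (nat \<Rightarrow> ('v, 'a::field) mpoly) set"
  assumes V: "finite V" and K: "graded_submodule V r a K"
  shows "\<exists>G. generates_upto V D K G"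
proof -
  have "\<forall>c. \<exists>B. B \<subseteq> K c \<and> finite B \<and> (\<forall>f\<in>K c. \<exists>s. f = (\<lambda>j. \<Sum>h\<in>B. Const (s h) * h j))"
    using graded_piece_finite_span[OF V K] by blast
  from choice[OF this] obtain B where
    B: "\<And>c. B c \<subseteq> K c \<and> finite (B c) \<and> (\<forall>f\<in>K c. \<exists>s. f = (\<lambda>j. \<Sum>h\<in>B c. Const (s h) * h j))"
    by blast
  define A where "A = {e. int e \<le> D}"
  have "A \<subseteq> {..nat D}" by (auto simp: A_def)
  then have A: "finite A" using finite_subset by blast
  define G where "G = (SIGMA e:A. B (int e))"
  have G: "finite G" using A B by (auto simp: G_def)
  have ex: "\<exists>w. (\<forall>g\<in>G. w g \<in> Hom V (c - int (fst g))) \<and> f = (\<lambda>j. \<Sum>g\<in>G. w g * snd g j)"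
    if c: "c \<le> D" and f: "f \<in> K c" for c f
  proof (cases "c < 0")
    case True
    have "f j = 0" for j
      using f K True Hom_neg[of "c - int (a j)" "f j" V] by (auto simp: graded_submodule_def free_deg_def)
    then show ?thesis by (intro exI[of _ "\<lambda>_. 0"]) auto
  next
    case False
    define e where "e = nat c"
    have e: "int e = c" "e \<in> A" using False c by (auto simp: e_def A_def)
    obtain s where s: "f = (\<lambda>j. \<Sum>h\<in>B c. Const (s h) * h j)" using B f by blast
    define w where "w = (\<lambda>g. if fst g = e then Const (s (snd g)) else (0 :: ('v, 'a) mpoly))"
    have "(\<Sum>g\<in>G. w g * snd g j) = f j" for j
    proof -
      have "(\<Sum>g\<in>G. w g * snd g j) = (\<Sum>k\<in>A. \<Sum>h\<in>B (int k). w (k, h) * h j)"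
        unfolding G_def using A B by (subst sum.Sigma) (auto intro: sum.cong)
      also have "\<dots> = (\<Sum>k\<in>A. if k = e then \<Sum>h\<in>B (int k). Const (s h) * h j else 0)"
        by (intro sum.cong) (auto simp: w_def)
      also have "\<dots> = f j" using A e s by simp
      finally show ?thesis .
    qed
    moreover have "\<forall>g\<in>G. w g \<in> Hom V (c - int (fst g))" using e Hom_Const by (auto simp: w_def)
    ultimately show ?thesis by (intro exI[of _ w]) auto
  qed
  have "\<forall>g\<in>G. snd g \<in> K (int (fst g)) \<and> int (fst g) \<le> D"
    using B unfolding G_def A_def by fastforce
  then show ?thesis
    using G unfolding generates_upto_def by (intro exI[of _ G] conjI allI impI ballI ex) auto
qed

text \<open>A relation with an invertible coefficient at \<open>g0\<close> can be subtracted,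
  suitably scaled, from any representation so that the coefficient of \<open>g0\<close>
  disappears.\<close>

lemma generates_upto_remove:
  fixes K :: "int \<Rightarrow> (nat \<Rightarrow> ('v, 'a::field) mpoly) set"
  assumes G: "generates_upto V D K G" and g0: "g0 \<in> G"
    and u: "\<And>g. g \<in> G \<Longrightarrow> u g \<in> Hom V (int (fst g0) - int (fst g))"
    and rel: "\<And>j. (\<Sum>g\<in>G. u g * snd g j) = 0" and s: "u g0 = Const s" "s \<noteq> 0"
  shows "generates_upto V D K (G - {g0})"
proof -
  have fin: "finite G" using G by (simp add: generates_upto_def)
  have "\<exists>w. (\<forall>g\<in>G - {g0}. w g \<in> Hom V (c - int (fst g))) \<and> f = (\<lambda>j. \<Sum>g\<in>G - {g0}. w g * snd g j)"
    if c: "c \<le> D" and f: "f \<in> K c" for c f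
  proof -
    obtain w where w: "\<forall>g\<in>G. w g \<in> Hom V (c - int (fst g))" "f = (\<lambda>j. \<Sum>g\<in>G. w g * snd g j)"
      using G c f unfolding generates_upto_def by blast
    define q where "q = w g0 * Const (1 / s)"
    have q: "q \<in> Hom V (c - int (fst g0))"
      using Hom_mult[of "w g0" V _ "Const (1 / s)" 0] w(1) g0 Hom_Const by (auto simp: q_def)
    have qs: "q * u g0 = w g0"
      using s by (simp add: q_def mult.assoc mult_single)
    have "f j = (\<Sum>g\<in>G - {g0}. (w g - q * u g) * snd g j)" for j
    proof -
      have "(\<Sum>g\<in>G. (w g - q * u g) * snd g j) = f j - q * (\<Sum>g\<in>G. u g * snd g j)"
        by (simp add: w(2) left_diff_distrib sum_subtractf sum_distrib_left mult.assoc)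
      also have "\<dots> = f j" using rel by simp
      also have "(\<Sum>g\<in>G. (w g - q * u g) * snd g j) =
          (w g0 - q * u g0) * snd g0 j + (\<Sum>g\<in>G - {g0}. (w g - q * u g) * snd g j)"
        by (rule sum.remove[OF fin g0])
      finally show ?thesis using qs by simp
    qed
    moreover have "w g - q * u g \<in> Hom V (c - int (fst g))" if "g \<in> G - {g0}" for g
      using Hom_diff[of "w g" V "c - int (fst g)" "q * u g"] Hom_mult[OF q u[of g]] w(1) that by auto
    ultimately show ?thesis by (intro exI[of _ "\<lambda>g. w g - q * u g"]) auto
  qed
  then show ?thesis using G unfolding generates_upto_def by blast
qed

text \<open>The columns of the matrix in the triple \<open>s = (r', a', M)\<close> are minimal generators, of the
  degrees \<open>a'\<close>, of the submodule generated by all \<open>K c\<close> with \<open>c \<le> D\<close>.\<close>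

definition minimal_cover :: "'v set \<Rightarrow> int \<Rightarrow> (int \<Rightarrow> (nat \<Rightarrow> ('v, 'a::comm_ring_1) mpoly) set) \<Rightarrow>
    nat \<times> (nat \<Rightarrow> nat) \<times> (nat \<Rightarrow> nat \<Rightarrow> ('v, 'a) mpoly) \<Rightarrow> bool" where
  "minimal_cover V D K s \<longleftrightarrow> (case s of (r', a', M) \<Rightarrow>
     (\<forall>k<r'. (\<lambda>j. M j k) \<in> K (int (a' k)) \<and> int (a' k) \<le> D) \<and>
     (\<forall>c\<le>D. K c \<subseteq> mat_map r' M ` free_deg V r' a' c) \<and>
     (\<forall>c. \<forall>w\<in>free_deg V r' a' c. mat_map r' M w = 0 \<longrightarrow> (\<forall>k. Poly_Mapping.lookup (w k) 0 = 0)))"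

text \<open>A generating set of least cardinality works: a relation with a nonzero constant term
  would allow one generator to be removed.\<close>

lemma minimal_cover_exists:
  fixes K :: "int \<Rightarrow> (nat \<Rightarrow> ('v, 'a::field) mpoly) set"
  assumes V: "finite V" and K: "graded_submodule V r a K"
  shows "\<exists>s. minimal_cover V D K s"
proof -
  obtain G where G: "generates_upto V D K G" and least: "\<And>G'. generates_upto V D K G' \<Longrightarrow> card G \<le> card G'"
    using generates_upto_exists[OF V K, of D] ex_has_least_nat[of "generates_upto V D K" _ card] by metis
  have fin: "finite G" using G by (simp add: generates_upto_def)
  obtain g where g: "bij_betw g {..<card G} G"
    using ex_bij_betw_nat_finite[OF fin] by (auto simp: atLeast0LessThan)
  have gG: "g k \<in> G" if "k < card G" for k using g that by (auto simp: bij_betw_def)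
  define M where "M j k = snd (g k) j" for j k
  define a' where "a' k = fst (g k)" for k
  have map_eq: "mat_map (card G) M w j = (\<Sum>h\<in>G. w (the_inv_into {..<card G} g h) * snd h j)" for w j
  proof -
    have "(\<Sum>h\<in>G. w (the_inv_into {..<card G} g h) * snd h j) =
      (\<Sum>k<card G. w (the_inv_into {..<card G} g (g k)) * snd (g k) j)"
      using sum.reindex_bij_betw[OF g, of "\<lambda>h. w (the_inv_into {..<card G} g h) * snd h j"] by simp
    also have "\<dots> = (\<Sum>k<card G. M j k * w k)"
      using g by (intro sum.cong) (auto simp: M_def the_inv_into_f_f bij_betw_def mult.commute)
    finally show ?thesis by (simp add: mat_map_def)
  qed
  have "f \<in> mat_map (card G) M ` free_deg V (card G) a' c" if cf: "c \<le> D" "f \<in> K c" for c f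
  proof -
    obtain w where w: "\<forall>g\<in>G. w g \<in> Hom V (c - int (fst g))" "f = (\<lambda>j. \<Sum>g\<in>G. w g * snd g j)"
      using G cf unfolding generates_upto_def by blast
    define w' where "w' k = (if k < card G then w (g k) else 0)" for k
    have "(\<Sum>h\<in>G. w' (the_inv_into {..<card G} g h) * snd h j) = (\<Sum>h\<in>G. w h * snd h j)" for j
    proof (rule sum.cong)
      fix h assume h: "h \<in> G"
      then have "the_inv_into {..<card G} g h < card G" "g (the_inv_into {..<card G} g h) = h"
        using g the_inv_into_into[of g "{..<card G}" h "{..<card G}"] f_the_inv_into_f[of g "{..<card G}" h]
        by (auto simp: bij_betw_def)
      then show "w' (the_inv_into {..<card G} g h) * snd h j = w h * snd h j" by (simp add: w'_def)
    qed simp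
    then have "f = mat_map (card G) M w'" by (simp add: fun_eq_iff map_eq w(2))
    moreover have "w' \<in> free_deg V (card G) a' c"
      using w(1) gG by (auto simp: free_deg_def w'_def a'_def)
    ultimately show ?thesis by blast
  qed
  moreover have "Poly_Mapping.lookup (w k) 0 = 0"
    if w: "w \<in> free_deg V (card G) a' c" and z: "mat_map (card G) M w = 0" for c w k
  proof (rule ccontr)
    assume nz: "Poly_Mapping.lookup (w k) 0 \<noteq> 0"
    then have k: "k < card G" using w by (auto simp: free_deg_def not_less[symmetric])
    define u where "u h = w (the_inv_into {..<card G} g h)" for h
    have wk: "w k \<in> Hom V (c - int (a' k))" using w by (simp add: free_deg_def)
    \<comment> \<open>A nonzero constant term forces the relation to live in the degree of generator
      \<open>k\<close>, so that its coefficient there is a constant.\<close>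
    have c: "c = int (a' k)" using Hom_const_term(1)[OF wk nz] by simp
    have uk: "u (g k) = w k" using g k by (auto simp: u_def the_inv_into_f_f bij_betw_def)
    have "generates_upto V D K (G - {g k})"
    proof (rule generates_upto_remove[OF G gG[OF k], where u = u])
      show "(\<Sum>h\<in>G. u h * snd h j) = 0" for j using z map_eq[of w j] by (simp add: u_def)
      show "u (g k) = Const (Poly_Mapping.lookup (w k) 0)" using Hom_const_term(2)[OF wk nz] uk by simp
      show "Poly_Mapping.lookup (w k) 0 \<noteq> 0" by (rule nz)
      fix h assume h: "h \<in> G"
      have "g (the_inv_into {..<card G} g h) = h"
        using g h f_the_inv_into_f[of g "{..<card G}" h] by (auto simp: bij_betw_def)
      then show "u h \<in> Hom V (int (fst (g k)) - int (fst h))"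
        using w c by (auto simp: free_deg_def u_def a'_def) (metis)
    qed
    then have "card G \<le> card (G - {g k})" by (rule least)
    then show False using card_Diff1_less[OF fin gG[OF k]] by simp
  qed
  moreover have "(\<lambda>j. M j k) \<in> K (int (a' k)) \<and> int (a' k) \<le> D" if "k < card G" for k
    using gG[OF that] G by (auto simp: generates_upto_def M_def a'_def)
  ultimately show ?thesis
    unfolding minimal_cover_def by (intro exI[of _ "(card G, a', M)"]) auto
qed

lemma graded_submodule_kernel: "graded_submodule V r a (\<lambda>c. {w \<in> free_deg V r a c. mat_map r M w = 0})"
  unfolding graded_submodule_def
  by (auto simp: free_deg_zero free_deg_diff mat_map_diff free_deg_mult mat_map_mult fun_eq_iff)

section \<open>Resolutions built from minimal covers\<close>

context
  fixes V :: "'v set" and K0 :: "int \<Rightarrow> (nat \<Rightarrow> ('v, 'a::field) mpoly) set"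
begin

text \<open>The module \<open>F\<^sub>i\<^sub>+\<^sub>1\<close> of the resolution and its map to \<open>F\<^sub>i\<close>, where only generators of degree at most
  \<open>E i\<close> are taken. A fixed choice makes the first steps depend on the first values of \<open>E\<close> only.\<close>

primrec res :: "(nat \<Rightarrow> int) \<Rightarrow> nat \<Rightarrow> nat \<times> (nat \<Rightarrow> nat) \<times> (nat \<Rightarrow> nat \<Rightarrow> ('v, 'a) mpoly)" where
  "res E 0 = (SOME s. minimal_cover V (E 0) K0 s)"
| "res E (Suc i) = (SOME s. minimal_cover V (E (Suc i))
     (\<lambda>c. {w \<in> free_deg V (fst (res E i)) (fst (snd (res E i))) c.
       mat_map (fst (res E i)) (snd (snd (res E i))) w = 0}) s)"

text \<open>Index shift: \<open>res E k\<close> describes the module at position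
  \<open>Suc k\<close>, while position 0 is S itself, of rank 1 and generated in degree 0.\<close>

definition res_rank :: "(nat \<Rightarrow> int) \<Rightarrow> nat \<Rightarrow> nat" where
  "res_rank E i = (case i of 0 \<Rightarrow> 1 | Suc k \<Rightarrow> fst (res E k))"

definition res_deg :: "(nat \<Rightarrow> int) \<Rightarrow> nat \<Rightarrow> nat \<Rightarrow> nat" where
  "res_deg E i = (case i of 0 \<Rightarrow> \<lambda>_. 0 | Suc k \<Rightarrow> fst (snd (res E k)))"

definition res_mat :: "(nat \<Rightarrow> int) \<Rightarrow> nat \<Rightarrow> nat \<Rightarrow> nat \<Rightarrow> ('v, 'a) mpoly" where
  "res_mat E i = snd (snd (res E i))"

text \<open>The module that position \<open>Suc i\<close> has to cover: the given submodule of S for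
  \<open>i = 0\<close>, the syzygies afterwards.\<close>

definition res_ker :: "(nat \<Rightarrow> int) \<Rightarrow> nat \<Rightarrow> int \<Rightarrow> (nat \<Rightarrow> ('v, 'a) mpoly) set" where
  "res_ker E i c = (case i of 0 \<Rightarrow> K0 c | Suc k \<Rightarrow>
     {w \<in> free_deg V (res_rank E i) (res_deg E i) c. mat_map (res_rank E i) (res_mat E k) w = 0})"

lemma res_agree:
  assumes "\<And>k. k < i \<Longrightarrow> E k = E' k"
  shows "k < i \<Longrightarrow> res E k = res E' k"
  by (induction k) (use assms in auto)

context
  assumes V: "finite V" and K0: "graded_submodule V 1 (\<lambda>_. 0) K0"
begin

lemma res_ker_submodule: "graded_submodule V (res_rank E i) (res_deg E i) (res_ker E i)"
  using K0 graded_submodule_kernel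
  by (cases i) (auto simp: res_ker_def[abs_def] res_rank_def res_deg_def)

lemma res_cover: "minimal_cover V (E i) (res_ker E i) (res_rank E (Suc i), res_deg E (Suc i), res_mat E i)"
proof -
  have "res E i = (SOME s. minimal_cover V (E i) (res_ker E i) s)"
    by (cases i) (auto simp: res_ker_def[abs_def] res_rank_def res_deg_def res_mat_def)
  then have "minimal_cover V (E i) (res_ker E i) (res E i)"
    using someI_ex[OF minimal_cover_exists[OF V res_ker_submodule]] by metis
  then show ?thesis by (simp add: res_rank_def res_deg_def res_mat_def)
qed

lemma res_column: "k < res_rank E (Suc i) \<Longrightarrow>
    (\<lambda>j. res_mat E i j k) \<in> res_ker E i (int (res_deg E (Suc i) k)) \<and> int (res_deg E (Suc i) k) \<le> E i"
  using res_cover[of E i] by (simp add: minimal_cover_def)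

lemma res_ker_free: "res_ker E i c \<subseteq> free_deg V (res_rank E i) (res_deg E i) c"
  using res_ker_submodule[of E i] by (auto simp: graded_submodule_def)

lemma res_map_ker:
  assumes "w \<in> free_deg V (res_rank E (Suc i)) (res_deg E (Suc i)) c"
  shows "mat_map (res_rank E (Suc i)) (res_mat E i) w \<in> res_ker E i c"
proof -
  have sub: "\<And>p q. p \<in> res_ker E i c \<Longrightarrow> q \<in> res_ker E i c \<Longrightarrow> p - q \<in> res_ker E i c" "0 \<in> res_ker E i c"
    "\<And>q f c e. q \<in> Hom V e \<Longrightarrow> f \<in> res_ker E i c \<Longrightarrow> (\<lambda>j. q * f j) \<in> res_ker E i (c + e)"
    using res_ker_submodule[of E i] unfolding graded_submodule_def by blast+
  have add: "p + q \<in> res_ker E i c" if "p \<in> res_ker E i c" "q \<in> res_ker E i c" for p q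
    using sub(1)[OF that(1) sub(1)[OF sub(2) that(2)]] by simp
  have sum: "(\<Sum>x\<in>A. h x) \<in> res_ker E i c" if "\<And>x. x \<in> A \<Longrightarrow> h x \<in> res_ker E i c" for A and h :: "nat \<Rightarrow> _"
    using that by (induction A rule: infinite_finite_induct) (auto intro: sub(2) add)
  have "mat_map (res_rank E (Suc i)) (res_mat E i) w =
      (\<Sum>k<res_rank E (Suc i). (\<lambda>j. w k * res_mat E i j k))"
    by (auto simp: mat_map_def fun_sum_apply fun_eq_iff mult.commute)
  also have "\<dots> \<in> res_ker E i c"
  proof (rule sum)
    fix k assume "k \<in> {..<res_rank E (Suc i)}"
    then have "(\<lambda>j. res_mat E i j k) \<in> res_ker E i (int (res_deg E (Suc i) k))"
      using res_column by blast
    moreover have "w k \<in> Hom V (c - int (res_deg E (Suc i) k))" using assms by (simp add: free_deg_def)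
    ultimately show "(\<lambda>j. w k * res_mat E i j k) \<in> res_ker E i c" using sub(3) by fastforce
  qed
  finally show ?thesis .
qed

text \<open>The columns of each later matrix are relations among the generators of the previous
  cover, whose minimality excludes constant terms. For the first matrix this is the assumption on
  \<open>K0\<close>.\<close>

lemma res_complex:
  assumes proper: "\<And>f c j. f \<in> K0 c \<Longrightarrow> Poly_Mapping.lookup (f j) 0 = 0"
  shows "minimal_free_complex V (res_rank E) (res_deg E) (res_mat E)"
proof
  fix k i j
  assume k: "k < res_rank E (Suc i)"
  show "(\<lambda>j. res_mat E i j k) \<in> free_deg V (res_rank E i) (res_deg E i) (int (res_deg E (Suc i) k))"
    using res_column[OF k] res_ker_free by blast
  show "Poly_Mapping.lookup (res_mat E i j k) 0 = 0"
  proof (cases i)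
    case 0
    then show ?thesis using res_column[OF k] proper by (auto simp: res_ker_def)
  next
    case (Suc l)
    then have "(\<lambda>j. res_mat E i j k) \<in> free_deg V (res_rank E (Suc l)) (res_deg E (Suc l)) (int (res_deg E (Suc i) k))"
      "mat_map (res_rank E (Suc l)) (res_mat E l) (\<lambda>j. res_mat E i j k) = 0"
      using res_column[OF k] by (auto simp: res_ker_def)
    then show ?thesis using res_cover[of E l] unfolding minimal_cover_def by fast
  qed
next
  fix w :: "nat \<Rightarrow> ('v, 'a) mpoly" and i c
  assume "w \<in> free_deg V (res_rank E (Suc (Suc i))) (res_deg E (Suc (Suc i))) c"
  from res_map_ker[OF this] show "mat_map (res_rank E (Suc i)) (res_mat E i)
      (mat_map (res_rank E (Suc (Suc i))) (res_mat E (Suc i)) w) = 0"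
    by (simp add: res_ker_def)
qed

lemma res_exact: "c \<le> E i \<Longrightarrow> res_ker E i c \<subseteq> mat_map (res_rank E (Suc i)) (res_mat E i) `
    free_deg V (res_rank E (Suc i)) (res_deg E (Suc i)) c"
  using res_cover[of E i] by (simp add: minimal_cover_def)

end

end

text \<open>Here \<open>t\<close> is the top degree of A modulo the x_i^d, where degrees in A are
  degrees in x divided by \<open>d\<close>.\<close>

locale toric_top = toric +
  fixes t :: int
  assumes top_degree: "invar u \<Longrightarrow> int (mdeg u) = int d * c \<Longrightarrow> t < c \<Longrightarrow> \<exists>i\<le>n. d \<le> Poly_Mapping.lookup u i"
    and top_attained: "\<exists>u. invar u \<and> int (mdeg u) = int d * t \<and> (\<forall>i. Poly_Mapping.lookup u i < d)"
begin

definition kernel :: "int \<Rightarrow> (nat \<Rightarrow> (nat \<Rightarrow>\<^sub>0 nat, 'a::field) mpoly) set" where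
  "kernel c = {f \<in> free_deg V 1 (\<lambda>_. 0) c. subst Mon (f 0) = 0}"

lemma kernel_submodule: "graded_submodule V 1 (\<lambda>_. 0) kernel"
  unfolding graded_submodule_def kernel_def
  by (auto simp: free_deg_zero free_deg_diff free_deg_mult subst_Mon_diff subst_Mon_mult)

lemma kernel_const_term:
  assumes "subst Mon p = 0" "p \<in> Hom V c"
  shows "Poly_Mapping.lookup p 0 = 0"
proof (rule ccontr)
  assume "Poly_Mapping.lookup p 0 \<noteq> 0"
  from Hom_const_term(2)[OF assms(2) this]
  have "Poly_Mapping.lookup (subst Mon p) 0 = Poly_Mapping.lookup p 0"
    using subst_Mon_single[of 0 "Poly_Mapping.lookup p 0"] by (metis lookup_single_eq monom_image_zero)
  then show False using assms \<open>Poly_Mapping.lookup p 0 \<noteq> 0\<close> by simp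
qed

lemma kernel_proper: "f \<in> kernel c \<Longrightarrow> Poly_Mapping.lookup (f j) 0 = 0"
  using kernel_const_term[of "f 0" c] by (cases j) (auto simp: kernel_def free_deg_def)

lemma toric_complexI:
  fixes rk dg and mt :: "nat \<Rightarrow> nat \<Rightarrow> nat \<Rightarrow> (nat \<Rightarrow>\<^sub>0 nat, 'a::field) mpoly"
  assumes "minimal_free_complex V rk dg mt" "rk 0 = 1" "dg 0 = (\<lambda>_. 0)"
    and "\<And>c. c \<le> D \<Longrightarrow> mat_map (rk 1) (mt 0) ` free_deg V (rk 1) (dg 1) c = kernel c"
    and "\<And>c z i. c \<le> D \<Longrightarrow> z \<in> free_deg V (rk (Suc i)) (dg (Suc i)) c \<Longrightarrow> mat_map (rk (Suc i)) (mt i) z = 0 \<Longrightarrow>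
      z \<in> mat_map (rk (Suc (Suc i))) (mt (Suc i)) ` free_deg V (rk (Suc (Suc i))) (dg (Suc (Suc i))) c"
  shows "toric_complex n d \<alpha> rk dg mt D t"
proof -
  interpret minimal_free_complex V rk dg mt by (rule assms(1))
  show ?thesis
  proof unfold_locales
    show "rk 0 = 1" "dg 0 = (\<lambda>_. 0)" by (rule assms)+
    show "bdry 0 ` F (Suc 0) c = {f \<in> F 0 c. subst Mon (f 0) = 0}" if "c \<le> D" for c
      using assms(4)[OF that] by (simp add: assms(2,3) kernel_def)
    show "z \<in> bdry (Suc i) ` F (Suc (Suc i)) c" if "c \<le> D" "z \<in> F (Suc i) c" "bdry i z = 0" for c z i
      by (rule assms(5)[OF that])
  qed (use top_attained in \<open>auto dest: top_degree\<close>)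
qed

lemma toric_complex_res:
  fixes K :: "int \<Rightarrow> (nat \<Rightarrow> (nat \<Rightarrow>\<^sub>0 nat, 'a::field) mpoly) set"
  defines "K \<equiv> kernel"
  assumes exact: "\<And>i c. c \<le> D \<Longrightarrow> res_ker V K E i c \<subseteq>
      mat_map (res_rank V K E (Suc i)) (res_mat V K E i) `
        free_deg V (res_rank V K E (Suc i)) (res_deg V K E (Suc i)) c"
  shows "toric_complex n d \<alpha> (res_rank V K E) (res_deg V K E) (res_mat V K E) D t"
proof (rule toric_complexI)
  have K: "graded_submodule V 1 (\<lambda>_. 0) K" unfolding K_def by (rule kernel_submodule)
  show "minimal_free_complex V (res_rank V K E) (res_deg V K E) (res_mat V K E)"
    by (rule res_complex[OF finite_V K]) (simp add: K_def kernel_proper)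
  fix c i and z :: "nat \<Rightarrow> (nat \<Rightarrow>\<^sub>0 nat, 'a) mpoly" assume c: "c \<le> D"
  have "mat_map (res_rank V K E 1) (res_mat V K E 0) ` free_deg V (res_rank V K E 1) (res_deg V K E 1) c = K c"
    using res_map_ker[OF finite_V K, of _ E 0 c] exact[OF c, of 0] by (auto simp: res_ker_def)
  then show "mat_map (res_rank V K E 1) (res_mat V K E 0) `
      free_deg V (res_rank V K E 1) (res_deg V K E 1) c = kernel c"
    by (simp add: K_def)
  show "z \<in> mat_map (res_rank V K E (Suc (Suc i))) (res_mat V K E (Suc i)) `
      free_deg V (res_rank V K E (Suc (Suc i))) (res_deg V K E (Suc (Suc i))) c"
    if "z \<in> free_deg V (res_rank V K E (Suc i)) (res_deg V K E (Suc i)) c"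
      "mat_map (res_rank V K E (Suc i)) (res_mat V K E i) z = 0"
    using exact[OF c, of "Suc i"] that by (auto simp: res_ker_def)
qed (simp_all add: res_rank_def res_deg_def)

text \<open>If generators of \<open>F\<^sub>i\<^sub>+\<^sub>1\<close> of degree up to \<open>c\<close> are taken instead, all of them still have degree
  at most \<open>i + 1 + t\<close>. This gives exactness in degree \<open>c\<close> and replaces Hilbert's basis theorem.\<close>

lemma res_exact_all:
  fixes K :: "int \<Rightarrow> (nat \<Rightarrow> (nat \<Rightarrow>\<^sub>0 nat, 'a::field) mpoly) set"
  defines "K \<equiv> kernel" and "E \<equiv> \<lambda>i. int i + 1 + t"
  shows "res_ker V K E i c \<subseteq> mat_map (res_rank V K E (Suc i)) (res_mat V K E i) `
    free_deg V (res_rank V K E (Suc i)) (res_deg V K E (Suc i)) c"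
proof (induction i arbitrary: c rule: less_induct)
  case (less i)
  have K: "graded_submodule V 1 (\<lambda>_. 0) K" unfolding K_def by (rule kernel_submodule)
  \<comment> \<open>The same construction below step \<open>i\<close>, but with all generators up to
    degree \<open>c\<close> from step \<open>i\<close> on.\<close>
  define E' where "E' k = (if k < i then E k else c)" for k
  have agree: "res V K E' k = res V K E k" if "k < i" for k
    using res_agree[of i E' E k V K] that by (simp add: E'_def)
  then have rank: "res_rank V K E' k = res_rank V K E k" and deg: "res_deg V K E' k = res_deg V K E k"
    and ker: "res_ker V K E' k = res_ker V K E k" if "k \<le> i" for k
    using that by (cases k; auto simp: res_rank_def res_deg_def res_ker_def[abs_def] res_mat_def Suc_le_eq)+
  \<comment> \<open>Exactness up to degree \<open>c\<close> comes from the induction hypothesis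
    below \<open>i\<close> and from the choice of \<open>E'\<close> from there on; hence the degree
    bound applies to the new complex.\<close>
  have "res_ker V K E' k c' \<subseteq> mat_map (res_rank V K E' (Suc k)) (res_mat V K E' k) `
      free_deg V (res_rank V K E' (Suc k)) (res_deg V K E' (Suc k)) c'" if "c' \<le> c" for k c'
  proof (cases "k < i")
    case True
    then show ?thesis using less[OF True, of c'] rank[of "Suc k"] deg[of "Suc k"] ker[of k] agree[OF True]
      by (simp add: res_mat_def)
  next
    case False
    then show ?thesis using that res_exact[OF finite_V K, of c' E' k] by (simp add: E'_def)
  qed
  then interpret toric_complex n d \<alpha> "res_rank V K E'" "res_deg V K E'" "res_mat V K E'" c t
    unfolding K_def by (rule toric_complex_res)
  have col: "\<exists>u. u \<in> free_deg V (res_rank V K E (Suc i)) (res_deg V K E (Suc i)) (int (res_deg V K E' (Suc i) k)) \<and>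
     (\<lambda>j. res_mat V K E' i j k) = mat_map (res_rank V K E (Suc i)) (res_mat V K E i) u"
    if k: "k < res_rank V K E' (Suc i)" for k
  proof -
    have k1: "(\<lambda>j. res_mat V K E' i j k) \<in> res_ker V K E i (int (res_deg V K E' (Suc i) k))"
      and k2: "int (res_deg V K E' (Suc i) k) \<le> c"
      using res_column[OF finite_V K k] ker by (auto simp: E'_def)
    \<comment> \<open>By the degree bound, each column of the larger cover lies in a degree that the
      cover with \<open>E\<close> already generates.\<close>
    have "int (res_deg V K E' (Suc i) k) \<le> E i"
      using generator_degree_le[OF k k2] by (simp add: E_def)
    then show ?thesis using res_exact[OF finite_V K] k1 by blast
  qed
  then obtain u where u: "\<And>k. k < res_rank V K E' (Suc i) \<Longrightarrow>
     u k \<in> free_deg V (res_rank V K E (Suc i)) (res_deg V K E (Suc i)) (int (res_deg V K E' (Suc i) k)) \<and>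
     (\<lambda>j. res_mat V K E' i j k) = mat_map (res_rank V K E (Suc i)) (res_mat V K E i) (u k)"
    by metis
  show ?case
  proof
    fix f assume "f \<in> res_ker V K E i c"
    then have "f \<in> res_ker V K E' i c" using ker by simp
    then obtain w where w: "w \<in> free_deg V (res_rank V K E' (Suc i)) (res_deg V K E' (Suc i)) c"
      "f = mat_map (res_rank V K E' (Suc i)) (res_mat V K E' i) w"
      using res_exact[OF finite_V K, of c E' i] by (auto simp: E'_def)
    let ?N = "\<lambda>j k. u k j"
    \<comment> \<open>The larger cover factors through the one with \<open>E\<close>: the columns of
      \<open>?N\<close> express its generators in those of the latter.\<close>
    have "f = mat_map (res_rank V K E (Suc i)) (res_mat V K E i) (mat_map (res_rank V K E' (Suc i)) ?N w)"
    proof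
      fix j
      have "f j = (\<Sum>k<res_rank V K E' (Suc i). res_mat V K E' i j k * w k)"
        by (simp add: w(2) mat_map_def)
      also have "\<dots> = (\<Sum>k<res_rank V K E' (Suc i). \<Sum>l<res_rank V K E (Suc i). res_mat V K E i j l * (u k l * w k))"
      proof (rule sum.cong)
        fix k assume "k \<in> {..<res_rank V K E' (Suc i)}"
        then have "res_mat V K E' i j k = mat_map (res_rank V K E (Suc i)) (res_mat V K E i) (u k) j"
          using u[of k] by (metis lessThan_iff)
        then show "res_mat V K E' i j k * w k = (\<Sum>l<res_rank V K E (Suc i). res_mat V K E i j l * (u k l * w k))"
          by (simp add: mat_map_def sum_distrib_right mult.assoc)
      qed simp
      also have "\<dots> = (\<Sum>l<res_rank V K E (Suc i). \<Sum>k<res_rank V K E' (Suc i). res_mat V K E i j l * (u k l * w k))"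
        by (rule sum.swap)
      finally show "f j = mat_map (res_rank V K E (Suc i)) (res_mat V K E i) (mat_map (res_rank V K E' (Suc i)) ?N w) j"
        by (simp add: mat_map_def sum_distrib_left)
    qed
    moreover have "mat_map (res_rank V K E' (Suc i)) ?N w \<in> free_deg V (res_rank V K E (Suc i)) (res_deg V K E (Suc i)) c"
      by (rule mat_map_free_deg[OF _ w(1)]) (use u in blast)
    ultimately show "f \<in> mat_map (res_rank V K E (Suc i)) (res_mat V K E i) `
      free_deg V (res_rank V K E (Suc i)) (res_deg V K E (Suc i)) c" by blast
  qed
qed

theorem toric_complex_exists:
  "\<exists>rk dg (mt :: nat \<Rightarrow> nat \<Rightarrow> nat \<Rightarrow> (nat \<Rightarrow>\<^sub>0 nat, 'a::field) mpoly). \<forall>D. toric_complex n d \<alpha> rk dg mt D t"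
  using toric_complex_res[OF res_exact_all] by blast

end

section \<open>Homogeneous components\<close>

definition hcomp :: "int \<Rightarrow> ('v, 'a::comm_ring_1) mpoly \<Rightarrow> ('v, 'a) mpoly" where
  "hcomp c p = (\<Sum>m\<in>{m \<in> Poly_Mapping.keys p. int (mdeg m) = c}. Poly_Mapping.single m (Poly_Mapping.lookup p m))"

lemma lookup_hcomp: "Poly_Mapping.lookup (hcomp c p) m = (if int (mdeg m) = c then Poly_Mapping.lookup p m else 0)"
proof -
  have "Poly_Mapping.lookup (hcomp c p) m =
      (\<Sum>k\<in>{m \<in> Poly_Mapping.keys p. int (mdeg m) = c}. if k = m then Poly_Mapping.lookup p m else 0)"
    by (auto simp: hcomp_def lookup_sum lookup_single when_def intro!: sum.cong)
  then show ?thesis by (simp add: in_keys_iff)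
qed

lemma hcomp_add: "hcomp c (p + q) = hcomp c p + hcomp c q"
  by (rule poly_mapping_eqI) (simp add: lookup_hcomp lookup_add)

lemma hcomp_zero [simp]: "hcomp c 0 = 0"
  by (rule poly_mapping_eqI) (simp add: lookup_hcomp)

lemma hcomp_sum: "hcomp c (sum f A) = (\<Sum>x\<in>A. hcomp c (f x))"
  by (induction A rule: infinite_finite_induct) (auto simp: hcomp_add)

lemma hcomp_Hom: "p \<in> Hom V e \<Longrightarrow> hcomp c p = (if c = e then p else 0)"
  by (rule poly_mapping_eqI) (auto simp: lookup_hcomp Hom_def in_keys_iff)

lemma hcomp_in_Hom: "p \<in> polys V \<Longrightarrow> hcomp c p \<in> Hom V c"
  unfolding hcomp_def polys_def by (intro Hom_sum Hom_single) auto

lemma sum_hcomp: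
  assumes "finite C" "int ` mdeg ` Poly_Mapping.keys p \<subseteq> C"
  shows "(\<Sum>c\<in>C. hcomp c p) = p"
proof (rule poly_mapping_eqI)
  fix m
  show "Poly_Mapping.lookup (\<Sum>c\<in>C. hcomp c p) m = Poly_Mapping.lookup p m"
    using assms by (cases "m \<in> Poly_Mapping.keys p") (auto simp: lookup_sum lookup_hcomp in_keys_iff)
qed

lemma hcomp_mult:
  fixes p q :: "('v, 'a::comm_ring_1) mpoly"
  assumes q: "q \<in> Hom V e"
  shows "hcomp (c + e) (q * p) = q * hcomp c p"
proof -
  have H: "q * Poly_Mapping.single m s \<in> Hom UNIV (e + int (mdeg m))" for m s
    using q by (intro Hom_mult) (auto simp: Hom_def)
  have "hcomp (c + e) (q * p) =
      hcomp (c + e) (q * (\<Sum>m\<in>Poly_Mapping.keys p. Poly_Mapping.single m (Poly_Mapping.lookup p m)))"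
    using sum_single_keys[of p] by simp
  also have "\<dots> = (\<Sum>m\<in>Poly_Mapping.keys p. if int (mdeg m) = c then q * Poly_Mapping.single m (Poly_Mapping.lookup p m) else 0)"
    unfolding sum_distrib_left hcomp_sum by (intro sum.cong) (auto simp: hcomp_Hom[OF H])
  also have "\<dots> = q * hcomp c p"
    by (auto simp: hcomp_def sum_distrib_left sum.inter_filter intro!: sum.cong)
  finally show ?thesis .
qed

lemma polys_zero [simp]: "0 \<in> polys V"
  by (simp add: polys_def)

lemma polys_add: "p \<in> polys V \<Longrightarrow> q \<in> polys V \<Longrightarrow> p + q \<in> polys V"
  unfolding polys_def using Poly_Mapping.keys_add[of p q] by blast

lemma polys_sum: "(\<And>x. x \<in> A \<Longrightarrow> f x \<in> polys V) \<Longrightarrow> sum f A \<in> polys V"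
  by (induction A rule: infinite_finite_induct) (auto intro: polys_add)

lemma polys_mult:
  assumes "p \<in> polys V" "q \<in> polys V"
  shows "p * q \<in> polys V"
  unfolding polys_def
proof clarify
  fix m v assume "m \<in> Poly_Mapping.keys (p * q)" "v \<in> Poly_Mapping.keys m"
  then obtain a b where "m = a + b" "a \<in> Poly_Mapping.keys p" "b \<in> Poly_Mapping.keys q"
    using keys_mult[of p q] by auto
  with \<open>v \<in> Poly_Mapping.keys m\<close> assms show "v \<in> V" by (auto simp: polys_def keys_add_nat)
qed

definition free_all :: "'v set \<Rightarrow> nat \<Rightarrow> (nat \<Rightarrow> ('v, 'a::comm_ring_1) mpoly) set" where
  "free_all V r = {f. (\<forall>j. f j \<in> polys V) \<and> (\<forall>j\<ge>r. f j = 0)}"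

definition fcomp_deg :: "(nat \<Rightarrow> nat) \<Rightarrow> int \<Rightarrow> (nat \<Rightarrow> ('v, 'a::comm_ring_1) mpoly) \<Rightarrow> nat \<Rightarrow> ('v, 'a) mpoly" where
  "fcomp_deg a c f = (\<lambda>j. hcomp (c - int (a j)) (f j))"

lemma free_deg_all: "free_deg V r a c \<subseteq> free_all V r"
  by (auto simp: free_deg_def free_all_def intro: Hom_polys)

lemma fcomp_deg_free: "f \<in> free_all V r \<Longrightarrow> fcomp_deg a c f \<in> free_deg V r a c"
  by (auto simp: free_deg_def free_all_def fcomp_deg_def intro: hcomp_in_Hom)

lemma fcomp_deg_id:
  assumes "f \<in> free_deg V r a c"
  shows "fcomp_deg a c f = f"
proof
  fix j
  show "fcomp_deg a c f j = f j"
    using assms hcomp_Hom[of "f j" V "c - int (a j)" "c - int (a j)"]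
    by (simp add: free_deg_def fcomp_deg_def)
qed

lemma fcomp_deg_zero [simp]: "fcomp_deg a c 0 = 0"
  by (auto simp: fcomp_deg_def fun_eq_iff)

lemma fcomp_deg_mat_map:
  assumes M: "\<And>k. k < r \<Longrightarrow> (\<lambda>j. M j k) \<in> free_deg V r' a' (int (a k))"
  shows "fcomp_deg a' c (mat_map r M w) = mat_map r M (fcomp_deg a c w)"
proof
  fix j
  have "hcomp (c - int (a' j)) (M j k * w k) = M j k * hcomp (c - int (a k)) (w k)" if "k < r" for k
    using hcomp_mult[of "M j k" V "int (a k) - int (a' j)" "c - int (a k)" "w k"] M[OF that]
    by (simp add: free_deg_def)
  then show "fcomp_deg a' c (mat_map r M w) j = mat_map r M (fcomp_deg a c w) j"
    by (simp add: fcomp_deg_def mat_map_def hcomp_sum)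
qed

lemma mat_map_sum: "mat_map r M (\<Sum>x\<in>A. f x) = (\<Sum>x\<in>A. mat_map r M (f x))"
  by (induction A rule: infinite_finite_induct)
    (simp_all only: sum.infinite sum.empty sum.insert mat_map_zero mat_map_add not_False_eq_True)

lemma free_all_sum: "(\<And>x. x \<in> A \<Longrightarrow> h x \<in> free_all V r) \<Longrightarrow> (\<Sum>x\<in>A. h x) \<in> free_all V r"
  by (auto simp: free_all_def fun_sum_apply intro: polys_sum)

text \<open>Passage from graded pieces to whole modules: only the finitely many degrees in
  \<open>C\<close> occur in \<open>f\<close>, and preimages of the components add up.\<close>

lemma image_all_components:
  assumes f: "f \<in> free_all V r"
    and comp: "\<And>c. fcomp_deg a c f \<in> mat_map r' M ` free_deg V r' a' c"
  shows "f \<in> mat_map r' M ` free_all V r'"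
proof -
  define C where "C = (\<Union>j<r. (\<lambda>m. int (mdeg m) + int (a j)) ` Poly_Mapping.keys (f j))"
  have C: "finite C" by (simp add: C_def)
  have "\<forall>c. \<exists>w. w \<in> free_deg V r' a' c \<and> fcomp_deg a c f = mat_map r' M w"
    using comp by blast
  from choice[OF this] obtain w where
    w: "\<And>c. w c \<in> free_deg V r' a' c \<and> fcomp_deg a c f = mat_map r' M (w c)" by blast
  have "f = (\<Sum>c\<in>C. fcomp_deg a c f)"
  proof
    fix j
    show "f j = (\<Sum>c\<in>C. fcomp_deg a c f) j"
    proof (cases "j < r")
      case True
      have "(\<Sum>c\<in>C. hcomp (c - int (a j)) (f j)) = (\<Sum>c\<in>(\<lambda>c. c - int (a j)) ` C. hcomp c (f j))"
        by (subst sum.reindex) (auto simp: inj_on_def)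
      also have "\<dots> = f j"
        using C True by (intro sum_hcomp) (force simp: C_def image_iff)+
      finally show ?thesis by (simp add: fun_sum_apply fcomp_deg_def)
    next
      case False
      then show ?thesis using f by (simp add: fun_sum_apply fcomp_deg_def free_all_def)
    qed
  qed
  also have "\<dots> = mat_map r' M (\<Sum>c\<in>C. w c)" using w by (simp add: mat_map_sum)
  finally show ?thesis using free_all_sum[of C w V r'] w free_deg_all by blast
qed

text \<open>Passage from whole modules to graded pieces: the matrix has degree 0, so the component
  of degree \<open>c\<close> of any preimage is again a preimage.\<close>

lemma image_homogeneous:
  assumes M: "\<And>k. k < r \<Longrightarrow> (\<lambda>j. M j k) \<in> free_deg V r' a' (int (a k))"
    and f: "f \<in> free_deg V r' a' c" "f \<in> mat_map r M ` free_all V r"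
  shows "f \<in> mat_map r M ` free_deg V r a c"
proof -
  obtain w where w: "w \<in> free_all V r" "f = mat_map r M w" using f by blast
  have "f = mat_map r M (fcomp_deg a c w)"
    using fcomp_deg_id[OF f(1)] fcomp_deg_mat_map[OF M, where c = c and w = w] w(2) by simp
  then show ?thesis using fcomp_deg_free[OF w(1)] by blast
qed

section \<open>Vectors and matrices of polynomials\<close>

text \<open>Extension by zero puts vectors of all ranks into one type, as the single carrier type of
  \<open>graded_complex\<close> demands.\<close>

definition vec_fun :: "'b::zero vec \<Rightarrow> nat \<Rightarrow> 'b" where
  "vec_fun v j = (if j < dim_vec v then v $ j else 0)"

definition mat_fun :: "'b::zero mat \<Rightarrow> nat \<Rightarrow> nat \<Rightarrow> 'b" where
  "mat_fun A j k = (if j < dim_row A \<and> k < dim_col A then A $$ (j, k) else 0)"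

lemma vec_fun_free_all: "v \<in> free_mod V r \<Longrightarrow> vec_fun v \<in> free_all V r"
  by (auto simp: free_mod_def free_all_def vec_fun_def)

lemma vec_vec_fun: "v \<in> carrier_vec r \<Longrightarrow> vec r (vec_fun v) = v"
  by (auto simp: vec_fun_def)

lemma vec_free_mod: "f \<in> free_all V r \<Longrightarrow> vec r f \<in> free_mod V r"
  by (auto simp: free_mod_def free_all_def)

lemma vec_fun_vec: "f \<in> free_all V r \<Longrightarrow> vec_fun (vec r f) = f"
  by (auto simp: free_all_def vec_fun_def fun_eq_iff)

lemma free_mod_image: "free_mod V r = vec r ` free_all V r"
proof (intro equalityI subsetI)
  fix v :: "('a, 'b) mpoly vec" assume v: "v \<in> free_mod V r"
  then have "v = vec r (vec_fun v)" by (simp add: vec_vec_fun free_mod_def)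
  then show "v \<in> vec r ` free_all V r" using vec_fun_free_all[OF v] by blast
qed (auto intro: vec_free_mod)

lemma vec_fun_image_iff:
  assumes "S \<subseteq> carrier_vec r" "f \<in> free_all V r"
  shows "f \<in> vec_fun ` S \<longleftrightarrow> vec r f \<in> S"
proof
  assume "f \<in> vec_fun ` S"
  then obtain s where "s \<in> S" "f = vec_fun s" by blast
  then show "vec r f \<in> S" using assms(1) vec_vec_fun[of s r] by auto
next
  assume "vec r f \<in> S"
  then show "f \<in> vec_fun ` S" using vec_fun_vec[OF assms(2)] by (metis imageI)
qed

lemma vec_fun_inject: "v \<in> carrier_vec r \<Longrightarrow> w \<in> carrier_vec r \<Longrightarrow> vec_fun v = vec_fun w \<longleftrightarrow> v = w"
  using vec_vec_fun by metis

lemma vec_fun_mult_mat_vec: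
  assumes "A \<in> carrier_mat r r'" "v \<in> carrier_vec r'"
  shows "vec_fun (A *\<^sub>v v) = mat_map r' (mat_fun A) (vec_fun v)"
  using assms by (auto simp: vec_fun_def mat_fun_def mat_map_def fun_eq_iff scalar_prod_def
      atLeast0LessThan intro!: sum.cong)

lemma scalar_prod_mat_map:
  assumes "g \<in> carrier_vec r" "v \<in> carrier_vec r"
  shows "g \<bullet> v = mat_map r (\<lambda>j k. if j = 0 then vec_fun g k else 0) (vec_fun v) 0"
  using assms by (auto simp: vec_fun_def mat_map_def scalar_prod_def atLeast0LessThan intro!: sum.cong)

section \<open>Translation between matrix resolutions and graded complexes\<close>

context toric_top
begin

text \<open>I(X) is homogeneous because the presentation multiplies degrees by \<open>d > 0\<close>,
  so different degrees of S stay apart in the image.\<close>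

lemma subst_hcomp:
  assumes "p \<in> polys V" "subst Mon p = 0"
  shows "subst Mon (hcomp c p) = 0"
proof -
  have H: "subst Mon (hcomp e p) \<in> Hom UNIV (int d * e)" for e
    using keys_subst_Hom[OF hcomp_in_Hom[OF assms(1)]] by (auto simp: Hom_def)
  define C where "C = insert c (int ` mdeg ` Poly_Mapping.keys p)"
  have C: "finite C" "c \<in> C" by (auto simp: C_def)
  have "(\<Sum>e\<in>C. hcomp e p) = p" by (rule sum_hcomp[OF C(1)]) (auto simp: C_def)
  then have "0 = hcomp (int d * c) (subst Mon (\<Sum>e\<in>C. hcomp e p))" using assms(2) by simp
  also have "\<dots> = (\<Sum>e\<in>C. if e = c then subst Mon (hcomp e p) else 0)"
    unfolding subst_Mon_sum hcomp_sum using d_pos by (intro sum.cong) (auto simp: hcomp_Hom[OF H])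
  also have "\<dots> = subst Mon (hcomp c p)" using C by simp
  finally show ?thesis by simp
qed

text \<open>Any resolution of I(X) becomes one of S/I(X) by putting S in front, with
  \<open>g\<close> as first matrix. This makes the degree bound available for every resolution in
  the supremum.\<close>

theorem resolution_toric_complex:
  fixes g :: "(nat \<Rightarrow>\<^sub>0 nat, 'a::field) mpoly vec"
  assumes res: "minimal_graded_free_resolution V (presentation_kernel V Mon) b a g M"
  shows "toric_complex n d \<alpha> (case_nat 1 b) (case_nat (\<lambda>_. 0) a)
    (case_nat (\<lambda>j k. if j = 0 then vec_fun g k else 0) (\<lambda>i. mat_fun (M i))) D t"
proof (rule toric_complexI)
  let ?rk = "case_nat 1 b" and ?dg = "case_nat (\<lambda>_. 0) a"
  let ?mt = "case_nat (\<lambda>j k. if j = 0 then vec_fun g k else 0) (\<lambda>i. mat_fun (M i))"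
  note res' = res[unfolded minimal_graded_free_resolution_def]
  note g1 = res'[THEN conjunct1]
  note res1 = res'[THEN conjunct2]
  note g2 = res1[THEN conjunct1, rule_format]
  note res2 = res1[THEN conjunct2]
  note M = res2[THEN conjunct1, THEN spec, THEN conjunct1]
  note Me = res2[THEN conjunct1, THEN spec, THEN conjunct2, rule_format]
  note res3 = res2[THEN conjunct2]
  note im = res3[THEN conjunct1]
  note res4 = res3[THEN conjunct2]
  note ex0 = res4[THEN conjunct1]
  note ex = res4[THEN conjunct2, THEN spec]
  have gc: "g \<in> carrier_vec (b 0)" using g1 by (simp add: free_mod_def)
  have fmc: "v \<in> free_mod V r \<Longrightarrow> v \<in> carrier_vec r" for v :: "(nat \<Rightarrow>\<^sub>0 nat, 'a) mpoly vec" and r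
    by (simp add: free_mod_def)
  have cols: "(\<lambda>j. ?mt i j k) \<in> free_deg V (?rk i) (?dg i) (int (?dg (Suc i) k))" if k: "k < ?rk (Suc i)" for i k
  proof (cases i)
    case 0
    then show ?thesis using k g1 g2 gc
      by (auto simp: free_deg_def vec_fun_def Hom_def free_mod_def polys_def)
  next
    case (Suc l)
    have "mat_fun (M l) j k \<in> Hom V (int (a (Suc l) k) - int (a l j))" for j
      using M[of l] Me[of j l k] k Suc by (force simp: mat_fun_def Hom_def polys_def)
    moreover have "mat_fun (M l) j k = 0" if "j \<ge> b l" for j
      using M[of l] that by (auto simp: mat_fun_def)
    ultimately show ?thesis using Suc by (simp add: free_deg_def)
  qed
  have cols0: "(\<lambda>j. ?mt 0 j k) \<in> free_deg V 1 (\<lambda>_. 0) (int (a 0 k))" if "k < b 0" for k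
    using cols[of k 0] that by simp
  have row: "mat_map (b 0) (?mt 0) f 0 = g \<bullet> vec (b 0) f" if "f \<in> free_all V (b 0)" for f
    using scalar_prod_mat_map[OF gc, of "vec (b 0) f"] vec_fun_vec[OF that] by simp
  have row0: "mat_map (b 0) (?mt 0) f j = 0" if "j > 0" for f j
    using that by (simp add: mat_map_def)
  have mul: "mat_map (b (Suc i)) (?mt (Suc i)) f = vec_fun (M i *\<^sub>v vec (b (Suc i)) f)"
    if "f \<in> free_all V (b (Suc i))" for f i
    using vec_fun_mult_mat_vec[OF M[of i], of "vec (b (Suc i)) f"] vec_fun_vec[OF that] by simp
  have zero_iff: "mat_map (b (Suc i)) (?mt (Suc i)) f = 0 \<longleftrightarrow> M i *\<^sub>v vec (b (Suc i)) f = 0\<^sub>v (b i)"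
    if "f \<in> free_all V (b (Suc i))" for f i
  proof -
    have "vec_fun (0\<^sub>v (b i)) = (0 :: nat \<Rightarrow> (nat \<Rightarrow>\<^sub>0 nat, 'a) mpoly)" by (auto simp: vec_fun_def)
    moreover have "vec_fun (M i *\<^sub>v vec (b (Suc i)) f) = vec_fun (0\<^sub>v (b i)) \<longleftrightarrow> M i *\<^sub>v vec (b (Suc i)) f = 0\<^sub>v (b i)"
      by (rule vec_fun_inject[where r = "b i"]) (use M[of i] in auto)
    ultimately show ?thesis by (simp only: mul[OF that])
  qed
  have zero0_iff: "mat_map (b 0) (?mt 0) f = 0 \<longleftrightarrow> g \<bullet> vec (b 0) f = 0" if "f \<in> free_all V (b 0)" for f
  proof -
    have "mat_map (b 0) (?mt 0) f = 0 \<longleftrightarrow> mat_map (b 0) (?mt 0) f 0 = 0"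
    proof
      assume z: "mat_map (b 0) (?mt 0) f 0 = 0"
      show "mat_map (b 0) (?mt 0) f = 0"
      proof
        fix j show "mat_map (b 0) (?mt 0) f j = 0 j" using z row0[of j f] by (cases "j = 0") auto
      qed
    qed simp
    then show ?thesis by (simp only: row[OF that])
  qed
  have img: "mat_map (b (Suc i)) (?mt (Suc i)) ` free_all V (b (Suc i)) =
      vec_fun ` (\<lambda>w. M i *\<^sub>v w) ` free_mod V (b (Suc i))" for i
  proof -
    have "(\<lambda>w. M i *\<^sub>v w) ` free_mod V (b (Suc i)) = (\<lambda>f. M i *\<^sub>v vec (b (Suc i)) f) ` free_all V (b (Suc i))"
      by (simp add: free_mod_image image_image)
    then show ?thesis using mul by (simp add: image_image)
  qed
  have exact_all: "f \<in> mat_map (b (Suc i)) (?mt (Suc i)) ` free_all V (b (Suc i)) \<longleftrightarrow> mat_map (b i) (?mt i) f = 0"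
    if f: "f \<in> free_all V (b i)" for f i
  proof -
    have v: "vec (b i) f \<in> free_mod V (b i)" using f by (rule vec_free_mod)
    have "f \<in> mat_map (b (Suc i)) (?mt (Suc i)) ` free_all V (b (Suc i)) \<longleftrightarrow>
        vec (b i) f \<in> (\<lambda>w. M i *\<^sub>v w) ` free_mod V (b (Suc i))"
      unfolding img by (rule vec_fun_image_iff[OF _ f]) (use mult_mat_vec_carrier[OF M fmc] in blast)
    also have "\<dots> \<longleftrightarrow> mat_map (b i) (?mt i) f = 0"
    proof (cases i)
      case 0
      then show ?thesis using ex0 v zero0_iff f by auto
    next
      case (Suc l)
      then show ?thesis using ex[of l] v zero_iff[of f l] f by auto
    qed
    finally show ?thesis .
  qed
  have gI: "subst Mon (mat_map (b 0) (?mt 0) f 0) = 0" if f: "f \<in> free_all V (b 0)" for f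
  proof -
    have "g \<bullet> vec (b 0) f \<in> presentation_kernel V Mon" using im vec_free_mod[OF f] by blast
    then show ?thesis using row[OF f] by (simp add: presentation_kernel_def)
  qed
  show "minimal_free_complex V ?rk ?dg ?mt"
  proof
    fix k i j assume k: "k < ?rk (Suc i)"
    show "(\<lambda>j. ?mt i j k) \<in> free_deg V (?rk i) (?dg i) (int (?dg (Suc i) k))" by (rule cols[OF k])
    show "Poly_Mapping.lookup (?mt i j k) 0 = 0"
    proof (cases i)
      case 0
      \<comment> \<open>The entries of \<open>g\<close> are images of basis vectors, hence lie in
        I(X), which contains no nonzero constant; this is minimality for the first map.\<close>
      define f where "f = (\<lambda>j. if j = k then 1 else (0 :: (nat \<Rightarrow>\<^sub>0 nat, 'a) mpoly))"
      have "f \<in> free_all V (b 0)" using k 0 by (auto simp: f_def free_all_def polys_def)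
      moreover have "mat_map (b 0) (?mt 0) f 0 = vec_fun g k"
        using k 0 by (simp add: mat_map_def f_def if_distrib cong: if_cong)
      ultimately have "subst Mon (vec_fun g k) = 0" using gI by metis
      moreover have "vec_fun g k \<in> Hom V (int (a 0 k))"
      proof -
        have "\<forall>j. ?mt 0 j k \<in> Hom V (int (?dg (Suc 0) k) - int (?dg 0 j))"
          using cols[OF k] unfolding 0 free_deg_def by blast
        from this[rule_format, of 0] show ?thesis by simp
      qed
      ultimately show ?thesis using kernel_const_term 0 by auto
    next
      case (Suc l)
      then show ?thesis using M[of l] Me[of j l k] k by (auto simp: mat_fun_def)
    qed
  next
    fix w :: "nat \<Rightarrow> (nat \<Rightarrow>\<^sub>0 nat, 'a) mpoly" and i c
    assume w: "w \<in> free_deg V (?rk (Suc (Suc i))) (?dg (Suc (Suc i))) c"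
    have "mat_map (b (Suc i)) (?mt (Suc i)) w \<in> free_deg V (?rk (Suc i)) (?dg (Suc i)) c"
      using mat_map_free_deg[OF cols w] by simp
    then have "mat_map (b (Suc i)) (?mt (Suc i)) w \<in> free_all V (b i)"
      using free_deg_all by fastforce
    moreover have "w \<in> free_all V (b (Suc i))" using w free_deg_all by fastforce
    ultimately have "mat_map (b i) (?mt i) (mat_map (b (Suc i)) (?mt (Suc i)) w) = 0"
      using exact_all[of "mat_map (b (Suc i)) (?mt (Suc i)) w" i] by blast
    then show "mat_map (?rk (Suc i)) (?mt i) (mat_map (?rk (Suc (Suc i))) (?mt (Suc i)) w) = 0" by simp
  qed
  show "?rk 0 = 1" "?dg 0 = (\<lambda>_. 0)" by simp_all
  fix c :: int
  show "mat_map (?rk 1) (?mt 0) ` free_deg V (?rk 1) (?dg 1) c = kernel c"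
  proof (intro equalityI subsetI)
    fix f assume "f \<in> mat_map (?rk 1) (?mt 0) ` free_deg V (?rk 1) (?dg 1) c"
    then obtain h where h: "h \<in> free_deg V (b 0) (a 0) c" "f = mat_map (b 0) (?mt 0) h" by auto
    then have "f \<in> free_deg V 1 (\<lambda>_. 0) c" using mat_map_free_deg[OF cols0, where w = h and c = c] by simp
    moreover have "h \<in> free_all V (b 0)" using h(1) free_deg_all by blast
    ultimately show "f \<in> kernel c" using gI[of h] h(2) by (simp add: kernel_def)
  next
    fix f :: "nat \<Rightarrow> (nat \<Rightarrow>\<^sub>0 nat, 'a) mpoly" assume f: "f \<in> kernel c"
    then have "f 0 \<in> presentation_kernel V Mon"
      by (auto simp: kernel_def presentation_kernel_def free_deg_def intro: Hom_polys)
    then obtain v where v: "v \<in> free_mod V (b 0)" "f 0 = g \<bullet> v" using im by blast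
    have "f = mat_map (b 0) (?mt 0) (vec_fun v)"
    proof
      fix j show "f j = mat_map (b 0) (?mt 0) (vec_fun v) j"
      proof (cases "j = 0")
        case True
        then show ?thesis using row[OF vec_fun_free_all[OF v(1)]] vec_vec_fun[OF fmc[OF v(1)]] v(2) by simp
      next
        case False
        then show ?thesis using f row0 by (simp add: kernel_def free_deg_def)
      qed
    qed
    then have "f \<in> mat_map (b 0) (?mt 0) ` free_deg V (b 0) (a 0) c"
      using f vec_fun_free_all[OF v(1)] cols0
      by (intro image_homogeneous[where a' = "\<lambda>_. 0" and r' = 1 and V = V]) (auto simp: kernel_def)
    then show "f \<in> mat_map (?rk 1) (?mt 0) ` free_deg V (?rk 1) (?dg 1) c" by simp
  qed
  fix z :: "nat \<Rightarrow> (nat \<Rightarrow>\<^sub>0 nat, 'a) mpoly" and i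
  assume z: "z \<in> free_deg V (?rk (Suc i)) (?dg (Suc i)) c" "mat_map (?rk (Suc i)) (?mt i) z = 0"
  show "z \<in> mat_map (?rk (Suc (Suc i))) (?mt (Suc i)) ` free_deg V (?rk (Suc (Suc i))) (?dg (Suc (Suc i))) c"
  proof (rule image_homogeneous[OF cols z(1)])
    show "z \<in> mat_map (?rk (Suc (Suc i))) (?mt (Suc i)) ` free_all V (?rk (Suc (Suc i)))"
    proof -
      have "z \<in> free_all V (b i)" using z(1) free_deg_all by fastforce
      then show ?thesis using exact_all[of z i] z(2) by simp
    qed
  qed
qed

text \<open>The converse, dropping position 0. Exactness must hold for every \<open>D\<close>,
  because kernels of whole modules are assembled from components of all degrees.\<close>

theorem toric_complex_resolution:
  fixes mt :: "nat \<Rightarrow> nat \<Rightarrow> nat \<Rightarrow> (nat \<Rightarrow>\<^sub>0 nat, 'a::field) mpoly"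
  assumes T: "\<And>D. toric_complex n d \<alpha> rk dg mt D t"
  shows "minimal_graded_free_resolution V (presentation_kernel V Mon) (\<lambda>i. rk (Suc i)) (\<lambda>i. dg (Suc i))
    (vec (rk 1) (mt 0 0)) (\<lambda>i. mat (rk (Suc i)) (rk (Suc (Suc i))) (\<lambda>(j, k). mt (Suc i) j k))"
proof -
  let ?b = "\<lambda>i. rk (Suc i)" and ?g = "vec (rk 1) (mt 0 0)"
  let ?M = "\<lambda>i. mat (rk (Suc i)) (rk (Suc (Suc i))) (\<lambda>(j, k). mt (Suc i) j k)"
  interpret T: toric_complex n d \<alpha> rk dg mt 0 t by (rule T)
  have exact0: "mat_map (rk 1) (mt 0) ` free_deg V (rk 1) (dg 1) c = {f \<in> free_deg V (rk 0) (dg 0) c. subst Mon (f 0) = 0}" for c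
    using toric_complex.exact0[OF T, of c c] by simp
  have exactS: "z \<in> mat_map (rk (Suc (Suc i))) (mt (Suc i)) ` free_deg V (rk (Suc (Suc i))) (dg (Suc (Suc i))) c"
    if "z \<in> free_deg V (rk (Suc i)) (dg (Suc i)) c" "mat_map (rk (Suc i)) (mt i) z = 0" for z i c
    using toric_complex.exactS[OF T, of c c z i] that by simp
  have ker_all: "z \<in> mat_map (rk (Suc (Suc i))) (mt (Suc i)) ` free_all V (rk (Suc (Suc i)))"
    if z: "z \<in> free_all V (rk (Suc i))" "mat_map (rk (Suc i)) (mt i) z = 0" for z i
  proof (rule image_all_components[OF z(1)])
    fix c
    have "mat_map (rk (Suc i)) (mt i) (fcomp_deg (dg (Suc i)) c z) = 0"
      by (subst fcomp_deg_mat_map[where V = V and r' = "rk i", symmetric])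
        (auto simp: z(2) intro: T.cols)
    then show "fcomp_deg (dg (Suc i)) c z \<in> mat_map (rk (Suc (Suc i))) (mt (Suc i)) `
        free_deg V (rk (Suc (Suc i))) (dg (Suc (Suc i))) c"
      using exactS fcomp_deg_free[OF z(1)] by blast
  qed
  have map_all: "mat_map (rk (Suc i)) (mt i) w \<in> free_all V (rk i)" if "w \<in> free_all V (rk (Suc i))" for w i
  proof -
    have "mt i j k \<in> polys V" "j \<ge> rk i \<Longrightarrow> mt i j k = 0" if "k < rk (Suc i)" for j k
      using T.cols[OF that] by (auto simp: free_deg_def intro: Hom_polys)
    then show ?thesis using that by (auto simp: free_all_def mat_map_def intro!: polys_sum polys_mult)
  qed
  have comp_all: "mat_map (rk (Suc i)) (mt i) (mat_map (rk (Suc (Suc i))) (mt (Suc i)) w) = 0"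
    if w: "w \<in> free_all V (rk (Suc (Suc i)))" for w i
  proof -
    let ?q = "mat_map (rk (Suc i)) (mt i) (mat_map (rk (Suc (Suc i))) (mt (Suc i)) w)"
    have "hcomp c (?q j) = 0" for c j
    proof -
      have "fcomp_deg (dg i) (c + int (dg i j)) ?q = 0"
        using T.comp_zero[OF fcomp_deg_free[OF w]]
        by (simp add: fcomp_deg_mat_map[OF T.cols])
      then have "fcomp_deg (dg i) (c + int (dg i j)) ?q j = 0" by simp
      then show ?thesis by (simp add: fcomp_deg_def)
    qed
    then have "?q j = 0" for j
      using sum_hcomp[of "int ` mdeg ` Poly_Mapping.keys (?q j)" "?q j"] by simp
    then show ?thesis by (simp add: fun_eq_iff)
  qed
  have Mc: "?M i *\<^sub>v v \<in> carrier_vec (rk (Suc i))" for i v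
    by (rule carrier_vecI) simp
  have sp: "?g \<bullet> v = mat_map (rk 1) (mt 0) (vec_fun v) 0" if "v \<in> carrier_vec (rk 1)" for v
    using that by (auto simp: scalar_prod_def mat_map_def vec_fun_def atLeast0LessThan intro!: sum.cong)
  have mv: "vec_fun (?M i *\<^sub>v v) = mat_map (rk (Suc (Suc i))) (mt (Suc i)) (vec_fun v)"
    if "v \<in> carrier_vec (rk (Suc (Suc i)))" for v i
  proof -
    have "mat_map (rk (Suc (Suc i))) (mat_fun (?M i)) (vec_fun v) = mat_map (rk (Suc (Suc i))) (mt (Suc i)) (vec_fun v)"
    proof
      fix j
      have "mt (Suc i) j k = 0" if "k < rk (Suc (Suc i))" "j \<ge> rk (Suc i)" for k
        using T.cols[OF that(1)] that(2) by (simp add: free_deg_def)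
      then show "mat_map (rk (Suc (Suc i))) (mat_fun (?M i)) (vec_fun v) j =
          mat_map (rk (Suc (Suc i))) (mt (Suc i)) (vec_fun v) j"
        by (auto simp: mat_map_def mat_fun_def intro!: sum.cong)
    qed
    then show ?thesis using vec_fun_mult_mat_vec[OF _ that, of "?M i" "rk (Suc i)"] by simp
  qed
  have fmc: "v \<in> free_mod V r \<Longrightarrow> v \<in> carrier_vec r" for v :: "(nat \<Rightarrow>\<^sub>0 nat, 'a) mpoly vec" and r
    by (simp add: free_mod_def)
  have F00: "f j = 0" if "f \<in> free_all V (rk 0)" "j > 0" for f :: "nat \<Rightarrow> (nat \<Rightarrow>\<^sub>0 nat, 'a) mpoly" and j
    using that by (simp add: free_all_def T.rk0)
  have sp0: "?g \<bullet> v = 0 \<longleftrightarrow> mat_map (rk 1) (mt 0) (vec_fun v) = 0" if v: "v \<in> free_mod V (rk 1)" for v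
  proof -
    have "mat_map (rk 1) (mt 0) (vec_fun v) j = 0" if "j > 0" for j
      using map_all[of "vec_fun v" 0] vec_fun_free_all[OF v] F00 that by simp
    then show ?thesis using sp[OF fmc[OF v]] by (metis (no_types) gr0I ext zero_fun_apply)
  qed
  have zero_iff: "?M i *\<^sub>v v = 0\<^sub>v (rk (Suc i)) \<longleftrightarrow> mat_map (rk (Suc (Suc i))) (mt (Suc i)) (vec_fun v) = 0"
    if v: "v \<in> free_mod V (rk (Suc (Suc i)))" for v i
  proof -
    have "vec_fun (0\<^sub>v (rk (Suc i))) = (0 :: nat \<Rightarrow> (nat \<Rightarrow>\<^sub>0 nat, 'a) mpoly)" by (auto simp: vec_fun_def)
    moreover have "?M i *\<^sub>v v \<in> carrier_vec (rk (Suc i))" by (rule Mc)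
    ultimately show ?thesis
      using mv[OF fmc[OF v]] vec_fun_inject[of "?M i *\<^sub>v v" "rk (Suc i)" "0\<^sub>v (rk (Suc i))"] by auto
  qed
  have exact_mod: "{v \<in> free_mod V (rk (Suc i)). mat_map (rk (Suc i)) (mt i) (vec_fun v) = 0} =
      (\<lambda>w. ?M i *\<^sub>v w) ` free_mod V (rk (Suc (Suc i)))" for i
  proof (intro equalityI subsetI)
    fix v assume "v \<in> {v \<in> free_mod V (rk (Suc i)). mat_map (rk (Suc i)) (mt i) (vec_fun v) = 0}"
    then have v: "v \<in> free_mod V (rk (Suc i))" "mat_map (rk (Suc i)) (mt i) (vec_fun v) = 0" by auto
    then obtain w where w: "w \<in> free_all V (rk (Suc (Suc i)))" "vec_fun v = mat_map (rk (Suc (Suc i))) (mt (Suc i)) w"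
      using ker_all vec_fun_free_all by blast
    have "vec_fun (?M i *\<^sub>v vec (rk (Suc (Suc i))) w) = vec_fun v"
      using mv[of "vec (rk (Suc (Suc i))) w" i] vec_fun_vec[OF w(1)] w(2) by simp
    then have "?M i *\<^sub>v vec (rk (Suc (Suc i))) w = v"
      using vec_fun_inject[of "?M i *\<^sub>v vec (rk (Suc (Suc i))) w" "rk (Suc i)" v] fmc[OF v(1)] Mc by simp
    then show "v \<in> (\<lambda>w. ?M i *\<^sub>v w) ` free_mod V (rk (Suc (Suc i)))" using vec_free_mod[OF w(1)] by blast
  next
    fix v assume "v \<in> (\<lambda>w. ?M i *\<^sub>v w) ` free_mod V (rk (Suc (Suc i)))"
    then obtain w where w: "w \<in> free_mod V (rk (Suc (Suc i)))" "v = ?M i *\<^sub>v w" by blast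
    have vf: "vec_fun v = mat_map (rk (Suc (Suc i))) (mt (Suc i)) (vec_fun w)" using mv[OF fmc[OF w(1)]] w(2) by simp
    have "vec_fun v \<in> free_all V (rk (Suc i))" using vf map_all[OF vec_fun_free_all[OF w(1)]] by simp
    moreover have "v \<in> carrier_vec (rk (Suc i))" unfolding w(2) by (rule Mc)
    ultimately have "v \<in> free_mod V (rk (Suc i))" using vec_free_mod vec_vec_fun by metis
    then show "v \<in> {v \<in> free_mod V (rk (Suc i)). mat_map (rk (Suc i)) (mt i) (vec_fun v) = 0}"
      using comp_all[OF vec_fun_free_all[OF w(1)]] vf by simp
  qed
  have "(\<lambda>v. ?g \<bullet> v) ` free_mod V (rk 1) = presentation_kernel V Mon"
  proof (intro equalityI subsetI)
    fix p assume "p \<in> (\<lambda>v. ?g \<bullet> v) ` free_mod V (rk 1)"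
    then obtain v where v: "v \<in> free_mod V (rk 1)" "p = mat_map (rk 1) (mt 0) (vec_fun v) 0"
      using sp fmc by blast
    have "subst Mon (mt 0 0 k) = 0" if k: "k < rk 1" for k
    proof -
      have "T.unit k \<in> free_deg V (rk 1) (dg 1) (int (dg 1 k))"
        using T.unit_Cyc[of k 1] k by (simp add: T.Cyc_def)
      then have "mat_map (rk 1) (mt 0) (T.unit k) \<in> {f \<in> free_deg V (rk 0) (dg 0) (int (dg 1 k)). subst Mon (f 0) = 0}"
        using exact0 by blast
      moreover have "mat_map (rk 1) (mt 0) (T.unit k) 0 = mt 0 0 k"
        using k by (simp add: mat_map_def T.unit_def if_distrib cong: if_cong)
      ultimately show ?thesis by simp
    qed
    then have "subst Mon p = 0" by (simp add: v(2) mat_map_def subst_Mon_sum subst_Mon_mult)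
    moreover have "p \<in> polys V"
      using map_all[of "vec_fun v" 0] vec_fun_free_all[OF v(1)] v(2) by (simp add: free_all_def)
    ultimately show "p \<in> presentation_kernel V Mon" by (simp add: presentation_kernel_def)
  next
    fix p :: "(nat \<Rightarrow>\<^sub>0 nat, 'a) mpoly" assume "p \<in> presentation_kernel V Mon"
    then have p: "p \<in> polys V" "subst Mon p = 0" by (auto simp: presentation_kernel_def)
    define f where "f = (\<lambda>j::nat. if j = 0 then p else 0)"
    have f: "f \<in> free_all V (rk 0)" using p by (auto simp: f_def free_all_def T.rk0)
    have "f \<in> mat_map (rk 1) (mt 0) ` free_all V (rk 1)"
    proof (rule image_all_components[OF f])
      fix c
      have "subst Mon (fcomp_deg (dg 0) c f 0) = 0"
        using subst_hcomp[OF p] by (simp add: fcomp_deg_def f_def)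
      then show "fcomp_deg (dg 0) c f \<in> mat_map (rk 1) (mt 0) ` free_deg V (rk 1) (dg 1) c"
        using fcomp_deg_free[OF f] exact0 by blast
    qed
    then obtain w where w: "w \<in> free_all V (rk 1)" "f = mat_map (rk 1) (mt 0) w" by blast
    have "?g \<bullet> vec (rk 1) w = f 0" using sp[of "vec (rk 1) w"] vec_fun_vec[OF w(1)] w(2) by simp
    then have "p = ?g \<bullet> vec (rk 1) w" by (simp add: f_def)
    then show "p \<in> (\<lambda>v. ?g \<bullet> v) ` free_mod V (rk 1)" using vec_free_mod[OF w(1)] by blast
  qed
  moreover have "?g \<in> free_mod V (rk 1)"
    using T.cols[of _ 0] by (auto simp: free_mod_def free_deg_def intro: Hom_polys)
  moreover have "\<forall>j<rk 1. \<forall>m\<in>Poly_Mapping.keys (?g $ j). mdeg m = dg 1 j"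
  proof (intro allI impI ballI)
    fix j m assume j: "j < rk 1" and m: "m \<in> Poly_Mapping.keys (?g $ j)"
    have "mt 0 0 j \<in> Hom V (int (dg 1 j))" using T.cols[of j 0] j by (simp add: free_deg_def T.dg0)
    then show "mdeg m = dg 1 j" using m j by (auto simp: Hom_def)
  qed
  moreover have "?M i \<in> carrier_mat (?b i) (?b (Suc i)) \<and>
       (\<forall>j<?b i. \<forall>k<?b (Suc i).
          ?M i $$ (j, k) \<in> polys V \<and>
          (\<forall>m\<in>Poly_Mapping.keys (?M i $$ (j, k)). mdeg m + dg (Suc i) j = dg (Suc (Suc i)) k) \<and>
          Poly_Mapping.lookup (?M i $$ (j, k)) 0 = 0)" for i
  proof (intro conjI allI impI)
    fix j k assume j: "j < ?b i" and k: "k < ?b (Suc i)"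
    have H: "mt (Suc i) j k \<in> Hom V (int (dg (Suc (Suc i)) k) - int (dg (Suc i) j))"
      using T.cols[OF k] by (simp add: free_deg_def)
    then show "?M i $$ (j, k) \<in> polys V" using j k by (auto intro: Hom_polys)
    show "\<forall>m\<in>Poly_Mapping.keys (?M i $$ (j, k)). mdeg m + dg (Suc i) j = dg (Suc (Suc i)) k"
      using H j k by (auto simp: Hom_def)
    show "Poly_Mapping.lookup (?M i $$ (j, k)) 0 = 0" using T.minimal[OF k] j k by simp
  qed simp
  moreover have "{v \<in> free_mod V (rk 1). ?g \<bullet> v = 0} = (\<lambda>w. ?M 0 *\<^sub>v w) ` free_mod V (rk (Suc (Suc 0)))"
    using exact_mod[of 0] sp0 by auto
  moreover have "{v \<in> free_mod V (rk (Suc (Suc i))). ?M i *\<^sub>v v = 0\<^sub>v (rk (Suc i))} =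
      (\<lambda>w. ?M (Suc i) *\<^sub>v w) ` free_mod V (rk (Suc (Suc (Suc i))))" for i
    using exact_mod[of "Suc i"] zero_iff[of _ i] by auto
  ultimately show ?thesis
    unfolding minimal_graded_free_resolution_def by simp
qed

end

section \<open>Diagonal groups and their invariants\<close>

text \<open>The scalar by which the diagonal matrix with entries \<open>f\<close> multiplies the
  monomial \<open>m\<close>.\<close>

definition diag_char :: "('v \<Rightarrow> 'a::comm_ring_1) \<Rightarrow> ('v \<Rightarrow>\<^sub>0 nat) \<Rightarrow> 'a" where
  "diag_char f m = (\<Prod>v\<in>Poly_Mapping.keys m. f v ^ Poly_Mapping.lookup m v)"

lemma diag_char_one: "diag_char (\<lambda>_. 1) m = 1"
  by (simp add: diag_char_def)

lemma diag_char_mult: "diag_char (\<lambda>i. f i * g i) m = diag_char f m * diag_char g m"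
  by (simp add: diag_char_def power_mult_distrib prod.distrib)

lemma diag_char_power:
  assumes "finite A" "Poly_Mapping.keys m \<subseteq> A"
  shows "diag_char (\<lambda>i. e ^ \<alpha> i) m = e ^ (\<Sum>i\<in>A. \<alpha> i * Poly_Mapping.lookup m i)"
proof -
  have "diag_char (\<lambda>i. e ^ \<alpha> i) m = e ^ (\<Sum>i\<in>Poly_Mapping.keys m. \<alpha> i * Poly_Mapping.lookup m i)"
    by (simp add: diag_char_def power_sum power_mult)
  also have "(\<Sum>i\<in>Poly_Mapping.keys m. \<alpha> i * Poly_Mapping.lookup m i) = (\<Sum>i\<in>A. \<alpha> i * Poly_Mapping.lookup m i)"
    using assms by (intro sum.mono_neutral_left) (auto simp: in_keys_iff)
  finally show ?thesis .
qed

lemma single_Var_power: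
  "(Poly_Mapping.single (Poly_Mapping.single v 1) s :: ('v, 'a::comm_ring_1) mpoly) ^ k =
    Poly_Mapping.single (Poly_Mapping.single v k) (s ^ k)"
  by (induction k) (simp_all add: mult_single flip: single_add)

lemma prod_single:
  "(\<Prod>v\<in>A. Poly_Mapping.single (g v) (h v) :: ('v, 'a::comm_ring_1) mpoly) = Poly_Mapping.single (sum g A) (prod h A)"
  by (induction A rule: infinite_finite_induct) (auto simp: mult_single)

lemma mat_act_diag:
  fixes p :: "(nat, 'a::comm_ring_1) mpoly"
  assumes "p \<in> polys {..<N}"
  shows "mat_act (mat_diag N f) p =
    (\<Sum>m\<in>Poly_Mapping.keys p. Poly_Mapping.single m (Poly_Mapping.lookup p m * diag_char f m))"
proof -
  have col: "(\<Sum>j<N. Const (mat_diag N f $$ (i, j)) * Var j) = Poly_Mapping.single (Poly_Mapping.single i 1) (f i)"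
    if "i < N" for i
  proof -
    have "(\<Sum>j<N. Const (mat_diag N f $$ (i, j)) * Var j) =
        (\<Sum>j<N. if i = j then Poly_Mapping.single (Poly_Mapping.single i 1) (f i) else (0 :: (nat, 'a) mpoly))"
      using that by (intro sum.cong) (auto simp: mat_diag_def mult_single)
    then show ?thesis using that by simp
  qed
  have "dim_col (mat_diag N f) = N" by (simp add: mat_diag_def)
  then have "mat_act (mat_diag N f) p = (\<Sum>m\<in>Poly_Mapping.keys p. Const (Poly_Mapping.lookup p m) *
      (\<Prod>v\<in>Poly_Mapping.keys m. Poly_Mapping.single (Poly_Mapping.single v 1) (f v) ^ Poly_Mapping.lookup m v))"
    unfolding mat_act_def subst_def
    using assms col by (intro sum.cong arg_cong2[where f = "(*)"] prod.cong) (auto simp: polys_def subset_iff)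
  also have "\<dots> = (\<Sum>m\<in>Poly_Mapping.keys p. Poly_Mapping.single m (Poly_Mapping.lookup p m * diag_char f m))"
    unfolding single_Var_power prod_single mult_single
    by (intro sum.cong) (simp_all add: diag_char_def flip: sum_single_keys)
  finally show ?thesis .
qed

text \<open>A diagonal matrix scales each monomial separately, and in a domain a nonzero coefficient
  can be cancelled.\<close>

lemma mat_act_diag_fixed_iff:
  fixes p :: "(nat, 'a::idom) mpoly"
  assumes "p \<in> polys {..<N}"
  shows "mat_act (mat_diag N f) p = p \<longleftrightarrow> (\<forall>m\<in>Poly_Mapping.keys p. diag_char f m = 1)"
proof -
  have "Poly_Mapping.lookup (mat_act (mat_diag N f) p) m = Poly_Mapping.lookup p m * diag_char f m" for m
  proof -
    have "Poly_Mapping.lookup (mat_act (mat_diag N f) p) m =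
        (\<Sum>k\<in>Poly_Mapping.keys p. if k = m then Poly_Mapping.lookup p m * diag_char f m else 0)"
      by (auto simp: mat_act_diag[OF assms] lookup_sum lookup_single when_def intro!: sum.cong)
    then show ?thesis by (simp add: in_keys_iff)
  qed
  then show ?thesis
    by (auto simp: poly_mapping_eq_iff fun_eq_iff in_keys_iff)
qed

text \<open>Diagonal shape and triviality on common invariant monomials pass together through
  products and inverses, so invariance under the generators implies invariance under the
  group.\<close>

lemma generate_diag:
  fixes F :: "(nat \<Rightarrow> 'a::field) set"
  assumes A: "A \<in> generate (GL N) (mat_diag N ` F)" and nz: "\<forall>f\<in>F. \<forall>i. f i \<noteq> 0"
  shows "\<exists>h. A = mat_diag N h \<and> (\<forall>m. (\<forall>f\<in>F. diag_char f m = 1) \<longrightarrow> diag_char h m = 1)"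
  using A
proof (induction rule: generate.induct)
  case one
  have "\<one>\<^bsub>GL N\<^esub> = mat_diag N (\<lambda>_. 1 :: 'a)" by (simp add: units_of_one ring_mat_simps)
  then show ?case using diag_char_one by metis
next
  case (incl h)
  then show ?case by blast
next
  case (inv h)
  then obtain f where f: "f \<in> F" "h = mat_diag N f" by blast
  interpret R: semiring "ring_mat TYPE('a) N ()" by (rule semiring_mat)
  let ?g = "mat_diag N (\<lambda>i. inverse (f i))"
  have hg: "h * ?g = 1\<^sub>m N" "?g * h = 1\<^sub>m N"
    using nz[rule_format, OF f(1)] by (simp_all add: f(2))
  have hc: "h \<in> carrier (ring_mat TYPE('a) N ())" "?g \<in> carrier (ring_mat TYPE('a) N ())"
    by (simp_all add: f(2) ring_mat_simps)
  have U: "h \<in> Units (ring_mat TYPE('a) N ())"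
    using hc hg unfolding Units_def by (auto simp: ring_mat_simps)
  have "?g = inv\<^bsub>ring_mat TYPE('a) N ()\<^esub> h"
    by (rule R.inv_unique'[OF hc]) (simp_all add: ring_mat_simps hg)
  then have e: "inv\<^bsub>GL N\<^esub> h = ?g" using R.units_of_inv[OF U] by simp
  have "diag_char (\<lambda>i. inverse (f i)) m = 1" if "diag_char f m = 1" for m
  proof -
    have "diag_char (\<lambda>i. inverse (f i) * f i) m = 1" using nz[rule_format, OF f(1)] by (simp add: diag_char_one)
    then show ?thesis using that by (simp add: diag_char_mult)
  qed
  then show ?case using e f(1) by blast
next
  case (eng h1 h2)
  then obtain f g where "h1 = mat_diag N f" "h2 = mat_diag N g"
    "\<forall>m. (\<forall>f\<in>F. diag_char f m = 1) \<longrightarrow> diag_char f m = 1"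
    "\<forall>m. (\<forall>f\<in>F. diag_char f m = 1) \<longrightarrow> diag_char g m = 1" by blast
  moreover from this have "h1 \<otimes>\<^bsub>GL N\<^esub> h2 = mat_diag N (\<lambda>i. f i * g i)"
    by (simp add: units_of_mult ring_mat_simps)
  ultimately show ?case
    by (intro exI[of _ "\<lambda>i. f i * g i"]) (simp add: diag_char_mult)
qed

lemma invariant_ring_diag:
  fixes F :: "(nat \<Rightarrow> 'a::field) set"
  assumes nz: "\<forall>f\<in>F. \<forall>i. f i \<noteq> 0"
  shows "invariant_ring n (generate (GL (Suc n)) (mat_diag (Suc n) ` F)) =
    {p \<in> polys {..n}. \<forall>m\<in>Poly_Mapping.keys p. \<forall>f\<in>F. diag_char f m = 1}"
proof (intro equalityI subsetI)
  fix p :: "(nat, 'a) mpoly"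
  assume p: "p \<in> invariant_ring n (generate (GL (Suc n)) (mat_diag (Suc n) ` F))"
  then have pn: "p \<in> polys {..<Suc n}" by (simp add: invariant_ring_def lessThan_Suc_atMost)
  have "mat_act (mat_diag (Suc n) f) p = p" if "f \<in> F" for f
    using p that generate.incl[of "mat_diag (Suc n) f" "mat_diag (Suc n) ` F" "GL (Suc n)"]
    by (auto simp: invariant_ring_def)
  then show "p \<in> {p \<in> polys {..n}. \<forall>m\<in>Poly_Mapping.keys p. \<forall>f\<in>F. diag_char f m = 1}"
    using pn mat_act_diag_fixed_iff[OF pn] by (simp add: lessThan_Suc_atMost)
next
  fix p :: "(nat, 'a) mpoly"
  assume p: "p \<in> {p \<in> polys {..n}. \<forall>m\<in>Poly_Mapping.keys p. \<forall>f\<in>F. diag_char f m = 1}"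
  then have pn: "p \<in> polys {..<Suc n}" by (simp add: lessThan_Suc_atMost)
  have "mat_act A p = p" if "A \<in> generate (GL (Suc n)) (mat_diag (Suc n) ` F)" for A
    using generate_diag[OF that nz] p mat_act_diag_fixed_iff[OF pn] by auto
  then show "p \<in> invariant_ring n (generate (GL (Suc n)) (mat_diag (Suc n) ` F))"
    using p by (simp add: invariant_ring_def)
qed

lemma primitive_root_power_eq_1_iff:
  assumes "primitive_root d e" "d > 0"
  shows "e ^ k = 1 \<longleftrightarrow> d dvd k"
proof
  have "e ^ k = (e ^ d) ^ (k div d) * e ^ (k mod d)"
    by (metis mult_div_mod_eq power_add power_mult)
  also have "\<dots> = e ^ (k mod d)" using assms(1) by (simp add: primitive_root_def)
  finally have *: "e ^ k = e ^ (k mod d)" .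
  assume "e ^ k = 1"
  then have "k mod d = 0" using * assms mod_less_divisor[of d k] by (auto simp: primitive_root_def)
  then show "d dvd k" by auto
next
  assume "d dvd k"
  then show "e ^ k = 1" using assms(1) by (auto simp: primitive_root_def power_mult)
qed

section \<open>Invariants of the two groups and the presentation of the coordinate ring\<close>

context toric
begin

context
  fixes e :: "'a::field"
  assumes e: "primitive_root d e"
begin

lemma e_nonzero: "e \<noteq> 0"
proof
  assume "e = 0"
  moreover have "e ^ d = 1" using e by (simp add: primitive_root_def)
  ultimately show False using d_pos by (simp add: power_0_left)
qed

lemma char_iff:
  assumes "Poly_Mapping.keys m \<subseteq> {..n}"
  shows "diag_char (\<lambda>i. e ^ \<alpha> i) m = 1 \<longleftrightarrow> invar m" "diag_char (\<lambda>_. e) m = 1 \<longleftrightarrow> d dvd mdeg m"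
  using diag_char_power[of "{..n}" m e \<alpha>] diag_char_power[of "{..n}" m e "\<lambda>_. 1"] assms
  by (simp_all add: primitive_root_power_eq_1_iff[OF e d_pos] invar_def mdeg_n)

lemma invariant_ring_Gamma:
  "invariant_ring n (Gamma n e \<alpha>) = {p. \<forall>m\<in>Poly_Mapping.keys p. invar m}"
proof -
  have G: "Gamma n e \<alpha> = generate (GL (Suc n)) (mat_diag (Suc n) ` {\<lambda>i. e ^ \<alpha> i})"
    by (simp add: Gamma_def)
  show ?thesis
    unfolding G by (subst invariant_ring_diag) (auto simp: e_nonzero polys_def char_iff invar_def)
qed

lemma invariant_ring_Gamma_bar:
  "invariant_ring n (Gamma_bar n e \<alpha>) = {p. \<forall>m\<in>Poly_Mapping.keys p. invar m \<and> d dvd mdeg m}"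
proof -
  have G: "Gamma_bar n e \<alpha> = generate (GL (Suc n)) (mat_diag (Suc n) ` {\<lambda>i. e ^ \<alpha> i, \<lambda>_. e})"
    by (simp add: Gamma_bar_def)
  show ?thesis
    unfolding G by (subst invariant_ring_diag) (auto simp: e_nonzero polys_def char_iff invar_def)
qed

text \<open>The scalar matrix acts trivially on monomials of degree \<open>d\<close>, so both groups
  give the same set.\<close>

lemma invariant_monomials_eq_V:
  "invariant_monomials n d (Gamma n e \<alpha>) = V" "invariant_monomials n d (Gamma_bar n e \<alpha>) = V"
  by (auto simp: invariant_monomials_def invariant_ring_Gamma invariant_ring_Gamma_bar V_def)

lemma C_d1_eq: "C_d1 n d e \<alpha> = {m \<in> V. \<forall>i\<le>n. Poly_Mapping.lookup m i \<noteq> 0}"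
  by (auto simp: C_d1_def invariant_monomials_eq_V)

text \<open>Surjectivity of the presentation is what gives \<open>coordinate_ring_regularity\<close>
  a specified value.\<close>

lemma subst_Mon_image: "subst Mon ` polys V = (invariant_ring n (Gamma_bar n e \<alpha>) :: (nat, 'a) mpoly set)"
proof (intro equalityI subsetI)
  fix q :: "(nat, 'a) mpoly" assume "q \<in> subst Mon ` polys V"
  then obtain p where p: "p \<in> polys V" "q = subst Mon p" by blast
  then have "invar u \<and> d dvd mdeg u" if "u \<in> Poly_Mapping.keys q" for u
    using keys_subst_Mon[of p] that monom_image_invar by (fastforce simp: polys_def)
  then show "q \<in> invariant_ring n (Gamma_bar n e \<alpha>)" by (simp add: invariant_ring_Gamma_bar)
next
  fix q :: "(nat, 'a) mpoly" assume "q \<in> invariant_ring n (Gamma_bar n e \<alpha>)"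
  then have "\<forall>u\<in>Poly_Mapping.keys q. \<exists>m. Poly_Mapping.keys m \<subseteq> V \<and> monom_image m = u"
    using monom_image_surj by (fastforce simp: invariant_ring_Gamma_bar dvd_def)
  then obtain g where g: "\<forall>u\<in>Poly_Mapping.keys q. Poly_Mapping.keys (g u) \<subseteq> V \<and> monom_image (g u) = u"
    by metis
  define p where "p = (\<Sum>u\<in>Poly_Mapping.keys q. Poly_Mapping.single (g u) (Poly_Mapping.lookup q u))"
  have "p \<in> polys V"
    unfolding p_def using g by (intro polys_sum) (auto simp: polys_def)
  moreover have "subst Mon p = (\<Sum>u\<in>Poly_Mapping.keys q. Poly_Mapping.single u (Poly_Mapping.lookup q u))"
    unfolding p_def subst_Mon_sum subst_Mon_single using g by (intro sum.cong) auto
  ultimately show "q \<in> subst Mon ` polys V" using sum_single_keys[of q] by (metis image_eqI)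
qed

lemma reg_invariant_ring_eq:
  "reg_invariant_ring n d e \<alpha> = ideal_regularity V (presentation_kernel V (Mon :: _ \<Rightarrow> (nat, 'a) mpoly))"
  by (simp add: reg_invariant_ring_def coordinate_ring_regularity_def invariant_monomials_eq_V subst_Mon_image)

end

section \<open>The top degree of the Artinian reduction\<close>

context
  assumes n: "2 \<le> n" "n < d"
begin

text \<open>Zero-sum vectors of weight \<open>d\<close> are added one at a time, each chosen inside
  the slack \<open>d - 1 - w i\<close> that keeps all exponents below \<open>d\<close>.\<close>

lemma reduced_vector_exists:
  "k \<le> n - 1 \<Longrightarrow> \<exists>w. (\<forall>i. w i < d) \<and> (\<forall>i>n. w i = 0) \<and> (\<Sum>i\<le>n. w i) = k * d \<and> d dvd (\<Sum>i\<le>n. \<alpha> i * w i)"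
proof (induction k)
  case 0
  then show ?case using d_pos by (intro exI[of _ "\<lambda>_. 0"]) auto
next
  case (Suc k)
  then obtain w where w: "\<forall>i. w i < d" "\<forall>i>n. w i = 0" "(\<Sum>i\<le>n. w i) = k * d" "d dvd (\<Sum>i\<le>n. \<alpha> i * w i)"
    by auto
  define u where "u i = d - 1 - w i" for i
  have uw: "u i + w i = d - 1" for i using w(1)[rule_format, of i] by (simp add: u_def)
  have "(\<Sum>i\<le>n. u i) + (\<Sum>i\<le>n. w i) = (n + 1) * (d - 1)"
    using uw by (simp flip: sum.distrib)
  moreover have "(n + 1) * (d - 1) + (n + 1) = n * d + d"
    using d_pos by (cases d) (simp_all add: algebra_simps)
  \<comment> \<open>Since \<open>k + 2 \<le> n\<close>, the total slack is at least 3d - n - 1, and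
    \<open>n < d\<close> makes this at least 2d - 1.\<close>
  moreover have "(k + 2) * d \<le> n * d" using Suc.prems n by (intro mult_le_mono1) simp
  moreover have "(k + 2) * d = k * d + 2 * d" by (simp add: algebra_simps)
  ultimately have "2 * d - 1 \<le> (\<Sum>i\<le>n. u i)" using w(3) n by linarith
  then obtain w' where w': "\<forall>i. w' i \<le> u i" "\<forall>i>n. w' i = 0" "(\<Sum>i\<le>n. w' i) = d" "d dvd (\<Sum>i\<le>n. \<alpha> i * w' i)"
    using zero_sum_subvector[OF d_pos] by blast
  have "w i + w' i < d" for i using w'(1)[rule_format, of i] uw[of i] d_pos by linarith
  then show ?case
    using w w' by (intro exI[of _ "\<lambda>i. w i + w' i"]) (auto simp: sum.distrib distrib_left)
qed

lemma reduced_monomial_exists: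
  assumes "k \<le> n - 1"
  shows "\<exists>u. invar u \<and> mdeg u = d * k \<and> (\<forall>i. Poly_Mapping.lookup u i < d)"
proof -
  obtain w where w: "\<forall>i. w i < d" "(\<Sum>i\<le>n. w i) = k * d" "d dvd (\<Sum>i\<le>n. \<alpha> i * w i)"
    using reduced_vector_exists[OF assms] by blast
  have "mdeg (vec_monom n w) = d * k"
    using w(2) mdeg_n[OF keys_vec_monom] by (simp add: mult.commute)
  moreover have "invar (vec_monom n w)"
    using w(3) keys_vec_monom[of n w] by (simp add: invar_def)
  ultimately show ?thesis using w(1) d_pos by (intro exI[of _ "vec_monom n w"]) simp
qed

text \<open>A reduced invariant monomial of degree \<open>d\<close>, available since
  \<open>2 \<le> n\<close>, is a variable of S outside \<open>Th\<close>. So the extremal position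
  is positive.\<close>

lemma card_V_gt: "card (V - Th) > 0"
proof -
  obtain u where u: "invar u" "mdeg u = d" "\<forall>i. Poly_Mapping.lookup u i < d"
    using reduced_monomial_exists[of 1] n by force
  have "u \<notin> Th"
  proof
    assume "u \<in> Th"
    then obtain i where "u = Poly_Mapping.single i d" by (auto simp: Th_def)
    then show False using u(3)[rule_format, of i] by simp
  qed
  then have "u \<in> V - Th" using u by (simp add: V_def)
  then show ?thesis using finite_V by (metis card_gt_0_iff empty_iff finite_Diff)
qed

text \<open>This exchanges reduced invariant monomials of degree kd with invariant monomials of
  degree (n + 1 - k)d whose exponents all lie between 1 and \<open>d\<close>.\<close>

definition complement :: "(nat \<Rightarrow>\<^sub>0 nat) \<Rightarrow> nat \<Rightarrow>\<^sub>0 nat" where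
  "complement u = vec_monom n (\<lambda>i. d - Poly_Mapping.lookup u i)"

lemma complement:
  assumes "invar u" "\<forall>i. Poly_Mapping.lookup u i \<le> d"
  shows "invar (complement u)" "mdeg (complement u) + mdeg u = (n + 1) * d"
proof -
  have sum: "(\<Sum>i\<le>n. \<alpha> i * (d - Poly_Mapping.lookup u i)) + (\<Sum>i\<le>n. \<alpha> i * Poly_Mapping.lookup u i) =
      (\<Sum>i\<le>n. \<alpha> i * d)"
    using assms(2) by (simp flip: sum.distrib distrib_left)
  have "d dvd (\<Sum>i\<le>n. \<alpha> i * (d - Poly_Mapping.lookup u i)) + (\<Sum>i\<le>n. \<alpha> i * Poly_Mapping.lookup u i)"
    unfolding sum by (simp add: dvd_sum)
  moreover have "d dvd (\<Sum>i\<le>n. \<alpha> i * Poly_Mapping.lookup u i)" using assms(1) by (simp add: invar_def)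
  ultimately have "d dvd (\<Sum>i\<le>n. \<alpha> i * (d - Poly_Mapping.lookup u i))"
    using dvd_add_left_iff by blast
  then show "invar (complement u)"
    using keys_vec_monom by (simp add: invar_def complement_def)
  have "mdeg (complement u) = (\<Sum>i\<le>n. d - Poly_Mapping.lookup u i)"
    unfolding complement_def by (subst mdeg_n[OF keys_vec_monom]) simp
  moreover have "mdeg u = (\<Sum>i\<le>n. Poly_Mapping.lookup u i)" using assms(1) by (simp add: mdeg_n invar_def)
  ultimately show "mdeg (complement u) + mdeg u = (n + 1) * d"
    using assms(2) by (simp flip: sum.distrib)
qed

lemma reduced_mdeg_less:
  assumes "invar u" "\<forall>i\<le>n. Poly_Mapping.lookup u i < d"
  shows "mdeg u < (n + 1) * d"
proof -
  have "mdeg u = (\<Sum>i\<le>n. Poly_Mapping.lookup u i)" using assms(1) by (simp add: mdeg_n invar_def)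
  also have "\<dots> < (\<Sum>i\<le>n. d)" using assms(2) by (intro sum_strict_mono) auto
  finally show ?thesis by simp
qed

text \<open>Reduced monomials have degree below (n + 1)d, so \<open>n\<close> bounds the top degree;
  the complement of an interior monomial of degree \<open>d\<close> attains it.\<close>

lemma toric_top_interior:
  assumes "\<exists>m\<in>V. \<forall>i\<le>n. Poly_Mapping.lookup m i \<noteq> 0"
  shows "toric_top n d \<alpha> (int n)"
proof unfold_locales
  fix u :: "nat \<Rightarrow>\<^sub>0 nat" and c :: int assume u: "invar u" "int (mdeg u) = int d * c" "int n < c"
  show "\<exists>i\<le>n. d \<le> Poly_Mapping.lookup u i"
  proof (rule ccontr)
    assume "\<not> ?thesis"
    then have "mdeg u < (n + 1) * d" using reduced_mdeg_less u(1) by (meson not_le)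
    then have "int d * c < int d * (int n + 1)" using u(2) by (simp add: algebra_simps flip: of_nat_mult of_nat_add)
    then show False using u(3) d_pos by (simp add: mult_less_cancel_left)
  qed
next
  obtain m where m: "m \<in> V" "\<forall>i\<le>n. Poly_Mapping.lookup m i \<noteq> 0" using assms by blast
  have m': "invar m" "mdeg m = d" "\<forall>i. Poly_Mapping.lookup m i \<le> d"
  proof -
    show "invar m" "mdeg m = d" using m(1) by (simp_all add: V_def)
    then have "(\<Sum>i\<le>n. Poly_Mapping.lookup m i) = d" using mdeg_n by (simp add: invar_def)
    then have "Poly_Mapping.lookup m i \<le> d" if "i \<le> n" for i
      using member_le_sum[of i "{..n}" "Poly_Mapping.lookup m"] that by simp
    moreover have "Poly_Mapping.lookup m i = 0" if "i > n" for i
    proof -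
      have "i \<notin> Poly_Mapping.keys m" using \<open>invar m\<close> that by (auto simp: invar_def)
      then show ?thesis by (simp add: in_keys_iff)
    qed
    ultimately show "\<forall>i. Poly_Mapping.lookup m i \<le> d" by (metis le0 not_le)
  qed
  have "mdeg (complement m) = d * n" using complement(2)[OF m'(1,3)] m'(2) by simp
  moreover have "Poly_Mapping.lookup (complement m) i < d" for i
    using m(2) d_pos by (simp add: complement_def)
  ultimately show "\<exists>u. invar u \<and> int (mdeg u) = int d * int n \<and> (\<forall>i. Poly_Mapping.lookup u i < d)"
    using complement(1)[OF m'(1,3)] by (intro exI[of _ "complement m"]) simp
qed

text \<open>A reduced monomial of degree nd would have an interior complement of degree
  \<open>d\<close>; degree (n - 1)d is attained by the zero-sum construction.\<close>

lemma toric_top_no_interior: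
  assumes "\<not> (\<exists>m\<in>V. \<forall>i\<le>n. Poly_Mapping.lookup m i \<noteq> 0)"
  shows "toric_top n d \<alpha> (int n - 1)"
proof unfold_locales
  fix u :: "nat \<Rightarrow>\<^sub>0 nat" and c :: int assume u: "invar u" "int (mdeg u) = int d * c" "int n - 1 < c"
  show "\<exists>i\<le>n. d \<le> Poly_Mapping.lookup u i"
  proof (rule ccontr)
    assume "\<not> ?thesis"
    then have lt: "\<forall>i\<le>n. Poly_Mapping.lookup u i < d" by (meson not_le)
    then have "mdeg u < (n + 1) * d" using reduced_mdeg_less u(1) by blast
    then have "int d * c < int d * (int n + 1)" using u(2) by (simp add: algebra_simps flip: of_nat_mult of_nat_add)
    then have "c < int n + 1" using d_pos by (simp add: mult_less_cancel_left)
    then have "c = int n" using u(3) by simp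
    then have "int (mdeg u) = int (d * n)" using u(2) by simp
    then have deg: "mdeg u = d * n" by linarith
    have "Poly_Mapping.lookup u i \<le> d" for i
    proof (cases "i \<le> n")
      case True
      then show ?thesis using lt by (simp add: less_imp_le)
    next
      case False
      then have "i \<notin> Poly_Mapping.keys u" using u(1) by (auto simp: invar_def)
      then show ?thesis by (simp add: in_keys_iff)
    qed
    then have le: "\<forall>i. Poly_Mapping.lookup u i \<le> d" by blast
    have "complement u \<in> V"
      using complement[OF u(1) le] deg by (simp add: V_def)
    moreover have "\<forall>i\<le>n. Poly_Mapping.lookup (complement u) i \<noteq> 0"
      using lt by (simp add: complement_def not_le)
    ultimately show False using assms by blast
  qed
next
  show "\<exists>u. invar u \<and> int (mdeg u) = int d * (int n - 1) \<and> (\<forall>i. Poly_Mapping.lookup u i < d)"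
    using reduced_monomial_exists[of "n - 1"] n by (auto simp: of_nat_diff)
qed

end

end

context toric_top
begin

text \<open>Every resolution gives the upper bound, the constructed one the lower. The hypothesis
  places the extremal generator at a positive position, hence in the resolution of the ideal and not
  at S itself.\<close>

lemma ideal_regularity_eq:
  assumes "card (V - Th) > 0"
  shows "ideal_regularity V (presentation_kernel V (Mon :: _ \<Rightarrow> (nat, 'a::field) mpoly)) = ereal (real_of_int (t + 1))"
  unfolding ideal_regularity_def
proof (rule Sup_eqI)
  let ?I = "presentation_kernel V (Mon :: _ \<Rightarrow> (nat, 'a) mpoly)"
  fix x assume "x \<in> {ereal (real (a i j) - real i) | a i j.
    \<exists>b g D. minimal_graded_free_resolution V ?I b a g D \<and> j < b i}"
  then obtain a i j b g D where x: "x = ereal (real (a i j) - real i)"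
    and res: "minimal_graded_free_resolution V ?I b a g D" and j: "j < b i" by blast
  \<comment> \<open>Position \<open>i\<close> over the ideal is position \<open>Suc i\<close> of the
    complex, which accounts for the 1 in \<open>t + 1\<close>.\<close>
  have "int (a i j) \<le> int (Suc i) + t"
    using toric_complex.generator_degree_le[OF resolution_toric_complex[OF res], of j "Suc i" "int (a i j)"] j
    by simp
  then have "real_of_int (int (a i j)) \<le> real_of_int (int (Suc i) + t)" by (simp only: of_int_le_iff)
  then show "x \<le> ereal (real_of_int (t + 1))" by (simp add: x)
next
  let ?I = "presentation_kernel V (Mon :: _ \<Rightarrow> (nat, 'a) mpoly)"
  fix y :: ereal assume y: "\<And>x. x \<in> {ereal (real (a i j) - real i) | a i j.
    \<exists>b g D. minimal_graded_free_resolution V ?I b a g D \<and> j < b i} \<Longrightarrow> x \<le> y"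
  obtain rk dg and mt :: "nat \<Rightarrow> nat \<Rightarrow> nat \<Rightarrow> (nat \<Rightarrow>\<^sub>0 nat, 'a) mpoly" where
    T: "\<And>D. toric_complex n d \<alpha> rk dg mt D t" using toric_complex_exists by metis
  obtain N where N: "card (V - Th) = Suc N" using assms by (cases "card (V - Th)") auto
  obtain j where j: "j < rk (Suc N)" "int (dg (Suc N) j) = int (Suc N) + t"
    using toric_complex.extremal_generator[OF T, of "int (Suc N) + t"] N by auto
  have "ereal (real (dg (Suc N) j) - real N) \<le> y"
    by (rule y, rule CollectI, intro exI conjI)
      (rule refl, rule toric_complex_resolution[OF T], rule j(1))
  moreover have "real (dg (Suc N) j) - real N = real_of_int (t + 1)"
  proof -
    have "real_of_int (int (dg (Suc N) j)) = real_of_int (int (Suc N) + t)" by (simp only: j(2))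
    then show ?thesis by simp
  qed
  ultimately show "ereal (real_of_int (t + 1)) \<le> y" by simp
qed

end

theorem theorem4p10:
  fixes n d :: nat and \<alpha> :: "nat \<Rightarrow> nat"
    and e :: "'a :: {alg_closed_field, field_char_0}"
  assumes "2 \<le> n" and "n < d"
    and "primitive_root d e"
    and "\<forall>i j. i \<le> j \<and> j \<le> n \<longrightarrow> \<alpha> i \<le> \<alpha> j"
    and "\<alpha> n < d"
    and "Gcd (insert d (\<alpha> ` {..n})) = 1"
    and "\<exists>i\<le>n. \<exists>j\<le>n. i \<noteq> j \<and> \<alpha> i < \<alpha> j"
  shows "ereal (real n) \<le> reg_invariant_ring n d e \<alpha>
    \<and> reg_invariant_ring n d e \<alpha> \<le> ereal (real (n + 1))
    \<and> (reg_invariant_ring n d e \<alpha> = ereal (real (n + 1)) \<longleftrightarrow> C_d1 n d e \<alpha> \<noteq> {})"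
proof -
  interpret toric n d \<alpha> using assms(2) by unfold_locales simp
  note reg = reg_invariant_ring_eq[OF assms(3)]
  note pos = card_V_gt[OF assms(1,2)]
  show ?thesis
  proof (cases "\<exists>m\<in>V. \<forall>i\<le>n. Poly_Mapping.lookup m i \<noteq> 0")
    case True
    then have "reg_invariant_ring n d e \<alpha> = ereal (real (n + 1))"
      using toric_top.ideal_regularity_eq[OF toric_top_interior[OF assms(1,2)] pos, where 'a = 'a]
      by (simp add: reg)
    then show ?thesis using True by (auto simp: C_d1_eq[OF assms(3)])
  next
    case False
    then have "reg_invariant_ring n d e \<alpha> = ereal (real n)"
      using toric_top.ideal_regularity_eq[OF toric_top_no_interior[OF assms(1,2)] pos, where 'a = 'a]
      by (simp add: reg)
    then show ?thesis using False by (auto simp: C_d1_eq[OF assms(3)])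
  qed
qed

end
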